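(* There are absolute constants $C\ge 1$, $c>0$ such that the following holds. Let $N$ be a positive integer, $\delta>0$, and let $f_0, f_1, f_2 : \mathbb{Z}^2 \to \mathbb{C}$ be bounded by $1$ in modulus. Let $\mu_N(d) := \frac{1}{N}\big(1-\frac{|d|}{N}\big)_+$ for $d\in\mathbb{Z}$ and $$\Lambda_N(f_0, f_1, f_2) := \mathbb{E}_{x \in [N]}\mathbb{E}_{y \in [N^2]}\sum_{d\in\mathbb{Z}} \mu_N(d)f_0(x,y)f_1(x+d,y) f_2(x,y+d^2).$$ If $|\Lambda_N(f_0,f_1, f_2)| \geq \delta$, then either $N \leq C\delta^{-C}$, or there exist $\alpha \in \mathbb{T}$ and a positive integer $q \leq C\delta^{-C}$ with $\|q\alpha\|_{\mathbb{T}} \leq C\delta^{-C}/N^2$ such that $$\mathbb{E}_{x\in[N]} \Big|\mathbb{E}_{y \in [2N^2]} f_2(x, y)\, e(\alpha y)\Big| \geq c\,\delta^{C}.$$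
   Context: $[X]=\{1,\dots,\lfloor X\rfloor\}$, $t_+=\max\{t,0\}$, $\mathbb{E}_{s\in S}$ is the average over a finite set $S$; $\mathbb{T}=\mathbb{R}/\mathbb{Z}$, $\|\cdot\|_{\mathbb{T}}$ is distance to the nearest integer, $e(t)=e^{2\pi i t}$. *)

theory Defs
  imports "HOL-Analysis.Analysis"
begin

definition interval_upto :: "real \<Rightarrow> int set" where
  "interval_upto X = {1..\<lfloor>X\<rfloor>}"

definition average :: "'a set \<Rightarrow> ('a \<Rightarrow> 'b) \<Rightarrow> 'b::real_vector" where
  "average S g = (\<Sum>s\<in>S. g s) /\<^sub>R real (card S)"

definition pos_part :: "real \<Rightarrow> real" where
  "pos_part t = max t 0"

text \<open>
  An element of \<open>\<real>/\<int>\<close> is given by an arbitrary real representative. Both functions below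
  are meant for such representatives: \<open>norm_circle\<close> is 1-periodic, and so is
  \<open>t \<mapsto> echar (t * y)\<close> for every integer \<open>y\<close>.
\<close>

definition norm_circle :: "real \<Rightarrow> real" where
  "norm_circle t = infdist t \<int>"

definition echar :: "real \<Rightarrow> complex" where
  "echar t = exp (2 * of_real pi * \<i> * of_real t)"

definition mu :: "nat \<Rightarrow> int \<Rightarrow> real" where
  "mu N d = 1 / real N * pos_part (1 - of_int \<bar>d\<bar> / real N)"

text \<open>For \<open>N > 0\<close> the sum over \<open>d\<close> has finite support, since \<open>mu N d = 0\<close> unless \<open>\<bar>d\<bar> < N\<close>.\<close>

definition Lambda ::
  "nat \<Rightarrow> (int \<times> int \<Rightarrow> complex) \<Rightarrow> (int \<times> int \<Rightarrow> complex) \<Rightarrow> (int \<times> int \<Rightarrow> complex) \<Rightarrow> complex" where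
  "Lambda N f0 f1 f2 =
     average (interval_upto (real N)) (\<lambda>x.
       average (interval_upto (real N ^ 2)) (\<lambda>y.
         \<Sum>\<^sub>\<infinity>d\<in>UNIV. of_real (mu N d) * f0 (x, y) * f1 (x + d, y) * f2 (x, y + d ^ 2)))"

end

theory Submission
  imports Defs
begin

text \<open>Put \<open>M = 2 N\<^sup>2\<close> and regard the functions \<open>\<phi> x = f2 (x, -)\<close> as functions on \<open>\<int>/M\<int>\<close>. Two
  applications of Cauchy--Schwarz remove \<open>f1\<close> and \<open>f0\<close>, so that for many pairs \<open>x, x'\<close> the dual function
  \<open>H y = E u. \<phi> x (y + u\<^sup>2) * cnj (\<phi> x' (y + (u + x - x')\<^sup>2))\<close> has large \<open>L\<^sup>2\<close> norm. Such an \<open>H\<close> has a large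
  Fourier coefficient: linearizing by van der Corput differencing and concatenating the resulting
  directions shows that many second multiplicative derivatives of \<open>H\<close> have a large Fourier coefficient,
  and two rounds of degree lowering (Peluse and Prendiville) pass from second derivatives to first
  derivatives and then to \<open>H\<close>. Here the Weyl sum bound forces the alternating sums of the frequencies
  that occur into the major arcs, of which there are only polynomially many.

  Expanding \<open>\<phi> x\<close> and \<open>\<phi> x'\<close> in Fourier series turns that coefficient of \<open>H\<close> into an average of
  \<open>\<bar>ft M (\<phi> x') j\<bar>\<^sup>2\<close> against quadratic exponential sums in which \<open>x - x'\<close> multiplies \<open>j\<close> in the linear
  coefficient. By Weyl and Vinogradov the average of these sums over \<open>x\<close> is small unless \<open>j\<close> is a major
  frequency; pigeonholing over the major frequencies gives one \<open>j\<close> that works on average over \<open>x'\<close>.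
  All dependencies are powers of a parameter \<open>K \<ge> 2\<close> comparable to \<open>1 / \<delta>\<close>.\<close>

section \<open>Averages\<close>

text \<open>The modulus \<open>M = 2 N\<^sup>2\<close> is dictated by the configuration:
  \<open>y\<close> and \<open>d\<^sup>2\<close> are at most \<open>N\<^sup>2\<close>, so
  \<open>y + d\<^sup>2\<close> never wraps around, and the average over a range of length
  \<open>2 N\<^sup>2\<close> in the conclusion is exactly a Fourier coefficient modulo
  \<open>M\<close>. Two obstacles shape the proof. Losses must stay polynomial, so no inverse
  theorem for higher uniformity norms is invoked. Degree lowering replaces it: \<open>H\<close> is
  itself an average over \<open>u\<close>, so one copy of \<open>H\<close> inside a derivative can
  be opened, after which the remaining copies are removed by Cauchy--Schwarz and a quadratic
  configuration twisted by differences of frequencies is left. Moreover the frequency must be the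
  same for all \<open>x\<close>, while the large coefficient of \<open>H\<close> depends on the pair
  \<open>x, x'\<close>. This is why the argument returns from \<open>H\<close> to \<open>f2\<close>
  through the dependence on \<open>x - x'\<close>, which leaves only few competing frequencies.
  Concatenation is needed because the differencing steps are products of numbers below
  \<open>N\<close>, not arbitrary residues modulo \<open>M\<close>; linear forms in two such numbers
  cover the residues evenly once degenerate coefficients are excluded.\<close>

lemma average_real: "average S (g :: 'a \<Rightarrow> real) = sum g S / real (card S)"
  by (simp add: average_def divide_inverse mult.commute)

lemma average_complex: "average S (g :: 'a \<Rightarrow> complex) = sum g S / of_nat (card S)"
  by (simp add: average_def scaleR_conv_of_real divide_inverse mult.commute)

lemma average_cong: "(\<And>a. a \<in> S \<Longrightarrow> f a = g a) \<Longrightarrow> average S f = average S g"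
  by (simp add: average_def)

lemma average_swap:
  "average A (\<lambda>a. average B (\<lambda>b. f a b)) = average B (\<lambda>b. average A (\<lambda>a. f a b))"
  by (simp add: average_def scaleR_sum_right mult.commute sum.swap[of _ B A])

lemma average_Times:
  "average (A \<times> B) f = average A (\<lambda>a. average B (\<lambda>b. f (a, b)))"
  by (simp add: average_def scaleR_sum_right sum.cartesian_product card_cartesian_product)

lemma average_add: "average S (\<lambda>a. f a + g a) = average S f + average S g"
  by (simp add: average_def sum.distrib scaleR_add_right)

lemma average_diff: "average S (\<lambda>a. f a - g a) = average S f - average S g"
  by (simp add: average_def sum_subtractf scaleR_diff_right)

lemma average_mult_left: "average S (\<lambda>a. c * f a) = c * average S (f :: _ \<Rightarrow> 'b::real_algebra)"
  by (simp add: average_def sum_distrib_left[symmetric])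

lemma average_mult_right: "average S (\<lambda>a. f a * c) = average S (f :: _ \<Rightarrow> 'b::real_algebra) * c"
  by (simp add: average_def sum_distrib_right[symmetric])

lemma average_sum: "average S (\<lambda>a. \<Sum>i\<in>I. f a i) = (\<Sum>i\<in>I. average S (\<lambda>a. f a i))"
  by (simp add: average_def scaleR_sum_right sum.swap[of _ I S])

lemma average_const: "finite S \<Longrightarrow> S \<noteq> {} \<Longrightarrow> average S (\<lambda>_. c) = c"
  by (simp add: average_def sum_constant_scaleR)

lemma average_cnj: "average S (\<lambda>a. cnj (f a)) = cnj (average S f)"
  by (simp add: average_complex)

lemma average_of_real: "average S (\<lambda>a. complex_of_real (f a)) = complex_of_real (average S f)"
  by (simp add: average_complex average_real)

lemma average_mono:
  "(\<And>a. a \<in> S \<Longrightarrow> f a \<le> g a) \<Longrightarrow> average S f \<le> average S (g :: _ \<Rightarrow> real)"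
  by (simp add: average_real divide_right_mono sum_mono)

lemma average_nonneg: "(\<And>a. a \<in> S \<Longrightarrow> 0 \<le> f a) \<Longrightarrow> 0 \<le> average S (f :: _ \<Rightarrow> real)"
  by (simp add: average_real sum_nonneg)

text \<open>An empty or infinite set has average 0, which is the reason for
  \<open>0 \<le> c\<close>.\<close>

lemma average_le:
  assumes "\<And>a. a \<in> S \<Longrightarrow> f a \<le> c" "0 \<le> c"
  shows "average S (f :: _ \<Rightarrow> real) \<le> c"
proof (cases "card S = 0")
  case False
  have "sum f S \<le> real (card S) * c" using assms by (intro sum_bounded_above) auto
  with False show ?thesis by (simp add: average_real divide_simps mult.commute)
qed (use assms in \<open>simp add: average_real\<close>)

lemma norm_average_le: "norm (average S f) \<le> average S (\<lambda>a. norm (f a))"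
  by (simp add: average_def divide_inverse mult_left_mono norm_sum)

lemma norm_average_le_const:
  "(\<And>a. a \<in> S \<Longrightarrow> norm (f a) \<le> c) \<Longrightarrow> 0 \<le> c \<Longrightarrow> norm (average S f) \<le> c"
  by (rule order_trans[OF norm_average_le average_le])

lemma average_exists_ge:
  assumes "finite S" "c \<le> average S (f :: _ \<Rightarrow> real)" "S \<noteq> {}"
  shows "\<exists>a\<in>S. c \<le> f a"
proof (rule ccontr)
  assume "\<not> ?thesis"
  then have "sum f S < (\<Sum>a\<in>S. c)" using assms by (intro sum_strict_mono) auto
  moreover have "card S > 0" using assms by (simp add: card_gt_0_iff)
  ultimately show False using assms(2) by (simp add: average_real field_simps)
qed

lemma average_square_le: "(average S (f :: _ \<Rightarrow> real))\<^sup>2 \<le> average S (\<lambda>a. (f a)\<^sup>2)"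
proof (cases "card S = 0")
  case False
  have "(\<Sum>a\<in>S. f a * 1)\<^sup>2 \<le> (\<Sum>a\<in>S. (f a)\<^sup>2) * (\<Sum>a\<in>S. 1\<^sup>2)" by (rule Cauchy_Schwarz_ineq_sum)
  with False show ?thesis by (simp add: average_real field_simps power2_eq_square)
qed (simp add: average_real)

lemma average_power4_le: "(average S (f :: _ \<Rightarrow> real)) ^ 4 \<le> average S (\<lambda>a. (f a) ^ 4)"
proof -
  have "(average S f) ^ 4 = ((average S f)\<^sup>2)\<^sup>2" by simp
  also have "\<dots> \<le> (average S (\<lambda>a. (f a)\<^sup>2))\<^sup>2" by (intro power_mono average_square_le) auto
  also have "\<dots> \<le> average S (\<lambda>a. ((f a)\<^sup>2)\<^sup>2)" by (rule average_square_le)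
  finally show ?thesis by simp
qed

lemma average_power8_le: "(average S (f :: _ \<Rightarrow> real)) ^ 8 \<le> average S (\<lambda>a. (f a) ^ 8)"
proof -
  have "(average S f) ^ 8 = ((average S f)\<^sup>2) ^ 4" by (simp flip: power_mult)
  also have "\<dots> \<le> (average S (\<lambda>a. (f a)\<^sup>2)) ^ 4" by (intro power_mono average_square_le) auto
  also have "\<dots> \<le> average S (\<lambda>a. ((f a)\<^sup>2) ^ 4)" by (rule average_power4_le)
  finally show ?thesis by (simp flip: power_mult)
qed

lemma norm_average_square_le: "(norm (average S f))\<^sup>2 \<le> average S (\<lambda>a. (norm (f a))\<^sup>2)"
  by (rule order_trans[OF power_mono[OF norm_average_le] average_square_le]) auto

lemma average_norm_square:
  "complex_of_real ((norm (average B z))\<^sup>2) = average B (\<lambda>b. average B (\<lambda>b'. z b * cnj (z b')))"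
  by (simp add: complex_norm_square average_mult_left average_mult_right average_cnj del: of_real_power)

text \<open>The Cauchy--Schwarz step of van der Corput type: the weight \<open>w\<close> does not depend on \<open>b\<close>.\<close>

lemma average_eliminate_aux:
  assumes "\<And>\<tau> y. norm (w \<tau> y) \<le> 1"
  shows "(norm (average T (\<lambda>\<tau>. average Y (\<lambda>y. w \<tau> y * average B (\<lambda>b. z b \<tau> y)))))\<^sup>2
    \<le> norm (average B (\<lambda>b. average B (\<lambda>b'.
        average T (\<lambda>\<tau>. average Y (\<lambda>y. z b \<tau> y * cnj (z b' \<tau> y))))))"
proof -
  let ?Z = "\<lambda>\<tau> y. average B (\<lambda>b. z b \<tau> y)"
  have "(norm (average T (\<lambda>\<tau>. average Y (\<lambda>y. w \<tau> y * ?Z \<tau> y))))\<^sup>2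
      \<le> average T (\<lambda>\<tau>. average Y (\<lambda>y. (norm (w \<tau> y * ?Z \<tau> y))\<^sup>2))"
    by (rule order_trans[OF norm_average_square_le average_mono]) (rule norm_average_square_le)
  also have "\<dots> \<le> average T (\<lambda>\<tau>. average Y (\<lambda>y. (norm (?Z \<tau> y))\<^sup>2))"
    using assms by (intro average_mono power_mono) (auto simp: norm_mult mult_left_le_one_le)
  also have "\<dots> = norm (complex_of_real (average T (\<lambda>\<tau>. average Y (\<lambda>y. (norm (?Z \<tau> y))\<^sup>2))))"
    by (simp add: average_nonneg)
  also have "complex_of_real (average T (\<lambda>\<tau>. average Y (\<lambda>y. (norm (?Z \<tau> y))\<^sup>2)))
      = average T (\<lambda>\<tau>. average Y (\<lambda>y. average B (\<lambda>b. average B (\<lambda>b'. z b \<tau> y * cnj (z b' \<tau> y)))))"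
    by (simp only: average_of_real[symmetric] average_norm_square)
  also have "\<dots> = average T (\<lambda>\<tau>. average B (\<lambda>b. average B (\<lambda>b'. average Y (\<lambda>y. z b \<tau> y * cnj (z b' \<tau> y)))))"
    by (simp only: average_swap[of Y B])
  also have "\<dots> = average B (\<lambda>b. average B (\<lambda>b'. average T (\<lambda>\<tau>. average Y (\<lambda>y. z b \<tau> y * cnj (z b' \<tau> y)))))"
    by (simp only: average_swap[of T B])
  finally show ?thesis .
qed

text \<open>Taking the norm inside gives up all cancellation in \<open>b\<close> and
  \<open>b'\<close>. This is harmless wherever the remaining variables carry the argument;
  \<open>concatenate_aux\<close> has to use the previous form, since there part of the doubled
  variables is still to be exploited.\<close>

lemma average_eliminate:
  assumes "\<And>\<tau> y. norm (w \<tau> y) \<le> 1"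
  shows "(norm (average T (\<lambda>\<tau>. average Y (\<lambda>y. w \<tau> y * average B (\<lambda>b. z b \<tau> y)))))\<^sup>2
    \<le> average B (\<lambda>b. average B (\<lambda>b'.
        norm (average T (\<lambda>\<tau>. average Y (\<lambda>y. z b \<tau> y * cnj (z b' \<tau> y))))))"
  by (rule order_trans[OF average_eliminate_aux[OF assms]
        order_trans[OF norm_average_le average_mono]]) (rule norm_average_le)

section \<open>Periodic functions and their Fourier coefficients\<close>

text \<open>Functions on \<open>\<int>/M\<int>\<close> are represented by \<open>M\<close>-periodic functions on the integers;
  \<open>ubp\<close> stands for unit-bounded periodic.\<close>

definition ubp :: "int \<Rightarrow> (int \<Rightarrow> complex) \<Rightarrow> bool" where
  "ubp M F \<longleftrightarrow> (\<forall>y. F (y + M) = F y) \<and> (\<forall>y. norm (F y) \<le> 1)"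

lemma ubp_norm: "ubp M F \<Longrightarrow> norm (F y) \<le> 1"
  by (simp add: ubp_def)

lemma ubp_shift: "ubp M F \<Longrightarrow> ubp M (\<lambda>y. F (y + c))"
proof -
  assume "ubp M F"
  then have "F (y + M + c) = F (y + c)" for y
    unfolding ubp_def by (metis add.assoc add.commute)
  with \<open>ubp M F\<close> show ?thesis by (simp add: ubp_def)
qed

lemma ubp_shift': "ubp M F \<Longrightarrow> ubp M (\<lambda>y. F (y - c))"
  using ubp_shift[of M F "-c"] by simp

lemma ubp_cnj: "ubp M F \<Longrightarrow> ubp M (\<lambda>y. cnj (F y))"
  by (simp add: ubp_def)

lemma ubp_mult: "ubp M F \<Longrightarrow> ubp M G \<Longrightarrow> ubp M (\<lambda>y. F y * G y)"
  by (auto simp: ubp_def norm_mult intro: mult_le_one)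

lemma ubp_const: "norm c \<le> 1 \<Longrightarrow> ubp M (\<lambda>y. c)"
  by (simp add: ubp_def)

lemma ubp_average: "(\<And>i. i \<in> I \<Longrightarrow> ubp M (F i)) \<Longrightarrow> ubp M (\<lambda>y. average I (\<lambda>i. F i y))"
  by (auto simp: ubp_def intro!: norm_average_le_const average_cong)

lemmas ubp_intros = ubp_shift ubp_shift' ubp_cnj ubp_mult ubp_average

lemma periodic_multiple:
  assumes "\<And>y. F (y + M) = F (y :: int)"
  shows "F (y + k * M) = F y"
proof -
  have nat: "F (z + int n * M) = F z" for z n
  proof (induction n)
    case (Suc n)
    have "F (z + int (Suc n) * M) = F ((z + int n * M) + M)" by (simp add: algebra_simps)
    then show ?case using assms Suc by simp
  qed simp
  show ?thesis
  proof (cases "k \<ge> 0")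
    case True
    then show ?thesis using nat[of y "nat k"] by simp
  next
    case False
    then show ?thesis using nat[of "y + k * M" "nat (- k)"] by simp
  qed
qed

lemma periodic_mod: "(\<And>y. F (y + M) = F (y :: int)) \<Longrightarrow> F (y mod M) = F y"
  using periodic_multiple[of F M "y mod M" "y div M"] by simp

lemma bij_betw_mod_shift:
  assumes "M > (0::int)"
  shows "bij_betw (\<lambda>y. (y + c) mod M) {0..<M} {0..<M}"
proof (rule bij_betwI[where g = "\<lambda>y. (y - c) mod M"])
  show "(\<lambda>y. (y + c) mod M) \<in> {0..<M} \<rightarrow> {0..<M}" "(\<lambda>y. (y - c) mod M) \<in> {0..<M} \<rightarrow> {0..<M}"
    using assms by auto
  show "((x + c) mod M - c) mod M = x" if "x \<in> {0..<M}" for x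
    using that by (simp add: mod_simps)
  show "((x - c) mod M + c) mod M = x" if "x \<in> {0..<M}" for x
    using that by (simp add: mod_simps)
qed

lemma sum_periodic_shift:
  assumes "M > 0" "\<And>y. F (y + M) = F (y :: int)"
  shows "(\<Sum>y\<in>{0..<M}. F (y + c)) = sum F {0..<M}"
  using sum.reindex_bij_betw[OF bij_betw_mod_shift[OF assms(1)], of F c] periodic_mod[of F M] assms(2)
  by simp

lemma average_periodic_shift:
  assumes "M > 0" "\<And>y. F (y + M) = F (y :: int)"
  shows "average {0..<M} (\<lambda>y. F (y + c)) = average {0..<M} F"
  using sum_periodic_shift[of M F c] assms by (simp add: average_def)

lemma ubp_average_shift:
  assumes "M > 0" "ubp M F"
  shows "average {0..<M} (\<lambda>y. F (y + c)) = average {0..<M} F"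
  using assms by (intro average_periodic_shift) (auto simp: ubp_def)

lemma ubp_norm_average_le: "ubp M F \<Longrightarrow> norm (average {0..<M} F) \<le> 1"
  by (intro norm_average_le_const) (auto simp: ubp_norm)

section \<open>Additive characters modulo \<open>M\<close>\<close>

lemma echar_add: "echar (s + t) = echar s * echar t"
  by (simp add: echar_def exp_add[symmetric] algebra_simps)

lemma echar_cis: "echar t = cis (2 * pi * t)"
  by (simp add: echar_def cis_conv_exp mult_ac)

lemma norm_echar [simp]: "norm (echar t) = 1"
  by (simp add: echar_cis)

lemma echar_of_int [simp]: "echar (of_int n) = 1"
  by (simp add: echar_cis cis_multiple_2pi)

lemma echar_0 [simp]: "echar 0 = 1"
  by (simp add: echar_def)

lemma cnj_echar: "cnj (echar t) = echar (- t)"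
  by (simp add: echar_cis cis_cnj)

lemma echar_add_int [simp]: "echar (t + of_int n) = echar t"
  by (simp add: echar_add)

lemma echar_eq_1: "echar t = 1 \<Longrightarrow> t \<in> \<int>"
proof -
  assume "echar t = 1"
  then obtain n where "Im (2 * of_real pi * \<i> * of_real t) = of_int (2 * n) * pi"
    unfolding echar_def exp_eq_1 by auto
  then have "t = of_int n" by (simp add: field_simps)
  then show ?thesis by simp
qed

definition eM :: "int \<Rightarrow> int \<Rightarrow> complex" where
  "eM M n = echar (of_int n / of_int M)"

lemma eM_add: "eM M (a + b) = eM M a * eM M b"
  by (simp add: eM_def echar_add add_divide_distrib)

lemma eM_minus: "eM M (- a) = cnj (eM M a)"
  by (simp add: eM_def cnj_echar)

lemma eM_diff: "eM M (a - b) = eM M a * cnj (eM M b)"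
  using eM_add[of M a "-b"] by (simp add: eM_minus)

lemma norm_eM [simp]: "norm (eM M n) = 1"
  by (simp add: eM_def)

lemma eM_0 [simp]: "eM M 0 = 1"
  by (simp add: eM_def)

lemma eM_multiple: "M \<noteq> 0 \<Longrightarrow> eM M (k * M) = 1"
  by (simp add: eM_def)

lemma eM_cnj_cancel [simp]: "eM M n * cnj (eM M n) = 1" "cnj (eM M n) * eM M n = 1"
  by (simp_all add: complex_norm_square[symmetric] mult.commute[of "cnj _"])

lemma eM_periodic: "M \<noteq> 0 \<Longrightarrow> eM M (n + k * M) = eM M n"
  by (simp add: eM_add eM_multiple)

lemma ubp_eM: "M \<noteq> 0 \<Longrightarrow> ubp M (\<lambda>y. eM M (j * y))"
  using eM_multiple[of M j] by (simp add: ubp_def ring_distribs eM_add)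

lemma eM_eq_1: "M \<noteq> 0 \<Longrightarrow> eM M n = 1 \<longleftrightarrow> M dvd n"
proof
  assume "M \<noteq> 0" "eM M n = 1"
  then obtain k where "of_int n / of_int M = (of_int k :: real)"
    using echar_eq_1[of "of_int n / of_int M"] by (auto simp: eM_def elim: Ints_cases)
  then have "(of_int n :: real) = of_int (k * M)" using \<open>M \<noteq> 0\<close> by (simp add: field_simps)
  then have "n = k * M" by (simp only: of_int_eq_iff)
  then show "M dvd n" by simp
qed (auto simp: mult.commute[of M] eM_multiple elim!: dvdE)

text \<open>Shifting \<open>y\<close> by 1 multiplies the average by \<open>eM M n\<close> and
  leaves it unchanged, so it vanishes unless that factor is 1.\<close>

lemma average_eM:
  assumes "M > 0"
  shows "average {0..<M} (\<lambda>y. eM M (n * y)) = (if M dvd n then 1 else 0)"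
proof (cases "M dvd n")
  case True
  then have "M dvd n * y" for y by simp
  then have "eM M (n * y) = 1" for y using assms eM_eq_1[of M "n * y"] by simp
  then show ?thesis using assms True by (simp add: average_const)
next
  case False
  let ?S = "average {0..<M} (\<lambda>y. eM M (n * y))"
  have "?S = average {0..<M} (\<lambda>y. eM M (n * (y + 1)))"
    using ubp_average_shift[OF assms ubp_eM[of M n], of 1] assms by simp
  also have "\<dots> = ?S * eM M n" by (simp add: ring_distribs eM_add average_mult_right)
  finally have "?S * (eM M n - 1) = 0" by (simp add: algebra_simps)
  then show ?thesis using False eM_eq_1[of M n] assms by simp
qed

section \<open>Fourier coefficients, Plancherel and Parseval\<close>

definition ft :: "int \<Rightarrow> (int \<Rightarrow> complex) \<Rightarrow> int \<Rightarrow> complex" where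
  "ft M F j = average {0..<M} (\<lambda>y. F y * eM M (- (j * y)))"

lemma ft_periodic: "M > 0 \<Longrightarrow> ft M F (j + k * M) = ft M F j"
proof -
  assume "M > 0"
  then have "eM M (- ((j + k * M) * y)) = eM M (- (j * y))" for y
    using eM_periodic[of M "- (j * y)" "- (k * y)"] by (simp add: algebra_simps)
  then show ?thesis by (simp add: ft_def)
qed

lemma ft_mod: "M > 0 \<Longrightarrow> ft M F (j mod M) = ft M F j"
  using ft_periodic[of M F "j mod M" "j div M"] by simp

lemma ft_norm_le: "ubp M F \<Longrightarrow> norm (ft M F j) \<le> 1"
  unfolding ft_def by (intro norm_average_le_const) (auto simp: norm_mult ubp_norm)

lemma ft_shift:
  assumes "M > 0" "ubp M F"
  shows "ft M (\<lambda>y. F (y + c)) j = eM M (j * c) * ft M F j"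
proof -
  have "ubp M (\<lambda>y. F y * eM M (- j * y))" using assms by (intro ubp_intros ubp_eM) auto
  from ubp_average_shift[OF assms(1) this, of c]
  have "ft M F j = average {0..<M} (\<lambda>y. F (y + c) * eM M (- j * y) * eM M (- j * c))"
    by (simp add: ft_def ring_distribs eM_diff eM_minus mult.assoc)
  also have "\<dots> = ft M (\<lambda>y. F (y + c)) j * eM M (- j * c)" by (simp add: ft_def average_mult_right)
  finally show ?thesis by (simp add: eM_minus mult.left_commute[of "eM M _"])
qed

lemma ft_modulate: "ft M (\<lambda>y. F y * eM M (- (g * y))) j = ft M F (j + g)"
  by (simp add: ft_def ring_distribs eM_diff eM_minus mult_ac)

lemma ft_average: "ft M (\<lambda>y. average I (\<lambda>i. F i y)) j = average I (\<lambda>i. ft M (F i) j)"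
  unfolding ft_def by (subst average_swap) (simp add: average_mult_right)

lemma plancherel:
  assumes "M > 0"
  shows "average {0..<M} (\<lambda>y. F y * cnj (G y)) = (\<Sum>j\<in>{0..<M}. ft M F j * cnj (ft M G j))"
proof -
  have phase: "eM M ((z - y) * j) = eM M (j * z) * cnj (eM M (j * y))" for z y j
    unfolding left_diff_distrib eM_diff by (simp add: mult.commute)
  have "(\<Sum>j\<in>{0..<M}. ft M F j * cnj (ft M G j))
    = (\<Sum>j\<in>{0..<M}. average {0..<M} (\<lambda>y. average {0..<M} (\<lambda>z. F y * cnj (G z) * eM M ((z - y) * j))))"
    unfolding ft_def average_cnj[symmetric] average_mult_left[symmetric] average_mult_right[symmetric] phase
    by (subst average_swap) (simp add: eM_minus mult_ac)
  also have "\<dots> = average {0..<M} (\<lambda>y. average {0..<M} (\<lambda>z. F y * cnj (G z) * (\<Sum>j\<in>{0..<M}. eM M ((z - y) * j))))"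
    by (simp add: average_sum[symmetric] sum_distrib_left)
  \<comment> \<open>The sum over \<open>j\<close> is \<open>M\<close> times an average of
    characters, so orthogonality leaves the diagonal \<open>z = y\<close>, and the average over
    \<open>z\<close> cancels the factor \<open>M\<close>.\<close>
  also have "\<dots> = average {0..<M} (\<lambda>y. average {0..<M} (\<lambda>z. F y * cnj (G z) * (if z = y then of_int M else 0)))"
  proof (intro average_cong)
    fix y z assume yz: "y \<in> {0..<M}" "z \<in> {0..<M}"
    have "M dvd z - y \<longleftrightarrow> z = y"
      using yz by (simp flip: mod_eq_dvd_iff)
    moreover have "(\<Sum>j\<in>{0..<M}. eM M ((z - y) * j)) = of_int M * average {0..<M} (\<lambda>j. eM M ((z - y) * j))"
      using assms by (simp add: average_complex)
    ultimately show "F y * cnj (G z) * (\<Sum>j\<in>{0..<M}. eM M ((z - y) * j)) = F y * cnj (G z) * (if z = y then of_int M else 0)"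
      using average_eM[OF assms, of "z - y"] by simp
  qed
  also have "\<dots> = average {0..<M} (\<lambda>y. F y * cnj (G y))"
  proof (intro average_cong)
    fix y assume "y \<in> {0..<M}"
    have "(\<lambda>z. F y * cnj (G z) * (if z = y then of_int M else 0)) = (\<lambda>z. if z = y then F y * cnj (G y) * of_int M else 0)"
      by auto
    then show "average {0..<M} (\<lambda>z. F y * cnj (G z) * (if z = y then of_int M else 0)) = F y * cnj (G y)"
      using \<open>y \<in> {0..<M}\<close> assms by (simp add: average_complex)
  qed
  finally show ?thesis by simp
qed

text \<open>Since \<open>ft\<close> is an average, the frequency side is a plain sum without a
  factor \<open>M\<close>: the squared coefficients of a unit-bounded function have total mass at
  most 1, whatever the size of \<open>M\<close>.\<close>

lemma parseval:
  assumes "M > 0"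
  shows "(\<Sum>j\<in>{0..<M}. (norm (ft M F j))\<^sup>2) = average {0..<M} (\<lambda>y. (norm (F y))\<^sup>2)"
proof -
  have "complex_of_real (\<Sum>j\<in>{0..<M}. (norm (ft M F j))\<^sup>2) = complex_of_real (average {0..<M} (\<lambda>y. (norm (F y))\<^sup>2))"
    using plancherel[OF assms, of F F]
    by (simp only: of_real_sum complex_norm_square average_of_real[symmetric])
  then show ?thesis by (simp only: of_real_eq_iff)
qed

lemma parseval_le: "M > 0 \<Longrightarrow> ubp M F \<Longrightarrow> (\<Sum>j\<in>{0..<M}. (norm (ft M F j))\<^sup>2) \<le> 1"
  by (auto simp: parseval intro!: average_le power_le_one ubp_norm)

lemma parseval_shift_le:
  assumes "M > 0" "ubp M F"
  shows "(\<Sum>j\<in>{0..<M}. (norm (ft M F (j + c)))\<^sup>2) \<le> 1"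
proof -
  have "(\<Sum>j\<in>{0..<M}. (norm (ft M F (j + c)))\<^sup>2) = (\<Sum>j\<in>{0..<M}. (norm (ft M F j))\<^sup>2)"
    using assms ft_periodic[of M F _ 1] by (intro sum_periodic_shift[where F = "\<lambda>j. (norm (ft M F j))\<^sup>2"]) auto
  then show ?thesis using parseval_le assms by simp
qed

section \<open>Cauchy--Schwarz and van der Corput steps\<close>

text \<open>The factor \<open>f y\<close> does not involve \<open>t\<close>; Cauchy--Schwarz in
  \<open>y\<close> therefore discards it by its bound.\<close>

lemma one_shift:
  assumes "M > 0" "ubp M f"
  shows "(norm (average B (\<lambda>t. average {0..<M} (\<lambda>y. f y * g (y + m * t)))))\<^sup>2
    \<le> average {0..<M} (\<lambda>y. (norm (average B (\<lambda>t. g (y + m * t))))\<^sup>2)"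
proof -
  have "average B (\<lambda>t. average {0..<M} (\<lambda>y. f y * g (y + m * t)))
      = average {0..<M} (\<lambda>y. f y * average B (\<lambda>t. g (y + m * t)))"
    by (subst average_swap) (simp add: average_mult_left)
  also have "(norm \<dots>)\<^sup>2 \<le> average {0..<M} (\<lambda>y. (norm (f y * average B (\<lambda>t. g (y + m * t))))\<^sup>2)"
    by (rule norm_average_square_le)
  also have "\<dots> \<le> average {0..<M} (\<lambda>y. (norm (average B (\<lambda>t. g (y + m * t))))\<^sup>2)"
    using assms by (intro average_mono power_mono) (auto simp: norm_mult mult_left_le_one_le ubp_norm)
  finally show ?thesis .
qed

text \<open>Splitting the shift as \<open>s + t\<close> reserves one variable for each
  Cauchy--Schwarz step. Doubling \<open>s\<close> removes \<open>f\<close>; translating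
  \<open>y\<close> by \<open>- m * t\<close> then frees \<open>g\<close> from \<open>t\<close>, and
  \<open>one_shift\<close> removes it. Only \<open>h\<close> survives, with the direction
  \<open>n - m\<close> in \<open>t\<close>.\<close>

lemma two_shifts:
  assumes M: "M > 0" and f: "ubp M f" and g: "ubp M g" and h: "ubp M h"
  shows "(norm (average A (\<lambda>s. average B (\<lambda>t. average {0..<M}
            (\<lambda>y. f y * (g (y + m * (s + t)) * h (y + n * (s + t))))))))^4
    \<le> average A (\<lambda>s. average A (\<lambda>s'. average {0..<M} (\<lambda>y. (norm (average B (\<lambda>t.
          h (y + n * s + (n - m) * t) * cnj (h (y + n * s' + (n - m) * t)))))\<^sup>2)))"
    (is "?X ^ 4 \<le> ?rhs")
proof -
  let ?z = "\<lambda>s t y. g (y + m * (s + t)) * h (y + n * (s + t))"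
  have eq: "average A (\<lambda>s. average B (\<lambda>t. average {0..<M} (\<lambda>y. f y * ?z s t y)))
      = average B (\<lambda>t. average {0..<M} (\<lambda>y. f y * average A (\<lambda>s. ?z s t y)))"
    by (simp only: average_swap[of A] average_mult_left)
  have "?X\<^sup>2 \<le> average A (\<lambda>s. average A (\<lambda>s'.
        norm (average B (\<lambda>t. average {0..<M} (\<lambda>y. ?z s t y * cnj (?z s' t y))))))"
    unfolding eq by (rule average_eliminate) (rule ubp_norm[OF f])
  then have "?X ^ 4 \<le> (average A (\<lambda>s. average A (\<lambda>s'.
        norm (average B (\<lambda>t. average {0..<M} (\<lambda>y. ?z s t y * cnj (?z s' t y)))))))\<^sup>2"
    using power_mono[of "?X\<^sup>2" _ 2] by (simp flip: power_mult)
  also have "\<dots> \<le> average A (\<lambda>s. average A (\<lambda>s'.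
        (norm (average B (\<lambda>t. average {0..<M} (\<lambda>y. ?z s t y * cnj (?z s' t y)))))\<^sup>2))"
    by (rule order_trans[OF average_square_le average_mono]) (rule average_square_le)
  also have "\<dots> \<le> ?rhs"
  proof (intro average_mono)
    fix s s'
    let ?G = "\<lambda>y. g (y + m * s) * cnj (g (y + m * s'))"
    let ?H = "\<lambda>y. h (y + n * s) * cnj (h (y + n * s'))"
    have "average {0..<M} (\<lambda>y. ?z s t y * cnj (?z s' t y)) = average {0..<M} (\<lambda>y. ?G y * ?H (y + (n - m) * t))" for t
    proof -
      have "ubp M (\<lambda>y. ?z s t y * cnj (?z s' t y))" by (intro ubp_intros g h)
      from ubp_average_shift[OF M this, of "- m * t"] show ?thesis
        by (simp add: algebra_simps)
    qed
    then have "(norm (average B (\<lambda>t. average {0..<M} (\<lambda>y. ?z s t y * cnj (?z s' t y)))))\<^sup>2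
        \<le> average {0..<M} (\<lambda>y. (norm (average B (\<lambda>t. ?H (y + (n - m) * t))))\<^sup>2)"
      using one_shift[OF M, of ?G B ?H "n - m"] by (simp add: ubp_intros g)
    then show "(norm (average B (\<lambda>t. average {0..<M} (\<lambda>y. ?z s t y * cnj (?z s' t y)))))\<^sup>2
        \<le> average {0..<M} (\<lambda>y. (norm (average B (\<lambda>t.
          h (y + n * s + (n - m) * t) * cnj (h (y + n * s' + (n - m) * t)))))\<^sup>2)"
      by (simp add: algebra_simps)
  qed
  finally show ?thesis .
qed

text \<open>One more variable than in \<open>two_shifts\<close>: doubling \<open>r\<close> removes
  \<open>g0\<close>, and after translating by \<open>- n1 * (s + t)\<close> the previous lemma
  applies to the doubled functions. Thus \<open>g3\<close> is differenced in the directions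
  \<open>n3\<close> and \<open>n3 - n1\<close> and averaged along \<open>n3 - n2\<close>.\<close>

lemma three_shifts:
  assumes M: "M > 0" and ub: "ubp M g0" "ubp M g1" "ubp M g2" "ubp M g3"
  shows "(norm (average A (\<lambda>r. average B (\<lambda>s. average C (\<lambda>t. average {0..<M} (\<lambda>y. g0 y *
            (g1 (y + n1 * (r + s + t)) * (g2 (y + n2 * (r + s + t)) * g3 (y + n3 * (r + s + t))))))))))^8
    \<le> average A (\<lambda>r. average A (\<lambda>r'. average B (\<lambda>s. average B (\<lambda>s'.
        average {0..<M} (\<lambda>y. (norm (average C (\<lambda>t.
          g3 (y + n3 * r + (n3 - n1) * s + (n3 - n2) * t) * cnj (g3 (y + n3 * r' + (n3 - n1) * s + (n3 - n2) * t)) *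
          cnj (g3 (y + n3 * r + (n3 - n1) * s' + (n3 - n2) * t) * cnj (g3 (y + n3 * r' + (n3 - n1) * s' + (n3 - n2) * t))))))\<^sup>2)))))"
    (is "?X ^ 8 \<le> ?rhs")
proof -
  let ?z = "\<lambda>r \<tau> y. g1 (y + n1 * (r + fst \<tau> + snd \<tau>)) * (g2 (y + n2 * (r + fst \<tau> + snd \<tau>)) * g3 (y + n3 * (r + fst \<tau> + snd \<tau>)))"
  have eq: "average A (\<lambda>r. average B (\<lambda>s. average C (\<lambda>t. average {0..<M} (\<lambda>y. g0 y *
            (g1 (y + n1 * (r + s + t)) * (g2 (y + n2 * (r + s + t)) * g3 (y + n3 * (r + s + t))))))))
      = average (B \<times> C) (\<lambda>\<tau>. average {0..<M} (\<lambda>y. g0 y * average A (\<lambda>r. ?z r \<tau> y)))"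
    by (simp add: average_swap[of A] average_mult_left[symmetric] average_Times)
  have "?X\<^sup>2 \<le> average A (\<lambda>r. average A (\<lambda>r'.
        norm (average (B \<times> C) (\<lambda>\<tau>. average {0..<M} (\<lambda>y. ?z r \<tau> y * cnj (?z r' \<tau> y))))))"
    unfolding eq by (rule average_eliminate) (rule ubp_norm[OF ub(1)])
  then have "?X ^ 8 \<le> (average A (\<lambda>r. average A (\<lambda>r'.
        norm (average (B \<times> C) (\<lambda>\<tau>. average {0..<M} (\<lambda>y. ?z r \<tau> y * cnj (?z r' \<tau> y)))))))^4"
    using power_mono[of "?X\<^sup>2" _ 4] by (simp flip: power_mult)
  also have "\<dots> \<le> average A (\<lambda>r. average A (\<lambda>r'.
        (norm (average (B \<times> C) (\<lambda>\<tau>. average {0..<M} (\<lambda>y. ?z r \<tau> y * cnj (?z r' \<tau> y)))))^4))"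
    by (rule order_trans[OF average_power4_le average_mono]) (rule average_power4_le)
  also have "\<dots> \<le> ?rhs"
  proof (intro average_mono)
    fix r r'
    let ?G1 = "\<lambda>y. g1 (y + n1 * r) * cnj (g1 (y + n1 * r'))"
    let ?G2 = "\<lambda>y. g2 (y + n2 * r) * cnj (g2 (y + n2 * r'))"
    let ?G3 = "\<lambda>y. g3 (y + n3 * r) * cnj (g3 (y + n3 * r'))"
    have "average {0..<M} (\<lambda>y. ?z r (s, t) y * cnj (?z r' (s, t) y))
       = average {0..<M} (\<lambda>y. ?G1 y * (?G2 (y + (n2 - n1) * (s + t)) * ?G3 (y + (n3 - n1) * (s + t))))" for s t
    proof -
      have "ubp M (\<lambda>y. ?z r (s, t) y * cnj (?z r' (s, t) y))" by (intro ubp_intros ub)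
      from ubp_average_shift[OF M this, of "- n1 * (s + t)"] show ?thesis
        by (simp add: algebra_simps)
    qed
    then have "norm (average (B \<times> C) (\<lambda>\<tau>. average {0..<M} (\<lambda>y. ?z r \<tau> y * cnj (?z r' \<tau> y)))) ^ 4
        \<le> average B (\<lambda>s. average B (\<lambda>s'. average {0..<M} (\<lambda>y. (norm (average C (\<lambda>t.
          ?G3 (y + (n3 - n1) * s + (n3 - n1 - (n2 - n1)) * t) * cnj (?G3 (y + (n3 - n1) * s' + (n3 - n1 - (n2 - n1)) * t)))))\<^sup>2)))"
      using two_shifts[OF M, of ?G1 ?G2 ?G3 B C "n2 - n1" "n3 - n1"] by (simp add: ubp_intros ub average_Times)
    also have "n3 - n1 - (n2 - n1) = n3 - n2" by simp
    finally show "norm (average (B \<times> C) (\<lambda>\<tau>. average {0..<M} (\<lambda>y. ?z r \<tau> y * cnj (?z r' \<tau> y)))) ^ 4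
        \<le> average B (\<lambda>s. average B (\<lambda>s'. average {0..<M} (\<lambda>y. (norm (average C (\<lambda>t.
          g3 (y + n3 * r + (n3 - n1) * s + (n3 - n2) * t) * cnj (g3 (y + n3 * r' + (n3 - n1) * s + (n3 - n2) * t)) *
          cnj (g3 (y + n3 * r + (n3 - n1) * s' + (n3 - n2) * t) * cnj (g3 (y + n3 * r' + (n3 - n1) * s' + (n3 - n2) * t))))))\<^sup>2)))"
      by (simp add: ac_simps)
  qed
  finally show ?thesis .
qed

text \<open>Here the two shifts are independent. Translating by \<open>- n * p\<close> frees
  \<open>L\<close> from \<open>p\<close>, so doubling \<open>p\<close> removes it; translating by
  \<open>- m * p1\<close> then frees the doubled \<open>R\<close> from \<open>p1\<close>, and
  \<open>one_shift\<close> removes that too. What remains involves \<open>Z\<close> alone, along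
  both directions.\<close>

lemma two_directions:
  assumes M: "M > 0" and Z: "ubp M Z" and L: "ubp M L" and R: "ubp M R"
  shows "(norm (average B (\<lambda>p. average B (\<lambda>p1. average {0..<M} (\<lambda>y. Z y * (L (y + n * p) * R (y + m * p1)))))))^4
    \<le> average B (\<lambda>p. average B (\<lambda>p'. average {0..<M} (\<lambda>y. (norm (average B (\<lambda>p1.
          Z (y - n * p - m * p1) * cnj (Z (y - n * p' - m * p1)))))\<^sup>2)))"
    (is "?X ^ 4 \<le> ?rhs")
proof -
  let ?z = "\<lambda>p p1 y. Z (y - n * p) * R (y - n * p + m * p1)"
  have "average {0..<M} (\<lambda>y. Z y * (L (y + n * p) * R (y + m * p1))) = average {0..<M} (\<lambda>y. L y * ?z p p1 y)" for p p1
  proof -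
    have "ubp M (\<lambda>y. Z y * (L (y + n * p) * R (y + m * p1)))" by (intro ubp_intros Z L R)
    from ubp_average_shift[OF M this, of "- n * p"] show ?thesis by (simp add: algebra_simps)
  qed
  then have eq: "average B (\<lambda>p. average B (\<lambda>p1. average {0..<M} (\<lambda>y. Z y * (L (y + n * p) * R (y + m * p1)))))
      = average B (\<lambda>p1. average {0..<M} (\<lambda>y. L y * average B (\<lambda>p. ?z p p1 y)))"
    by (subst average_swap) (simp only: average_swap[of B "{0..<M}"] average_mult_left)
  have "?X\<^sup>2 \<le> average B (\<lambda>p. average B (\<lambda>p'.
        norm (average B (\<lambda>p1. average {0..<M} (\<lambda>y. ?z p p1 y * cnj (?z p' p1 y))))))"
    unfolding eq by (rule average_eliminate) (rule ubp_norm[OF L])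
  then have "?X ^ 4 \<le> (average B (\<lambda>p. average B (\<lambda>p'.
        norm (average B (\<lambda>p1. average {0..<M} (\<lambda>y. ?z p p1 y * cnj (?z p' p1 y)))))))\<^sup>2"
    using power_mono[of "?X\<^sup>2" _ 2] by (simp flip: power_mult)
  also have "\<dots> \<le> average B (\<lambda>p. average B (\<lambda>p'.
        (norm (average B (\<lambda>p1. average {0..<M} (\<lambda>y. ?z p p1 y * cnj (?z p' p1 y)))))\<^sup>2))"
    by (rule order_trans[OF average_square_le average_mono]) (rule average_square_le)
  also have "\<dots> \<le> ?rhs"
  proof (intro average_mono)
    fix p p'
    let ?R = "\<lambda>y. R (y - n * p) * cnj (R (y - n * p'))"
    let ?Z = "\<lambda>y. Z (y - n * p) * cnj (Z (y - n * p'))"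
    have "average {0..<M} (\<lambda>y. ?z p p1 y * cnj (?z p' p1 y)) = average {0..<M} (\<lambda>y. ?R y * ?Z (y + (- m) * p1))" for p1
    proof -
      have "ubp M (\<lambda>y. ?z p p1 y * cnj (?z p' p1 y))" by (intro ubp_intros Z R)
      from ubp_average_shift[OF M this, of "- m * p1"] show ?thesis
        by (simp add: algebra_simps)
    qed
    then have "(norm (average B (\<lambda>p1. average {0..<M} (\<lambda>y. ?z p p1 y * cnj (?z p' p1 y)))))\<^sup>2
        \<le> average {0..<M} (\<lambda>y. (norm (average B (\<lambda>p1. ?Z (y + (- m) * p1))))\<^sup>2)"
      using one_shift[OF M, of ?R B ?Z "- m"] by (simp add: ubp_intros R)
    then show "(norm (average B (\<lambda>p1. average {0..<M} (\<lambda>y. ?z p p1 y * cnj (?z p' p1 y)))))\<^sup>2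
        \<le> average {0..<M} (\<lambda>y. (norm (average B (\<lambda>p1. Z (y - n * p - m * p1) * cnj (Z (y - n * p' - m * p1)))))\<^sup>2)"
      by (simp add: algebra_simps)
  qed
  finally show ?thesis .
qed

text \<open>Two Cauchy--Schwarz steps turn the quadratic configuration into one that is linear in \<open>\<sigma>\<close>.\<close>

lemma linearize:
  assumes M: "M > 0" and H: "ubp M H" and F: "ubp M F" and F': "ubp M F'"
  shows "(norm (average A (\<lambda>t. average B (\<lambda>s. average C (\<lambda>\<tau>. average {0..<M} (\<lambda>y.
            H y * (F (y + (u + t + s + \<sigma> \<tau>)\<^sup>2) * F' (y + (u + h + t + s + \<sigma> \<tau>)\<^sup>2))))))))^4
    \<le> average A (\<lambda>t. average A (\<lambda>t'. average B (\<lambda>s. average B (\<lambda>s'. norm (average C (\<lambda>\<tau>. average {0..<M} (\<lambda>y.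
          H y * (cnj (H (y - 2 * (t' - t) * (u + t + s + \<sigma> \<tau>) - (t' - t)\<^sup>2)) *
          (cnj (H (y - 2 * h * (s' - s) - 2 * (s' - s) * (u + t + s + \<sigma> \<tau>) - (s' - s)\<^sup>2)) *
           H (y - 2 * h * (s' - s) - 2 * (t' - t + (s' - s)) * (u + t + s + \<sigma> \<tau>) - (t' - t + (s' - s))\<^sup>2))))))))))"
    (is "?X ^ 4 \<le> ?rhs")
proof -
  let ?v = "\<lambda>t s \<tau>. u + t + s + \<sigma> \<tau>"
  let ?z = "\<lambda>t \<tau> y. H (y - (?v t (fst \<tau>) (snd \<tau>))\<^sup>2) * F' (y + 2 * h * ?v t (fst \<tau>) (snd \<tau>) + h\<^sup>2)"
  \<comment> \<open>Translating by the first square frees \<open>F\<close> from all shifts and makes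
    the argument of \<open>F'\<close> linear, at the price of a quadratic argument of
    \<open>H\<close>.\<close>
  have "average {0..<M} (\<lambda>y. H y * (F (y + (?v t s \<tau>)\<^sup>2) * F' (y + (u + h + t + s + \<sigma> \<tau>)\<^sup>2)))
      = average {0..<M} (\<lambda>y. F y * ?z t (s, \<tau>) y)" for t s \<tau>
  proof -
    have "ubp M (\<lambda>y. H y * (F (y + (?v t s \<tau>)\<^sup>2) * F' (y + (u + h + t + s + \<sigma> \<tau>)\<^sup>2)))"
      by (intro ubp_intros H F F')
    from ubp_average_shift[OF M this, of "- (?v t s \<tau>)\<^sup>2"] show ?thesis
      by (simp add: algebra_simps power2_eq_square)
  qed
  then have eq: "average A (\<lambda>t. average B (\<lambda>s. average C (\<lambda>\<tau>. average {0..<M} (\<lambda>y.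
            H y * (F (y + (?v t s \<tau>)\<^sup>2) * F' (y + (u + h + t + s + \<sigma> \<tau>)\<^sup>2))))))
      = average (B \<times> C) (\<lambda>\<tau>. average {0..<M} (\<lambda>y. F y * average A (\<lambda>t. ?z t \<tau> y)))"
    by (simp add: average_swap[of A] average_mult_left[symmetric] average_Times)
  have "?X\<^sup>2 \<le> average A (\<lambda>t. average A (\<lambda>t'.
        norm (average (B \<times> C) (\<lambda>\<tau>. average {0..<M} (\<lambda>y. ?z t \<tau> y * cnj (?z t' \<tau> y))))))"
    unfolding eq by (rule average_eliminate) (rule ubp_norm[OF F])
  then have "?X ^ 4 \<le> (average A (\<lambda>t. average A (\<lambda>t'.
        norm (average (B \<times> C) (\<lambda>\<tau>. average {0..<M} (\<lambda>y. ?z t \<tau> y * cnj (?z t' \<tau> y)))))))\<^sup>2"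
    using power_mono[of "?X\<^sup>2" _ 2] by (simp flip: power_mult)
  also have "\<dots> \<le> average A (\<lambda>t. average A (\<lambda>t'.
        (norm (average (B \<times> C) (\<lambda>\<tau>. average {0..<M} (\<lambda>y. ?z t \<tau> y * cnj (?z t' \<tau> y)))))\<^sup>2))"
    by (rule order_trans[OF average_square_le average_mono]) (rule average_square_le)
  also have "\<dots> \<le> ?rhs"
  proof (intro average_mono)
    fix t t'
    let ?W = "\<lambda>y. F' (y + 2 * h * (u + t) + h\<^sup>2) * cnj (F' (y + 2 * h * (u + t') + h\<^sup>2))"
    let ?x = "\<lambda>s \<tau> y. H (y - 2 * h * (s + \<sigma> \<tau>) - (?v t s \<tau>)\<^sup>2) * cnj (H (y - 2 * h * (s + \<sigma> \<tau>) - (?v t' s \<tau>)\<^sup>2))"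
    \<comment> \<open>Both copies of \<open>F'\<close> move by the same amount
      \<open>2 * h * (s + \<sigma> \<tau>)\<close>, which one translation removes; their product
      \<open>?W\<close> is then independent of \<open>s\<close> and \<open>\<tau>\<close>.\<close>
    have "average {0..<M} (\<lambda>y. ?z t (s, \<tau>) y * cnj (?z t' (s, \<tau>) y)) = average {0..<M} (\<lambda>y. ?W y * ?x s \<tau> y)" for s \<tau>
    proof -
      have "ubp M (\<lambda>y. ?z t (s, \<tau>) y * cnj (?z t' (s, \<tau>) y))" by (intro ubp_intros H F')
      from ubp_average_shift[OF M this, of "- 2 * h * (s + \<sigma> \<tau>)"] show ?thesis
        by (simp add: algebra_simps)
    qed
    then have eq2: "average (B \<times> C) (\<lambda>\<tau>. average {0..<M} (\<lambda>y. ?z t \<tau> y * cnj (?z t' \<tau> y)))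
        = average C (\<lambda>\<tau>. average {0..<M} (\<lambda>y. ?W y * average B (\<lambda>s. ?x s \<tau> y)))"
      by (simp add: average_swap[of B] average_mult_left[symmetric] average_Times)
    have le: "(norm (average (B \<times> C) (\<lambda>\<tau>. average {0..<M} (\<lambda>y. ?z t \<tau> y * cnj (?z t' \<tau> y)))))\<^sup>2
        \<le> average B (\<lambda>s. average B (\<lambda>s'. norm (average C (\<lambda>\<tau>. average {0..<M} (\<lambda>y. ?x s \<tau> y * cnj (?x s' \<tau> y))))))"
      unfolding eq2 by (rule average_eliminate) (rule ubp_norm[of M ?W], intro ubp_intros F')
    \<comment> \<open>Bringing the first factor back to \<open>H y\<close> leaves differences of two
      squares in the other arguments; these are linear in \<open>\<sigma> \<tau>\<close>, with
      slopes given by \<open>t' - t\<close>, by \<open>s' - s\<close> and by their sum.\<close>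
    have eq3: "average {0..<M} (\<lambda>y. ?x s \<tau> y * cnj (?x s' \<tau> y)) = average {0..<M} (\<lambda>y.
          H y * (cnj (H (y - 2 * (t' - t) * ?v t s \<tau> - (t' - t)\<^sup>2)) *
          (cnj (H (y - 2 * h * (s' - s) - 2 * (s' - s) * ?v t s \<tau> - (s' - s)\<^sup>2)) *
           H (y - 2 * h * (s' - s) - 2 * (t' - t + (s' - s)) * ?v t s \<tau> - (t' - t + (s' - s))\<^sup>2))))" for s s' \<tau>
    proof -
      have "ubp M (\<lambda>y. ?x s \<tau> y * cnj (?x s' \<tau> y))" by (intro ubp_intros H)
      note sh = ubp_average_shift[OF M this, of "2 * h * (s + \<sigma> \<tau>) + (?v t s \<tau>)\<^sup>2"]
      have e: "y + (2 * h * (s + w) + (u + t + s + w)\<^sup>2) - 2 * h * (s + w) - (u + t + s + w)\<^sup>2 = y"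
        "y + (2 * h * (s + w) + (u + t + s + w)\<^sup>2) - 2 * h * (s + w) - (u + t' + s + w)\<^sup>2
          = y - 2 * (t' - t) * (u + t + s + w) - (t' - t)\<^sup>2"
        "y + (2 * h * (s + w) + (u + t + s + w)\<^sup>2) - 2 * h * (s' + w) - (u + t + s' + w)\<^sup>2
          = y - 2 * h * (s' - s) - 2 * (s' - s) * (u + t + s + w) - (s' - s)\<^sup>2"
        "y + (2 * h * (s + w) + (u + t + s + w)\<^sup>2) - 2 * h * (s' + w) - (u + t' + s' + w)\<^sup>2
          = y - 2 * h * (s' - s) - 2 * (t' - t + (s' - s)) * (u + t + s + w) - (t' - t + (s' - s))\<^sup>2"
        for y w :: int
        by (simp_all add: power2_eq_square algebra_simps)
      show ?thesis
        by (rule sh[symmetric, THEN trans]) (unfold e, simp only: complex_cnj_mult complex_cnj_cnj mult.assoc)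
    qed
    show "(norm (average (B \<times> C) (\<lambda>\<tau>. average {0..<M} (\<lambda>y. ?z t \<tau> y * cnj (?z t' \<tau> y)))))\<^sup>2
        \<le> average B (\<lambda>s. average B (\<lambda>s'. norm (average C (\<lambda>\<tau>. average {0..<M} (\<lambda>y.
          H y * (cnj (H (y - 2 * (t' - t) * ?v t s \<tau> - (t' - t)\<^sup>2)) *
          (cnj (H (y - 2 * h * (s' - s) - 2 * (s' - s) * ?v t s \<tau> - (s' - s)\<^sup>2)) *
           H (y - 2 * h * (s' - s) - 2 * (t' - t + (s' - s)) * ?v t s \<tau> - (t' - t + (s' - s))\<^sup>2))))))))"
      using le unfolding eq3 .
  qed
  finally show ?thesis .
qed

text \<open>After expanding the square and translating, one factor \<open>cnj (T y)\<close> is free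
  of \<open>l, r, p, p'\<close>, so all four can be doubled in a single Cauchy--Schwarz step. This
  puts two directions \<open>l\<close> and \<open>l'\<close> next to each other, and the function
  left over is a derivative of \<open>T\<close> whose step is a linear form in \<open>r\<close> and
  \<open>r'\<close>. Now \<open>two_directions\<close> applies to \<open>p\<close> and
  \<open>p1\<close>. The exponent 8 is 2 times 4.\<close>

lemma concatenate_aux:
  assumes M: "M > 0" and T: "ubp M T"
  shows "(average A (\<lambda>l. average R (\<lambda>r. average {0..<M} (\<lambda>y. (norm (average B (\<lambda>p.
            T (y + 2 * l * p) * cnj (T (y + 2 * l * p + 2 * (v - l) * r)))))\<^sup>2))))^8
    \<le> average A (\<lambda>l. average R (\<lambda>r. average A (\<lambda>l'. average R (\<lambda>r'.
        average B (\<lambda>p. average B (\<lambda>p'. average {0..<M} (\<lambda>y. (norm (average B (\<lambda>p1.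
          (\<lambda>z. T z * cnj (T (z + (2 * (v - l') * r' - 2 * (v - l) * r)))) (y - 2 * l * p - 2 * l' * p1) *
          cnj ((\<lambda>z. T z * cnj (T (z + (2 * (v - l') * r' - 2 * (v - l) * r)))) (y - 2 * l * p' - 2 * l' * p1)))))\<^sup>2)))))))"
    (is "?B ^ 8 \<le> ?rhs")
proof -
  let ?X = "\<lambda>l r p' p y. T (y + 2 * l * (p - p')) * cnj (T (y + 2 * l * (p - p') + 2 * (v - l) * r)) * T (y + 2 * (v - l) * r)"
  let ?\<Omega> = "A \<times> R \<times> B \<times> B"
  \<comment> \<open>All parameters are packed into \<open>\<omega>\<close>, the doubled index; the
    outer index is trivial.\<close>
  let ?z = "\<lambda>\<omega> (\<tau>::unit) y. case \<omega> of (l, r, p', p) \<Rightarrow> ?X l r p' p y"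
  have shift1: "average {0..<M} (\<lambda>y. T (y + 2 * l * p) * cnj (T (y + 2 * l * p + 2 * (v - l) * r)) *
        cnj (T (y + 2 * l * p') * cnj (T (y + 2 * l * p' + 2 * (v - l) * r))))
      = average {0..<M} (\<lambda>y. cnj (T y) * ?X l r p' p y)" for l r p p'
  proof -
    have "ubp M (\<lambda>y. T (y + 2 * l * p) * cnj (T (y + 2 * l * p + 2 * (v - l) * r)) *
        cnj (T (y + 2 * l * p') * cnj (T (y + 2 * l * p' + 2 * (v - l) * r))))" by (intro ubp_intros T)
    from ubp_average_shift[OF M this, of "- 2 * l * p'"] show ?thesis by (simp add: algebra_simps)
  qed
  have "complex_of_real ?B = average A (\<lambda>l. average R (\<lambda>r. average {0..<M} (\<lambda>y.
      average B (\<lambda>p. average B (\<lambda>p'. T (y + 2 * l * p) * cnj (T (y + 2 * l * p + 2 * (v - l) * r)) *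
        cnj (T (y + 2 * l * p') * cnj (T (y + 2 * l * p' + 2 * (v - l) * r))))))))"
    by (simp only: average_of_real[symmetric] average_norm_square)
  also have "\<dots> = average A (\<lambda>l. average R (\<lambda>r. average B (\<lambda>p. average B (\<lambda>p'. average {0..<M} (\<lambda>y.
       cnj (T y) * ?X l r p' p y)))))"
    by (simp only: average_swap[of "{0..<M}"] shift1)
  also have "\<dots> = average A (\<lambda>l. average R (\<lambda>r. average B (\<lambda>p'. average B (\<lambda>p. average {0..<M} (\<lambda>y.
       cnj (T y) * ?X l r p' p y)))))"
    by (subst average_swap) (rule refl)
  also have "\<dots> = average ?\<Omega> (\<lambda>\<omega>. average {0..<M} (\<lambda>y. cnj (T y) * ?z \<omega> () y))"
    by (simp add: average_Times)
  also have "\<dots> = average {()} (\<lambda>\<tau>. average {0..<M} (\<lambda>y. cnj (T y) * average ?\<Omega> (\<lambda>\<omega>. ?z \<omega> \<tau> y)))"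
    by (simp only: average_swap[of ?\<Omega>] average_mult_left) (simp add: average_const)
  finally have eq: "complex_of_real ?B = \<dots>" .
  have nn: "?B \<ge> 0" by (intro average_nonneg) auto
  have "?B\<^sup>2 = (norm (complex_of_real ?B))\<^sup>2" by simp
  also have "\<dots> \<le> norm (average ?\<Omega> (\<lambda>\<omega>. average ?\<Omega> (\<lambda>\<omega>'.
      average {()} (\<lambda>\<tau>. average {0..<M} (\<lambda>y. ?z \<omega> \<tau> y * cnj (?z \<omega>' \<tau> y))))))"
    unfolding eq by (intro average_eliminate_aux) (simp add: ubp_norm[OF T])
  also have "average ?\<Omega> (\<lambda>\<omega>. average ?\<Omega> (\<lambda>\<omega>'.
      average {()} (\<lambda>\<tau>. average {0..<M} (\<lambda>y. ?z \<omega> \<tau> y * cnj (?z \<omega>' \<tau> y)))))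
    = average A (\<lambda>l. average R (\<lambda>r. average B (\<lambda>p'. average B (\<lambda>p. average A (\<lambda>l'. average R (\<lambda>r'. average B (\<lambda>p1'. average B (\<lambda>p1.
        average {0..<M} (\<lambda>y. ?X l r p' p y * cnj (?X l' r' p1' p1 y))))))))))"
    by (simp add: average_Times average_const)
  \<comment> \<open>The averages over \<open>p\<close> and \<open>p1\<close> are moved innermost, so
    that the triangle inequality below leaves exactly these two inside the norm.\<close>
  also have "\<dots> = average A (\<lambda>l. average R (\<lambda>r. average A (\<lambda>l'. average R (\<lambda>r'. average B (\<lambda>p'. average B (\<lambda>p1'. average B (\<lambda>p. average B (\<lambda>p1.
        average {0..<M} (\<lambda>y. ?X l r p' p y * cnj (?X l' r' p1' p1 y))))))))))"
    by (simp only: average_swap[of B A] average_swap[of B R]) (intro average_cong[where S = A] average_cong[where S = R], rule average_cong, rule average_swap)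
  also have "norm \<dots> \<le> average A (\<lambda>l. average R (\<lambda>r. average A (\<lambda>l'. average R (\<lambda>r'. average B (\<lambda>p'. average B (\<lambda>p1'. norm (average B (\<lambda>p. average B (\<lambda>p1.
        average {0..<M} (\<lambda>y. ?X l r p' p y * cnj (?X l' r' p1' p1 y)))))))))))"
    by (intro order_trans[OF norm_average_le average_mono] norm_average_le order.refl)
  finally have B2: "?B\<^sup>2 \<le> \<dots>" .
  have "?B ^ 8 = (?B\<^sup>2) ^ 4" by (simp flip: power_mult)
  also have "\<dots> \<le> (average A (\<lambda>l. average R (\<lambda>r. average A (\<lambda>l'. average R (\<lambda>r'. average B (\<lambda>p'. average B (\<lambda>p1'. norm (average B (\<lambda>p. average B (\<lambda>p1.
        average {0..<M} (\<lambda>y. ?X l r p' p y * cnj (?X l' r' p1' p1 y))))))))))))^4"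
    by (intro power_mono B2) simp
  also have "\<dots> \<le> average A (\<lambda>l. average R (\<lambda>r. average A (\<lambda>l'. average R (\<lambda>r'. average B (\<lambda>p'. average B (\<lambda>p1'. (norm (average B (\<lambda>p. average B (\<lambda>p1.
        average {0..<M} (\<lambda>y. ?X l r p' p y * cnj (?X l' r' p1' p1 y))))))^4))))))"
    by (intro order_trans[OF average_power4_le average_mono] average_power4_le order.refl)
  also have "\<dots> \<le> ?rhs"
  proof (intro average_mono[where S = A] average_mono[where S = R] average_le[where S = B])
    fix l r l' r' p' p1'
    let ?b = "2 * (v - l') * r' - 2 * (v - l) * r"
    let ?Z = "\<lambda>z. T z * cnj (T (z + ?b))"
    let ?L = "\<lambda>y. T (y - 2 * (v - l) * r - 2 * l * p') * cnj (T (y - 2 * l * p'))"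
    let ?R = "\<lambda>y. cnj (T (y - 2 * (v - l) * r - 2 * l' * p1')) * T (y + ?b - 2 * l' * p1')"
    \<comment> \<open>This translation places the two factors that involve neither \<open>p\<close>
      nor \<open>p1\<close> at \<open>y\<close> and \<open>y + ?b\<close>; they form
      \<open>?Z\<close>, while the others depend on \<open>y + 2 * l * p\<close> or on
      \<open>y + 2 * l' * p1\<close>.\<close>
    have sh: "average {0..<M} (\<lambda>y. ?X l r p' p y * cnj (?X l' r' p1' p1 y))
      = average {0..<M} (\<lambda>y. ?Z y * (?L (y + 2 * l * p) * ?R (y + 2 * l' * p1)))" for p p1
    proof -
      have "ubp M (\<lambda>y. ?X l r p' p y * cnj (?X l' r' p1' p1 y))" by (intro ubp_intros T)
      from ubp_average_shift[OF M this, of "- 2 * (v - l) * r"] show ?thesis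
        by (simp add: algebra_simps)
    qed
    show "(norm (average B (\<lambda>p. average B (\<lambda>p1.
        average {0..<M} (\<lambda>y. ?X l r p' p y * cnj (?X l' r' p1' p1 y))))))^4
      \<le> average B (\<lambda>p. average B (\<lambda>p'. average {0..<M} (\<lambda>y. (norm (average B (\<lambda>p1.
          ?Z (y - 2 * l * p - 2 * l' * p1) * cnj (?Z (y - 2 * l * p' - 2 * l' * p1)))))\<^sup>2)))"
      unfolding sh by (rule two_directions[OF M]; intro ubp_intros T)
  qed (intro average_nonneg, simp)+
  finally show ?thesis .
qed

section \<open>Distance to the nearest integer\<close>

lemma norm_circle_le: "norm_circle t \<le> \<bar>t - of_int n\<bar>"
  unfolding norm_circle_def by (metis Ints_of_int dist_real_def infdist_le)

lemma norm_circle_round: "norm_circle t = \<bar>t - of_int (round t)\<bar>"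
proof (rule antisym[OF norm_circle_le])
  have "(0::real) \<in> \<int>" by simp
  then have "\<int> \<noteq> ({} :: real set)" by blast
  then show "\<bar>t - of_int (round t)\<bar> \<le> norm_circle t"
    unfolding norm_circle_def infdist_def
    by (auto intro!: cINF_greatest simp: dist_real_def round_diff_minimal elim!: Ints_cases)
qed

lemma norm_circle_nonneg [simp]: "0 \<le> norm_circle t"
  by (simp add: norm_circle_round)

lemma norm_circle_decomp: obtains n :: int and r :: real where "t = of_int n + r" "\<bar>r\<bar> = norm_circle t"
  using norm_circle_round[of t] that[of "round t" "t - of_int (round t)"] by simp

lemma norm_circle_add_le: "norm_circle (s + t) \<le> norm_circle s + norm_circle t"
  using norm_circle_le[of "s + t" "round s + round t"] by (simp add: norm_circle_round)

lemma norm_circle_minus [simp]: "norm_circle (- t) = norm_circle t"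
proof -
  have "norm_circle (- t) \<le> norm_circle t" for t
    using norm_circle_le[of "- t" "- round t"] by (simp add: norm_circle_round)
  from this[of t] this[of "- t"] show ?thesis by simp
qed

lemma norm_circle_add_int [simp]: "norm_circle (t + of_int n) = norm_circle t"
proof -
  have le: "norm_circle (t + of_int n) \<le> norm_circle t" for t n
    using norm_circle_le[of "t + of_int n" "round t + n"] by (simp add: norm_circle_round)
  from le[of t n] le[of "t + of_int n" "- n"] show ?thesis by simp
qed

lemma norm_circle_small:
  assumes "\<bar>t\<bar> \<le> 1 / 2" shows "norm_circle t = \<bar>t\<bar>"
proof (rule antisym)
  show "norm_circle t \<le> \<bar>t\<bar>" using norm_circle_le[of t 0] by simp
  show "\<bar>t\<bar> \<le> norm_circle t"
  proof (cases "round t = 0")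
    case False
    then have "\<bar>of_int (round t) :: real\<bar> \<ge> 1" by linarith
    with assms show ?thesis unfolding norm_circle_round by linarith
  qed (simp add: norm_circle_round)
qed

lemma norm_one_minus_echar: "norm (1 - echar t) = 2 * \<bar>sin (pi * t)\<bar>"
proof -
  have "(norm (1 - echar t))\<^sup>2 = (1 - cos (2 * (pi * t)))\<^sup>2 + (sin (2 * (pi * t)))\<^sup>2"
    by (simp add: cmod_def echar_cis mult_ac)
  also have "\<dots> = 1 + ((cos (2 * (pi * t)))\<^sup>2 + (sin (2 * (pi * t)))\<^sup>2) - 2 * cos (2 * (pi * t))"
    by (simp add: power2_eq_square algebra_simps)
  also have "\<dots> = 2 - 2 * cos (2 * (pi * t))" by (simp only: sin_cos_squared_add2)
  also have "\<dots> = (2 * \<bar>sin (pi * t)\<bar>)\<^sup>2" unfolding cos_double_sin by (simp add: power_mult_distrib)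
  finally show ?thesis by (rule power2_eq_imp_eq) auto
qed

lemma norm_one_minus_echar_le: "norm (1 - echar t) \<le> 2 * pi * \<bar>t\<bar>"
  using abs_sin_x_le_abs_x[of "pi * t"] by (simp add: norm_one_minus_echar abs_mult)

text \<open>Concavity: on \<open>[0, pi / 2]\<close> the sine lies above its chord.\<close>

lemma sin_pi_ge: "0 \<le> t \<Longrightarrow> t \<le> 1 / 2 \<Longrightarrow> 2 * t \<le> sin (pi * t)"
proof -
  assume t: "0 \<le> t" "t \<le> 1 / 2"
  have "concave_on {0..pi / 2} sin"
  proof (rule f''_le0_imp_concave)
    show "(sin has_real_derivative cos x) (at x)" for x by (rule DERIV_sin)
    show "(cos has_real_derivative - sin x) (at x)" for x by (rule DERIV_cos)
    show "- sin x \<le> 0" if "x \<in> {0..pi / 2}" for x using that by (auto intro!: sin_ge_zero)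
  qed simp
  from concave_onD_Icc'[OF this, of "pi * t"] t show ?thesis by (simp add: field_simps)
qed

lemma norm_one_minus_echar_ge: "4 * norm_circle t \<le> norm (1 - echar t)"
proof -
  obtain n r where nr: "t = of_int n + r" "\<bar>r\<bar> = norm_circle t" by (rule norm_circle_decomp)
  have "\<bar>r\<bar> \<le> 1 / 2" using of_int_round_abs_le[of t] nr(2) by (simp add: norm_circle_round abs_minus_commute)
  then have "2 * \<bar>r\<bar> \<le> sin (pi * \<bar>r\<bar>)" by (intro sin_pi_ge) auto
  also have "\<dots> \<le> \<bar>sin (pi * r)\<bar>" by (cases "r \<ge> 0") auto
  also have "2 * \<dots> = norm (1 - echar t)"
    using norm_one_minus_echar[of r] nr(1) by (simp add: add.commute[of "of_int n"])
  finally show ?thesis using nr(2) by simp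
qed

text \<open>Multiplication by \<open>1 - echar \<theta>\<close> telescopes the sum to two boundary
  terms. The product form also covers integral \<open>\<theta>\<close>, where dividing would be
  impossible.\<close>

lemma geometric_echar_bound: "norm (\<Sum>k\<in>{a..<b::int}. echar (\<theta> * of_int k)) * norm_circle \<theta> \<le> 1"
proof (cases "a \<le> b")
  case True
  then have tele: "(1 - echar \<theta>) * (\<Sum>k\<in>{a..<b}. echar (\<theta> * of_int k)) = echar (\<theta> * of_int a) - echar (\<theta> * of_int b)"
  proof (induction b rule: int_ge_induct)
    case (step i)
    have "{a..<i + 1} = insert i {a..<i}" using step.hyps by auto
    then have "(1 - echar \<theta>) * (\<Sum>k\<in>{a..<i + 1}. echar (\<theta> * of_int k))
        = (1 - echar \<theta>) * echar (\<theta> * of_int i) + (echar (\<theta> * of_int a) - echar (\<theta> * of_int i))"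
      by (simp add: distrib_left step.IH)
    then show ?case by (simp add: algebra_simps echar_add)
  qed simp
  have "4 * norm_circle \<theta> * norm (\<Sum>k\<in>{a..<b}. echar (\<theta> * of_int k))
      \<le> norm ((1 - echar \<theta>) * (\<Sum>k\<in>{a..<b}. echar (\<theta> * of_int k)))"
    unfolding norm_mult by (intro mult_right_mono norm_one_minus_echar_ge) auto
  also have "\<dots> \<le> 2" unfolding tele by (rule order_trans[OF norm_triangle_ineq4]) simp
  finally show ?thesis by (simp add: mult_ac)
qed simp

section \<open>Moving windows and pigeonhole counting\<close>

text \<open>Each unit shift drops one term and gains one. This allows a long sum to be replaced by
  its average over short shifts, which introduces fresh variables for later differencing.\<close>

lemma window_shift:
  assumes "\<And>u. norm (\<phi> u :: complex) \<le> 1"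
  shows "norm ((\<Sum>u\<in>{a..<b::int}. \<phi> (u + int s)) - (\<Sum>u\<in>{a..<b}. \<phi> u)) \<le> 2 * real s"
proof (cases "a < b")
  case True
  have step: "norm ((\<Sum>u\<in>{a..<b}. \<psi> (u + 1)) - (\<Sum>u\<in>{a..<b}. \<psi> u)) \<le> 2" if "\<And>u. norm (\<psi> u :: complex) \<le> 1" for \<psi>
  proof -
    have "(\<Sum>u\<in>{a..<b}. \<psi> (u + 1)) = sum \<psi> ((\<lambda>u. u + 1) ` {a..<b})"
      by (subst sum.reindex) (auto simp: inj_on_def)
    also have "(\<lambda>u. u + 1) ` {a..<b} = insert b ({a..<b} - {a})"
      using True by (auto simp: image_iff intro: bexI[of _ "_ - 1"])
    also have "sum \<psi> \<dots> = \<psi> b + (sum \<psi> {a..<b} - \<psi> a)"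
      using True by (simp add: sum_diff1)
    finally have "(\<Sum>u\<in>{a..<b}. \<psi> (u + 1)) - (\<Sum>u\<in>{a..<b}. \<psi> u) = \<psi> b - \<psi> a" by simp
    then show ?thesis using norm_triangle_ineq4[of "\<psi> b" "\<psi> a"] that[of a] that[of b] by simp
  qed
  show ?thesis
  proof (induction s)
    case (Suc s)
    have "norm ((\<Sum>u\<in>{a..<b}. \<phi> (u + int (Suc s))) - (\<Sum>u\<in>{a..<b}. \<phi> (u + int s))) \<le> 2"
      using step[of "\<lambda>u. \<phi> (u + int s)"] assms by (simp add: ac_simps)
    with Suc show ?case
      using norm_triangle_ineq[of "(\<Sum>u\<in>{a..<b}. \<phi> (u + int (Suc s))) - (\<Sum>u\<in>{a..<b}. \<phi> (u + int s))"
          "(\<Sum>u\<in>{a..<b}. \<phi> (u + int s)) - (\<Sum>u\<in>{a..<b}. \<phi> u)"] by simp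
  qed simp
qed simp

lemma average_many:
  assumes "finite A" "\<And>a. a \<in> A \<Longrightarrow> f a \<le> 1" "c \<le> average A f" "0 \<le> c"
  shows "c / 2 * real (card A) \<le> real (card {a \<in> A. c / 2 \<le> f a})"
proof -
  let ?S = "{a \<in> A. c / 2 \<le> f a}"
  have "c * real (card A) \<le> sum f A"
  proof (cases "card A = 0")
    case False
    then show ?thesis using assms(3) by (simp add: average_real field_simps)
  qed (use assms(1) in simp)
  \<comment> \<open>Unpopular elements contribute less than \<open>c / 2\<close> each, popular ones
    at most 1.\<close>
  also have "sum f A \<le> (\<Sum>a\<in>A. (if c / 2 \<le> f a then 1 else 0) + c / 2)"
    using assms(2,4) by (intro sum_mono) (auto intro: add_increasing2)
  also have "\<dots> = real (card ?S) + c / 2 * real (card A)"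
    using assms(1) by (simp add: sum.distrib sum.If_cases Int_def)
  finally show ?thesis by (simp add: field_simps)
qed

lemma card_le_fibers:
  assumes "finite S" "finite T" "\<And>x. x \<in> S \<Longrightarrow> g x \<in> T"
    and "\<And>t. t \<in> T \<Longrightarrow> real (card {x \<in> S. g x = t}) \<le> c"
  shows "real (card S) \<le> real (card T) * c"
proof -
  have "real (card S) = (\<Sum>t\<in>T. \<Sum>x | x \<in> S \<and> g x = t. 1)"
    using assms(1-3) by (subst sum.group) auto
  also have "\<dots> = (\<Sum>t\<in>T. real (card {x \<in> S. g x = t}))" by simp
  also have "\<dots> \<le> (\<Sum>t\<in>T. c)" by (intro sum_mono assms(4))
  finally show ?thesis by simp
qed

section \<open>Vinogradov's lemma\<close>

text \<open>If \<open>\<beta> l\<close> is close to an integer for a positive proportion of the \<open>l\<close> in an interval of length \<open>n\<close>,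
  then two such \<open>l\<close> at bounded distance \<open>q\<close> make \<open>q \<beta>\<close> close to an integer; counting in residue classes
  modulo \<open>q\<close> improves the quality of the approximation by a factor \<open>n\<close>.\<close>

lemma vinogradov_aux:
  fixes \<beta> \<rho> \<eta> :: real and S :: "int set"
  assumes fin: "finite S" and q: "q > 0" and rho: "of_int q * \<beta> = of_int m + \<rho>" "\<rho> \<noteq> 0"
    and W: "\<And>l l'. l \<in> S \<Longrightarrow> l' \<in> S \<Longrightarrow> \<bar>of_int (l' - l) * \<rho>\<bar> \<le> of_int q / 2"
    and cls: "\<And>l l'. l \<in> S \<Longrightarrow> l' \<in> S \<Longrightarrow> q dvd l' - l"
    and close: "\<And>l. l \<in> S \<Longrightarrow> norm_circle (\<beta> * of_int l) \<le> \<eta>" and eta: "\<eta> \<ge> 0"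
  shows "real (card S) \<le> 2 * \<eta> / \<bar>\<rho>\<bar> + 1"
proof (cases "S = {}")
  case False
  define l0 where "l0 = Min S"
  have l0: "l0 \<in> S" "\<And>l. l \<in> S \<Longrightarrow> l0 \<le> l" using fin False by (auto simp: l0_def)
  let ?t = "\<lambda>l. (l - l0) div q"
  have t: "l = l0 + q * ?t l" if "l \<in> S" for l using cls[OF l0(1) that] by simp
  have inj: "inj_on ?t S"
  proof (rule inj_onI)
    fix x y assume xy: "x \<in> S" "y \<in> S" "?t x = ?t y"
    then have "l0 + q * ?t x = l0 + q * ?t y" by simp
    from t[OF xy(1), THEN trans, OF trans[OF this t[OF xy(2), symmetric]]] show "x = y" .
  qed
  have img: "?t l \<in> {0..\<lfloor>2 * \<eta> / \<bar>\<rho>\<bar>\<rfloor>}" if l: "l \<in> S" for l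
  proof -
    \<comment> \<open>The window hypothesis keeps the accumulated error below 1/2, so its absolute
      value is its distance to the nearest integer. That distance equals the one of
      \<open>\<beta> * (l - l0)\<close>, hence is at most \<open>2 * \<eta>\<close>, which limits
      the number of steps of length \<open>q\<close> from \<open>l0\<close>.\<close>
    have "\<bar>of_int (?t l) * \<rho>\<bar> \<le> 1 / 2"
    proof -
      have "of_int (l - l0) = (of_int q * of_int (?t l) :: real)"
        using t[OF l] by (simp flip: of_int_mult of_int_diff)
      then have "of_int q * \<bar>of_int (?t l) * \<rho>\<bar> = \<bar>of_int (l - l0) * \<rho>\<bar>"
        using q by (simp add: abs_mult)
      then have "of_int q * \<bar>of_int (?t l) * \<rho>\<bar> \<le> of_int q * (1 / 2)" using W[OF l0(1) l] by simp
      then show ?thesis using q by (simp only: mult_le_cancel_left_pos of_int_0_less_iff)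
    qed
    then have "\<bar>of_int (?t l) * \<rho>\<bar> = norm_circle (of_int (?t l) * \<rho>)" by (simp add: norm_circle_small)
    also have "\<dots> = norm_circle (of_int (?t l) * \<rho> + of_int (?t l * m))"
      by (simp only: norm_circle_add_int)
    also have "of_int (?t l) * \<rho> + of_int (?t l * m) = of_int (?t l) * (of_int q * \<beta>)"
      unfolding rho by (simp add: algebra_simps)
    also have "\<dots> = \<beta> * of_int l + - (\<beta> * of_int l0)"
    proof -
      have "(of_int l :: real) = of_int l0 + of_int q * of_int (?t l)"
        using t[OF l] by (simp flip: of_int_mult of_int_add)
      then show ?thesis by (simp add: algebra_simps)
    qed
    also have "norm_circle \<dots> \<le> \<eta> + \<eta>"
      using norm_circle_add_le[of "\<beta> * of_int l" "- (\<beta> * of_int l0)"] close[OF l] close[OF l0(1)] by simp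
    finally have "\<bar>of_int (?t l)\<bar> \<le> 2 * \<eta> / \<bar>\<rho>\<bar>"
      using rho(2) by (simp add: abs_mult pos_le_divide_eq)
    then have "of_int (?t l) \<le> 2 * \<eta> / \<bar>\<rho>\<bar>" by linarith
    moreover have "?t l \<ge> 0" using l0(2)[OF l] q by (simp add: pos_imp_zdiv_nonneg_iff)
    ultimately show ?thesis by (simp add: le_floor_iff)
  qed
  have "card S \<le> card {0..\<lfloor>2 * \<eta> / \<bar>\<rho>\<bar>\<rfloor>}"
    by (rule card_inj_on_le[OF inj]) (use img in auto)
  also have "real \<dots> = of_int (\<lfloor>2 * \<eta> / \<bar>\<rho>\<bar>\<rfloor> + 1)" using eta by simp
  also have "\<dots> \<le> 2 * \<eta> / \<bar>\<rho>\<bar> + 1" by simp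
  finally show ?thesis by simp
qed (use eta in simp)

text \<open>The interval is cut into windows of length \<open>W\<close>, short enough that the error
  \<open>\<rho>\<close> per step cannot wrap around inside one window; \<open>vinogradov_aux\<close>
  then bounds each residue class modulo \<open>q\<close> in each window.\<close>

lemma vinogradov_windows:
  fixes \<beta> \<rho> \<eta> :: real and S :: "int set"
  assumes S: "S \<subseteq> {a..<a + n}" and n: "n > 0" and q: "q > 0" and rho: "of_int q * \<beta> = of_int m + \<rho>" "\<rho> \<noteq> 0"
    and W: "W > 0" "of_int W * \<bar>\<rho>\<bar> \<le> of_int q / 2"
    and close: "\<And>l. l \<in> S \<Longrightarrow> norm_circle (\<beta> * of_int l) \<le> \<eta>" and eta: "\<eta> \<ge> 0"
  shows "real (card S) \<le> of_int ((n - 1) div W + 1) * of_int q * (2 * \<eta> / \<bar>\<rho>\<bar> + 1)"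
proof -
  let ?T = "{0..(n - 1) div W} \<times> {0..<q}"
  let ?g = "\<lambda>l. ((l - a) div W, l mod q)"
  have fin: "finite S" using S by (rule finite_subset) simp
  have "real (card S) \<le> real (card ?T) * (2 * \<eta> / \<bar>\<rho>\<bar> + 1)"
  proof (rule card_le_fibers[OF fin])
    show "?g x \<in> ?T" if "x \<in> S" for x
    proof -
      from that S have "0 \<le> x - a" "x - a \<le> n - 1" by auto
      then show ?thesis using W(1) q by (auto simp: pos_imp_zdiv_nonneg_iff intro: zdiv_mono1)
    qed
    show "real (card {x \<in> S. ?g x = t}) \<le> 2 * \<eta> / \<bar>\<rho>\<bar> + 1" if "t \<in> ?T" for t
    proof (rule vinogradov_aux[OF _ q rho])
      show "finite {x \<in> S. ?g x = t}" using fin by simp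
      fix l l' assume l: "l \<in> {x \<in> S. ?g x = t}" "l' \<in> {x \<in> S. ?g x = t}"
      then show "q dvd l' - l" by (auto simp flip: mod_eq_dvd_iff)
      have "(l - a) div W = (l' - a) div W" using l by auto
      then have "(l' - a) - (l - a) = (l' - a) mod W - (l - a) mod W"
        by (metis add_diff_cancel_left mult_div_mod_eq)
      then have "\<bar>l' - l\<bar> \<le> W"
        using pos_mod_sign[OF W(1), of "l - a"] pos_mod_bound[OF W(1), of "l - a"]
          pos_mod_sign[OF W(1), of "l' - a"] pos_mod_bound[OF W(1), of "l' - a"] by linarith
      then have "\<bar>of_int (l' - l) :: real\<bar> \<le> of_int W" by (simp only: of_int_abs[symmetric] of_int_le_iff)
      then have "\<bar>of_int (l' - l) * \<rho>\<bar> \<le> of_int W * \<bar>\<rho>\<bar>" by (simp add: abs_mult mult_right_mono)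
      then show "\<bar>of_int (l' - l) * \<rho>\<bar> \<le> of_int q / 2" using W(2) by linarith
    qed (use close eta in auto)
  qed simp
  also have "real (card ?T) = of_int ((n - 1) div W + 1) * of_int q"
    using n W(1) q by (simp add: card_cartesian_product pos_imp_zdiv_nonneg_iff)
  finally show ?thesis .
qed

text \<open>Pigeonhole over the blocks of length \<open>D\<close>.\<close>

lemma close_pair:
  fixes S :: "int set" and D :: int
  assumes S: "S \<subseteq> {a..<a + n}" and D: "D > 0" and n: "n > 0" and big: "of_int n / of_int D + 1 < real (card S)"
  shows "\<exists>l\<in>S. \<exists>l'\<in>S. l < l' \<and> l' - l < D"
proof (rule ccontr)
  assume neg: "\<not> ?thesis"
  let ?g = "\<lambda>l. (l - a) div D"
  have "inj_on ?g S"
  proof (rule inj_onI, rule ccontr)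
    fix x y assume xy: "x \<in> S" "y \<in> S" "?g x = ?g y" "x \<noteq> y"
    have "(y - a) - (x - a) = (y - a) mod D - (x - a) mod D"
      using xy(3) by (metis add_diff_cancel_left mult_div_mod_eq)
    then have "\<bar>y - x\<bar> < D"
      using pos_mod_sign[OF D, of "x - a"] pos_mod_bound[OF D, of "x - a"]
        pos_mod_sign[OF D, of "y - a"] pos_mod_bound[OF D, of "y - a"] by linarith
    then show False using neg xy by (cases "x < y") force+
  qed
  moreover have "?g ` S \<subseteq> {0..(n - 1) div D}"
  proof
    fix z assume "z \<in> ?g ` S"
    then obtain x where "x \<in> S" "z = ?g x" by auto
    moreover from \<open>x \<in> S\<close> S have "0 \<le> x - a" "x - a \<le> n - 1" by auto
    ultimately show "z \<in> {0..(n - 1) div D}" using D by (auto simp: pos_imp_zdiv_nonneg_iff intro: zdiv_mono1)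
  qed
  ultimately have "card S \<le> card {0..(n - 1) div D}" by (intro card_inj_on_le) auto
  also have "real \<dots> = of_int ((n - 1) div D + 1)" using n D by (simp add: pos_imp_zdiv_nonneg_iff)
  also have "\<dots> \<le> of_int n / of_int D + 1"
  proof -
    have "of_int ((n - 1) div D) \<le> (of_int (n - 1) / of_int D :: real)"
      by (metis floor_divide_of_int_eq of_int_floor_le)
    also have "\<dots> \<le> of_int n / of_int D" using D by (intro divide_right_mono) auto
    finally show ?thesis by simp
  qed
  finally show False using big by simp
qed

text \<open>A close pair yields \<open>q\<close> with the weak error \<open>2 * \<eta>\<close>. If
  this error does not wrap around over the whole interval, the count in a single window gives the
  extra factor \<open>1 / n\<close>; if it does, windows of the critical length show that fewer than
  \<open>n / K\<close> points qualify.\<close>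

lemma vinogradov:
  fixes \<beta> \<eta> K :: real and S :: "int set"
  assumes S: "S \<subseteq> {a..<a + n}" and K: "K \<ge> 1" and card: "of_int n / K \<le> real (card S)"
    and close: "\<And>l. l \<in> S \<Longrightarrow> norm_circle (\<beta> * of_int l) \<le> \<eta>"
    and eta: "0 \<le> \<eta>" "32 * K * \<eta> < 1" and n: "8 * K\<^sup>2 \<le> of_int n"
  shows "\<exists>q::nat. 0 < q \<and> real q \<le> 4 * K \<and> norm_circle (real q * \<beta>) \<le> 16 * K\<^sup>2 * \<eta> / of_int n"
proof -
  have "K\<^sup>2 > 0" using K by simp
  then have n0: "(of_int n :: real) > 0" using n by linarith
  then have n0': "n > 0" by simp
  have KK: "K \<le> K\<^sup>2" using K by (simp add: power2_eq_square)
  \<comment> \<open>At least \<open>3 * K\<close>, so that \<open>n / D + 1\<close> stays below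
    \<open>n / K\<close>; at most \<open>4 * K\<close>, which is the bound for
    \<open>q\<close>.\<close>
  define D where "D = \<lfloor>4 * K\<rfloor>"
  have D: "3 * K \<le> of_int D" "of_int D \<le> 4 * K" using K unfolding D_def by linarith+
  have D0: "D > 0" using D(1) K by (smt (verit) of_int_0_less_iff)
  have "of_int n / of_int D + 1 < real (card S)"
  proof -
    have "of_int n / of_int D \<le> of_int n / (3 * K)" using D(1) K n0 by (intro divide_left_mono) auto
    moreover have "1 < 2 * of_int n / (3 * K)"
    proof -
      have "3 * K < 2 * of_int n" using n KK K by linarith
      then show ?thesis using K by simp
    qed
    moreover have "of_int n / (3 * K) + 2 * of_int n / (3 * K) = of_int n / K" by (simp add: field_simps)
    ultimately show ?thesis using card by linarith
  qed
  from close_pair[OF S D0 n0' this] obtain l l' where l: "l \<in> S" "l' \<in> S" "l < l'" "l' - l < D" by auto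
  define q where "q = l' - l"
  have q: "q > 0" "q \<le> D" using l by (auto simp: q_def)
  have "(of_int q :: real) \<le> of_int D" using q by simp
  then have qK: "of_int q \<le> 4 * K" using D(2) by linarith
  obtain m \<rho> where rho: "of_int q * \<beta> = of_int m + \<rho>" "\<bar>\<rho>\<bar> = norm_circle (of_int q * \<beta>)"
    by (rule norm_circle_decomp)
  have "of_int q * \<beta> = \<beta> * of_int l' + - (\<beta> * of_int l)" by (simp add: q_def algebra_simps)
  then have rho_small: "\<bar>\<rho>\<bar> \<le> 2 * \<eta>"
    using norm_circle_add_le[of "\<beta> * of_int l'" "- (\<beta> * of_int l)"] close[OF l(1)] close[OF l(2)] rho(2) by simp
  have etaK: "\<eta> \<le> K * \<eta>" using K eta mult_right_mono[of 1 K \<eta>] by simp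
  have "\<bar>\<rho>\<bar> \<le> 16 * K\<^sup>2 * \<eta> / of_int n"
  proof (cases "\<rho> = 0")
    case True
    then show ?thesis using eta n0 by simp
  next
    case False
    then have r0: "\<bar>\<rho>\<bar> > 0" by simp
    define X where "X = 2 * \<eta> / \<bar>\<rho>\<bar> + 1"
    have X0: "X \<ge> 1" using eta r0 by (simp add: X_def)
    show ?thesis
    proof (cases "of_int n * \<bar>\<rho>\<bar> \<le> of_int q / 2")
      case True
      have "real (card S) \<le> of_int ((n - 1) div n + 1) * of_int q * X"
        unfolding X_def by (rule vinogradov_windows[OF S n0' q(1) rho(1) False n0' True close eta(1)])
      also have "(n - 1) div n = 0" using n0' by (intro div_pos_pos_trivial) auto
      finally have "of_int n / K \<le> of_int q * X" using card by simp
      also have "\<dots> = of_int q * (2 * \<eta> / \<bar>\<rho>\<bar>) + of_int q" by (simp add: X_def algebra_simps)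
      also have "\<dots> \<le> 4 * K * (2 * \<eta> / \<bar>\<rho>\<bar>) + of_int n / (2 * K)"
      proof (intro add_mono mult_right_mono qK)
        have "of_int q * (2 * K) \<le> 4 * K * (2 * K)" using qK K by (intro mult_right_mono) auto
        also have "\<dots> \<le> of_int n" using n by (simp add: power2_eq_square)
        finally show "of_int q \<le> of_int n / (2 * K)" using K by (simp add: field_simps)
      qed (use eta in auto)
      finally have "of_int n / K - of_int n / (2 * K) \<le> 8 * K * \<eta> / \<bar>\<rho>\<bar>" by simp
      then have "of_int n / (2 * K) \<le> 8 * K * \<eta> / \<bar>\<rho>\<bar>" by (simp add: field_simps)
      then show ?thesis using r0 n0 K by (simp add: field_simps power2_eq_square)
    next
      case big: False
      \<comment> \<open>\<open>q * B\<close> is essentially the longest window over which the error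
        stays below 1/2.\<close>
      define B where "B = \<lfloor>1 / (2 * \<bar>\<rho>\<bar>)\<rfloor>"
      have "\<bar>\<rho>\<bar> \<le> 1 / 16" using rho_small etaK eta by linarith
      then have "1 / (2 * \<bar>\<rho>\<bar>) \<ge> 2" using r0 by (simp add: field_simps)
      then have B: "of_int B \<le> 1 / (2 * \<bar>\<rho>\<bar>)" "1 / (4 * \<bar>\<rho>\<bar>) \<le> of_int B"
        unfolding B_def by (linarith, simp add: field_simps) linarith
      then have B0: "B > 0" using r0 by (smt (verit) divide_pos_pos of_int_0_less_iff)
      have W: "q * B > 0" using q B0 by simp
      then have Wr: "(of_int (q * B) :: real) > 0" by (simp only: of_int_0_less_iff)
      have W2: "of_int (q * B) * \<bar>\<rho>\<bar> \<le> of_int q / 2"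
        using mult_left_mono[OF B(1), of "of_int q * \<bar>\<rho>\<bar>"] q r0 by (simp add: field_simps)
      have "of_int (q * B) \<le> (of_int n :: real)"
      proof (rule ccontr)
        assume "\<not> ?thesis"
        then have "of_int n * \<bar>\<rho>\<bar> \<le> of_int (q * B) * \<bar>\<rho>\<bar>" by (intro mult_right_mono) auto
        then show False using W2 big by linarith
      qed
      then have nW: "1 \<le> of_int n / (of_int (q * B) :: real)" using Wr by (simp only: le_divide_eq_1_pos)
      have "real (card S) \<le> of_int ((n - 1) div (q * B) + 1) * of_int q * X"
        unfolding X_def by (rule vinogradov_windows[OF S n0' q(1) rho(1) False W W2 close eta(1)])
      also have "\<dots> \<le> (2 * of_int n / of_int (q * B)) * of_int q * X"
      proof (intro mult_right_mono)
        have "of_int ((n - 1) div (q * B)) \<le> (of_int (n - 1) / of_int (q * B) :: real)"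
          using of_int_floor_le[of "of_int (n - 1) / of_int (q * B) :: real"] by (simp only: floor_divide_of_int_eq)
        also have "\<dots> \<le> of_int n / of_int (q * B)" using Wr by (intro divide_right_mono) auto
        finally show "of_int ((n - 1) div (q * B) + 1) \<le> (2 * of_int n / of_int (q * B) :: real)"
          using add_mono[OF _ nW] unfolding of_int_add of_int_1 mult_2 add_divide_distrib by blast
      qed (use q X0 in auto)
      also have "\<dots> = 2 * of_int n * X * (1 / of_int B)" using q B0 by (simp add: divide_simps)
      also have "\<dots> \<le> 2 * of_int n * X * (4 * \<bar>\<rho>\<bar>)"
      proof (intro mult_left_mono)
        show "1 / of_int B \<le> 4 * \<bar>\<rho>\<bar>" using B(2) B0 r0 by (simp add: field_simps)
      qed (use n0 X0 in auto)
      also have "\<dots> = of_int n * (16 * \<eta> + 8 * \<bar>\<rho>\<bar>)" using r0 by (simp add: X_def field_simps)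
      also have "\<dots> \<le> of_int n * (32 * \<eta>)" using rho_small n0 by (intro mult_left_mono) auto
      also have "\<dots> < of_int n / K" using eta(2) n0 K by (simp add: field_simps)
      finally show ?thesis using card by simp
    qed
  qed
  then have "norm_circle (real (nat q) * \<beta>) \<le> 16 * K\<^sup>2 * \<eta> / of_int n"
    using q(1) unfolding rho(2) by simp
  moreover have "real (nat q) \<le> 4 * K" "0 < nat q" using q(1) qK by simp_all
  ultimately show ?thesis by blast
qed

text \<open>Because \<open>K \<ge> 2\<close>, numerical constants can be paid for by raising the
  exponent. This keeps every bound below a pure power of one parameter.\<close>

lemma absorb_const:
  fixes K :: real
  assumes "K \<ge> 2" "c \<le> 2 ^ n" "n + m \<le> k"
  shows "c * K ^ m \<le> K ^ k"
proof -
  have "c * K ^ m \<le> 2 ^ n * K ^ m" using assms by (intro mult_right_mono) auto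
  also have "\<dots> \<le> K ^ n * K ^ m" using assms by (intro mult_right_mono power_mono) auto
  also have "\<dots> \<le> K ^ k" using assms by (simp flip: power_add add: power_increasing)
  finally show ?thesis .
qed

lemma floor_half: "1 \<le> (r::real) \<Longrightarrow> r / 2 \<le> of_int \<lfloor>r\<rfloor>"
proof -
  assume "1 \<le> r"
  then have "1 \<le> \<lfloor>r\<rfloor>" by simp
  then have "(1::real) \<le> of_int \<lfloor>r\<rfloor>" by simp
  then show ?thesis by linarith
qed

section \<open>Weyl sums\<close>

text \<open>Weyl differencing: the pairs in the expanded square are grouped by their difference
  \<open>k\<close>, and the inner range is the intersection of the interval with its
  translate.\<close>

lemma norm_sum_square_differences:
  fixes \<phi> :: "int \<Rightarrow> complex"
  assumes ab: "b - a \<le> n"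
  shows "(norm (sum \<phi> {a..<b}))\<^sup>2
    \<le> (\<Sum>k\<in>{- n..<n}. norm (\<Sum>u\<in>{max a (a - k)..<min b (b - k)}. \<phi> (u + k) * cnj (\<phi> u)))"
proof -
  have inner: "(\<Sum>v\<in>{a..<b}. \<phi> v * cnj (\<phi> u)) = (\<Sum>k\<in>{- n..<n}. if u + k \<in> {a..<b} then \<phi> (u + k) * cnj (\<phi> u) else 0)"
    if u: "u \<in> {a..<b}" for u
  proof -
    have "(\<Sum>k\<in>{- n..<n}. if u + k \<in> {a..<b} then \<phi> (u + k) * cnj (\<phi> u) else 0)
       = (\<Sum>v\<in>(\<lambda>k. u + k) ` {- n..<n}. if v \<in> {a..<b} then \<phi> v * cnj (\<phi> u) else 0)"
      by (subst sum.reindex) auto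
    also have "\<dots> = (\<Sum>v\<in>{a..<b}. if v \<in> {a..<b} then \<phi> v * cnj (\<phi> u) else 0)"
    proof (rule sum.mono_neutral_right)
      show "{a..<b} \<subseteq> (\<lambda>k. u + k) ` {- n..<n}"
      proof
        fix v assume "v \<in> {a..<b}"
        then show "v \<in> (\<lambda>k. u + k) ` {- n..<n}" using u ab by (intro image_eqI[of _ _ "v - u"]) auto
      qed
    qed auto
    finally show ?thesis by simp
  qed
  have "complex_of_real ((norm (sum \<phi> {a..<b}))\<^sup>2) = (\<Sum>u\<in>{a..<b}. \<Sum>v\<in>{a..<b}. \<phi> v * cnj (\<phi> u))"
    unfolding complex_norm_square cnj_sum sum_product by (rule sum.swap)
  also have "\<dots> = (\<Sum>u\<in>{a..<b}. \<Sum>k\<in>{- n..<n}. if u + k \<in> {a..<b} then \<phi> (u + k) * cnj (\<phi> u) else 0)"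
    by (intro sum.cong refl inner)
  also have "\<dots> = (\<Sum>k\<in>{- n..<n}. \<Sum>u\<in>{a..<b}. if u + k \<in> {a..<b} then \<phi> (u + k) * cnj (\<phi> u) else 0)"
    by (rule sum.swap)
  also have "\<dots> = (\<Sum>k\<in>{- n..<n}. \<Sum>u\<in>{max a (a - k)..<min b (b - k)}. \<phi> (u + k) * cnj (\<phi> u))"
  proof (rule sum.cong[OF refl])
    fix k
    have "{max a (a - k)..<min b (b - k)} = {u \<in> {a..<b}. u + k \<in> {a..<b}}" by auto
    then show "(\<Sum>u\<in>{a..<b}. if u + k \<in> {a..<b} then \<phi> (u + k) * cnj (\<phi> u) else 0)
      = (\<Sum>u\<in>{max a (a - k)..<min b (b - k)}. \<phi> (u + k) * cnj (\<phi> u))"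
      by (simp only: sum.inter_filter[symmetric] finite_atLeastLessThan_int)
  qed
  finally have "(norm (sum \<phi> {a..<b}))\<^sup>2
      = norm (\<Sum>k\<in>{- n..<n}. \<Sum>u\<in>{max a (a - k)..<min b (b - k)}. \<phi> (u + k) * cnj (\<phi> u))"
    by (metis abs_of_nonneg norm_of_real zero_le_power2)
  then show ?thesis by (simp add: norm_sum)
qed

text \<open>Differencing turns the quadratic phase into geometric sums with frequency
  \<open>2 * \<beta> * k\<close>. Many of them must be large, so \<open>2 * \<beta> * k\<close> is
  within \<open>O(K\<^sup>2 / N)\<close> of an integer for many \<open>k\<close>, and Vinogradov's
  lemma gains the second factor \<open>1 / N\<close>.\<close>

lemma weyl_leading:
  fixes \<beta> \<gamma> K :: real and N :: nat
  assumes K: "K \<ge> 2" and N: "K ^ 31 \<le> real N" and J: "b - a \<le> int N"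
    and big: "real N / K \<le> norm (\<Sum>u\<in>{a..<b}. echar (\<beta> * of_int (u\<^sup>2) + \<gamma> * of_int u))"
  shows "\<exists>q::nat. 0 < q \<and> real q \<le> 32 * K\<^sup>2 \<and> norm_circle (real q * \<beta>) \<le> 512 * K ^ 6 / (real N)\<^sup>2"
proof -
  let ?\<phi> = "\<lambda>u::int. echar (\<beta> * of_int (u\<^sup>2) + \<gamma> * of_int u)"
  let ?I = "\<lambda>k. {max a (a - k)..<min b (b - k)}"
  let ?T = "\<lambda>k. norm (\<Sum>u\<in>?I k. ?\<phi> (u + k) * cnj (?\<phi> u))"
  have K0: "K > 0" using K by simp
  have "(1::real) \<le> K ^ 31" using K by (simp add: one_le_power)
  then have N1: "real N \<ge> 1" using N by linarith
  then have N0: "real N > 0" by simp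
  have TN: "?T k \<le> real N" for k
  proof -
    have "?T k \<le> (\<Sum>u\<in>?I k. 1)" by (rule sum_norm_le) (simp add: norm_mult)
    also have "\<dots> \<le> real N" using J by auto
    finally show ?thesis .
  qed
  have geo: "?T k * norm_circle (2 * \<beta> * of_int k) \<le> 1" for k
  proof -
    have "?\<phi> (u + k) * cnj (?\<phi> u) = echar (\<beta> * of_int (k\<^sup>2) + \<gamma> * of_int k) * echar (2 * \<beta> * of_int k * of_int u)" for u
      unfolding cnj_echar echar_add[symmetric] by (simp add: algebra_simps power2_eq_square)
    then have "?T k = norm (\<Sum>u\<in>?I k. echar (2 * \<beta> * of_int k * of_int u))"
      by (simp add: sum_distrib_left[symmetric] norm_mult)
    then show ?thesis using geometric_echar_bound by simp
  qed
  have "(real N / K)\<^sup>2 \<le> (\<Sum>k\<in>{- int N..<int N}. ?T k)"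
    by (rule order_trans[OF power_mono[OF big] norm_sum_square_differences[OF J]]) (use K0 in simp)
  then have "(real N)\<^sup>2 / K\<^sup>2 \<le> (\<Sum>k\<in>{- int N..<int N}. ?T k)" by (simp add: power_divide)
  then have avg: "1 / (2 * K\<^sup>2) \<le> average {- int N..<int N} (\<lambda>k. ?T k / real N)"
    using N0 K0 by (simp add: average_real sum_divide_distrib[symmetric] field_simps power2_eq_square)
  let ?S = "{k \<in> {- int N..<int N}. 1 / (2 * K\<^sup>2) / 2 \<le> ?T k / real N}"
  have cS: "1 / (2 * K\<^sup>2) / 2 * real (card {- int N..<int N}) \<le> real (card ?S)"
    by (rule average_many[OF _ _ avg]) (use TN N0 in auto)
  have small: "512 * K ^ 4 < real N"
  proof -
    have "512 * K ^ 4 \<le> K ^ 13" by (rule absorb_const[OF K, of _ 9]) auto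
    also have "\<dots> < K ^ 31" using K by (intro power_strict_increasing) auto
    finally show ?thesis using N by linarith
  qed
  have "\<exists>q::nat. 0 < q \<and> real q \<le> 4 * (4 * K\<^sup>2) \<and> norm_circle (real q * (2 * \<beta>))
      \<le> 16 * (4 * K\<^sup>2)\<^sup>2 * (4 * K\<^sup>2 / real N) / of_int (2 * int N)"
  proof (rule vinogradov[where S = ?S and a = "- int N"])
    show "?S \<subseteq> {- int N..<- int N + 2 * int N}" by auto
    show "1 \<le> 4 * K\<^sup>2" using one_le_power[of K 2] K by linarith
    show "of_int (2 * int N) / (4 * K\<^sup>2) \<le> real (card ?S)" using cS by simp
    show "norm_circle (2 * \<beta> * of_int l) \<le> 4 * K\<^sup>2 / real N" if "l \<in> ?S" for l
    proof -
      have "real N / (4 * K\<^sup>2) \<le> ?T l" using that N0 K0 by (simp add: field_simps)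
      then have "real N / (4 * K\<^sup>2) * norm_circle (2 * \<beta> * of_int l) \<le> ?T l * norm_circle (2 * \<beta> * of_int l)"
        by (intro mult_right_mono) auto
      also have "\<dots> \<le> 1" by (rule geo)
      finally show ?thesis using N0 K0 by (simp add: field_simps)
    qed
    show "32 * (4 * K\<^sup>2) * (4 * K\<^sup>2 / real N) < 1" using small N0 by (simp add: field_simps flip: power_add)
    have "8 * (4 * K\<^sup>2)\<^sup>2 \<le> 512 * K ^ 4" by (simp add: power_mult_distrib flip: power_mult)
    then show "8 * (4 * K\<^sup>2)\<^sup>2 \<le> of_int (2 * int N)" using small N0 by simp
  qed (use K0 in simp)
  then obtain q :: nat where q: "0 < q" "real q \<le> 4 * (4 * K\<^sup>2)"
    "norm_circle (real q * (2 * \<beta>)) \<le> 16 * (4 * K\<^sup>2)\<^sup>2 * (4 * K\<^sup>2 / real N) / of_int (2 * int N)" by blast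
  \<comment> \<open>The factor 2 coming from differencing is moved into the denominator, hence the
    witness \<open>2 * q\<close>.\<close>
  have "16 * (4 * K\<^sup>2)\<^sup>2 * (4 * K\<^sup>2 / real N) / of_int (2 * int N) = 512 * K ^ 6 / (real N)\<^sup>2"
    by (simp add: field_simps eval_nat_numeral)
  with q show ?thesis by (intro exI[of _ "2 * q"]) (auto simp: mult_ac)
qed

lemma norm_echar_diff: "norm (echar (x + y) - echar y) \<le> 7 * \<bar>x\<bar>"
proof -
  have "norm (echar (x + y) - echar y) = norm (1 - echar x)"
  proof -
    have "echar (x + y) - echar y = - ((1 - echar x) * echar y)" by (simp add: echar_add algebra_simps)
    then show ?thesis by (simp only: norm_minus_cancel norm_mult norm_echar mult_1_right)
  qed
  also have "\<dots> \<le> 2 * pi * \<bar>x\<bar>" by (rule norm_one_minus_echar_le)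
  also have "\<dots> \<le> 7 * \<bar>x\<bar>" using pi_less_4 pi_approx by (intro mult_right_mono) auto
  finally show ?thesis .
qed

text \<open>Once \<open>q * \<beta>\<close> is nearly integral, shifting \<open>u\<close> by
  multiples of \<open>q\<close> hardly changes the quadratic part of the phase. Averaging over such
  shifts leaves a geometric sum with frequency \<open>q * \<gamma>\<close>, which can be large only
  if that is close to an integer as well.\<close>

lemma weyl:
  fixes \<beta> \<gamma> K :: real and N :: nat
  assumes K: "K \<ge> 2" and N: "K ^ 31 \<le> real N" and J: "b - a \<le> int N"
    and range: "\<And>u. u \<in> {a..<b} \<Longrightarrow> \<bar>u\<bar> \<le> 4 * int N"
    and big: "real N / K \<le> norm (\<Sum>u\<in>{a..<b}. echar (\<beta> * of_int (u\<^sup>2) + \<gamma> * of_int u))"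
  shows "\<exists>q::nat. 0 < q \<and> real q \<le> K ^ 31 \<and> norm_circle (real q * \<beta>) \<le> K ^ 31 / (real N)\<^sup>2
    \<and> norm_circle (real q * \<gamma>) \<le> K ^ 31 / real N"
proof -
  let ?\<phi> = "\<lambda>u::int. echar (\<beta> * of_int (u\<^sup>2) + \<gamma> * of_int u)"
  obtain q :: nat where q: "0 < q" "real q \<le> 32 * K\<^sup>2" "norm_circle (real q * \<beta>) \<le> 512 * K ^ 6 / (real N)\<^sup>2"
    using weyl_leading[OF K N J big] by blast
  have K0: "K > 0" using K by simp
  have "(1::real) \<le> K ^ 31" using K by (simp add: one_le_power)
  then have N1: "real N \<ge> 1" using N by linarith
  then have N0: "real N > 0" by simp
  obtain m \<kappa> where kappa: "real q * \<beta> = of_int m + \<kappa>" "\<bar>\<kappa>\<bar> = norm_circle (real q * \<beta>)"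
    by (rule norm_circle_decomp)
  \<comment> \<open>The exponent 27 makes the drift of the quadratic part along \<open>L\<close>
    shifts at most \<open>1 / (4 * K)\<close>; the final bound is \<open>8 * K ^ 28 / N\<close>,
    whence the exponent 31.\<close>
  define L where "L = \<lfloor>real N / K ^ 27\<rfloor>"
  have "1 \<le> real N / K ^ 27"
  proof -
    have "K ^ 27 \<le> K ^ 31" using K by (intro power_increasing) auto
    then show ?thesis using N K0 by simp
  qed
  then have L: "L \<ge> 1" "of_int L \<le> real N / K ^ 27" "real N / K ^ 27 / 2 \<le> of_int L"
    using floor_half[of "real N / K ^ 27"] unfolding L_def by simp_all
  have L0: "(of_int L :: real) > 0" using L(1) by simp
  have qL: "2 * (real q * of_int L) \<le> real N / (2 * K)"
  proof -
    have "real q * of_int L \<le> 32 * K\<^sup>2 * (real N / K ^ 27)" using q L L0 by (intro mult_mono) auto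
    moreover have "128 * K ^ 3 \<le> K ^ 27" by (rule absorb_const[OF K, of _ 7]) auto
    then have "64 * K\<^sup>2 * (real N / K ^ 27) \<le> real N / (2 * K)"
      using K0 N0 by (simp add: field_simps power2_eq_square power3_eq_cube)
    ultimately show ?thesis by linarith
  qed
  have avg_eq: "average {0..<L} (\<lambda>t. \<Sum>u\<in>{a..<b}. ?\<phi> u) = (\<Sum>u\<in>{a..<b}. ?\<phi> u)"
    using L(1) by (intro average_const) auto
  have "norm (average {0..<L} (\<lambda>t. \<Sum>u\<in>{a..<b}. ?\<phi> (u + int q * t)) - (\<Sum>u\<in>{a..<b}. ?\<phi> u)) \<le> 2 * (real q * of_int L)"
  proof -
    have "norm (average {0..<L} (\<lambda>t. (\<Sum>u\<in>{a..<b}. ?\<phi> (u + int q * t)) - (\<Sum>u\<in>{a..<b}. ?\<phi> u))) \<le> 2 * (real q * of_int L)"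
    proof (rule norm_average_le_const)
      fix t assume t: "t \<in> {0..<L}"
      have "norm ((\<Sum>u\<in>{a..<b}. ?\<phi> (u + int (nat (int q * t)))) - (\<Sum>u\<in>{a..<b}. ?\<phi> u)) \<le> 2 * real (nat (int q * t))"
        by (rule window_shift) simp
      also have "\<dots> = 2 * (real q * of_int t)" using t by simp
      also have "\<dots> \<le> 2 * (real q * of_int L)" using t by (intro mult_left_mono) auto
      finally show "norm ((\<Sum>u\<in>{a..<b}. ?\<phi> (u + int q * t)) - (\<Sum>u\<in>{a..<b}. ?\<phi> u)) \<le> 2 * (real q * of_int L)"
        using t by simp
    qed (use L0 in simp)
    then show ?thesis by (simp only: average_diff avg_eq)
  qed
  then have "real N / (2 * K) \<le> norm (average {0..<L} (\<lambda>t. \<Sum>u\<in>{a..<b}. ?\<phi> (u + int q * t)))"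
    using big qL norm_triangle_ineq2[of "\<Sum>u\<in>{a..<b}. ?\<phi> u" "average {0..<L} (\<lambda>t. \<Sum>u\<in>{a..<b}. ?\<phi> (u + int q * t))"]
    by (simp add: norm_minus_commute field_simps)
  also have "average {0..<L} (\<lambda>t. \<Sum>u\<in>{a..<b}. ?\<phi> (u + int q * t)) = (\<Sum>u\<in>{a..<b}. average {0..<L} (\<lambda>t. ?\<phi> (u + int q * t)))"
    by (rule average_sum)
  finally have big2: "real N / (2 * K) \<le> norm (\<Sum>u\<in>{a..<b}. average {0..<L} (\<lambda>t. ?\<phi> (u + int q * t)))" .
  have "\<exists>u\<in>{a..<b}. 1 / (2 * K) \<le> norm (average {0..<L} (\<lambda>t. ?\<phi> (u + int q * t)))"
  proof (rule ccontr)
    assume neg: "\<not> ?thesis"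
    have ne: "{a..<b} \<noteq> {}" using big2 divide_pos_pos[OF N0, of "2 * K"] K0 by (intro notI) simp
    have "norm (\<Sum>u\<in>{a..<b}. average {0..<L} (\<lambda>t. ?\<phi> (u + int q * t)))
        \<le> (\<Sum>u\<in>{a..<b}. norm (average {0..<L} (\<lambda>t. ?\<phi> (u + int q * t))))" by (rule norm_sum)
    also have "\<dots> < (\<Sum>u\<in>{a..<b}. 1 / (2 * K))" using neg ne by (intro sum_strict_mono) (auto simp: not_le)
    also have "\<dots> = real (nat (b - a)) * (1 / (2 * K))" by simp
    also have "\<dots> \<le> real N * (1 / (2 * K))" using J K0 by (intro mult_right_mono) auto
    finally show False using big2 by simp
  qed
  then obtain u where u: "u \<in> {a..<b}" "1 / (2 * K) \<le> norm (average {0..<L} (\<lambda>t. ?\<phi> (u + int q * t)))" by blast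
  have close: "norm (?\<phi> (u + int q * t) - ?\<phi> u * echar (real q * \<gamma> * of_int t)) \<le> 1 / (4 * K)" if t: "t \<in> {0..<L}" for t
  proof -
    define w where "w = 2 * u * t + int q * t\<^sup>2"
    have "\<beta> * of_int ((u + int q * t)\<^sup>2) + \<gamma> * of_int (u + int q * t)
       = \<beta> * of_int (u\<^sup>2) + \<gamma> * of_int u + real q * \<gamma> * of_int t + of_int w * (real q * \<beta>)"
      unfolding w_def by (simp add: power2_eq_square algebra_simps)
    also have "\<dots> = (of_int w * \<kappa> + (\<beta> * of_int (u\<^sup>2) + \<gamma> * of_int u + real q * \<gamma> * of_int t)) + of_int (w * m)"
      unfolding kappa by (simp add: algebra_simps)
    finally have eq: "?\<phi> (u + int q * t) = echar (of_int w * \<kappa> + (\<beta> * of_int (u\<^sup>2) + \<gamma> * of_int u + real q * \<gamma> * of_int t))"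
      by (simp only: echar_add_int)
    have eq': "?\<phi> u * echar (real q * \<gamma> * of_int t) = echar (\<beta> * of_int (u\<^sup>2) + \<gamma> * of_int u + real q * \<gamma> * of_int t)"
      by (simp only: echar_add[symmetric])
    have "norm (?\<phi> (u + int q * t) - ?\<phi> u * echar (real q * \<gamma> * of_int t)) \<le> 7 * \<bar>of_int w * \<kappa>\<bar>"
      unfolding eq eq' by (rule norm_echar_diff)
    also have "\<bar>of_int w * \<kappa>\<bar> \<le> (40 * (real N)\<^sup>2 / K ^ 27) * (512 * K ^ 6 / (real N)\<^sup>2)"
      unfolding abs_mult
    proof (intro mult_mono)
      have t2: "of_int t \<le> real N / K ^ 27" using t L(2) by (smt (verit) atLeastLessThan_iff of_int_less_iff)
      have "\<bar>of_int u :: real\<bar> \<le> 4 * real N" using range[OF u(1)] by linarith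
      then have "2 * \<bar>of_int u :: real\<bar> * of_int t \<le> 2 * (4 * real N) * (real N / K ^ 27)"
        using t t2 by (intro mult_mono) auto
      moreover have "\<bar>of_int (2 * u * t) :: real\<bar> = 2 * \<bar>of_int u :: real\<bar> * of_int t"
        using t by (simp add: abs_mult)
      ultimately have "\<bar>of_int (2 * u * t) :: real\<bar> \<le> 8 * real N * (real N / K ^ 27)" by simp
      then have 1: "\<bar>of_int (2 * u * t) :: real\<bar> \<le> 8 * (real N)\<^sup>2 / K ^ 27" by (simp add: power2_eq_square)
      have "\<bar>of_int (int q * t\<^sup>2) :: real\<bar> = real q * (of_int t * of_int t)" using t by (simp add: power2_eq_square)
      also have "\<dots> \<le> 32 * K\<^sup>2 * ((real N / K ^ 27) * (real N / K ^ 27))"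
        using q(2) t2 t K0 by (intro mult_mono) auto
      also have "\<dots> = 32 * (real N)\<^sup>2 / K ^ 27 * (K\<^sup>2 / K ^ 27)" by (simp add: power2_eq_square)
      also have "\<dots> \<le> 32 * (real N)\<^sup>2 / K ^ 27 * 1"
        using K by (intro mult_left_mono) (auto intro!: power_increasing)
      finally have 2: "\<bar>of_int (int q * t\<^sup>2) :: real\<bar> \<le> 32 * (real N)\<^sup>2 / K ^ 27" by simp
      have "\<bar>of_int w :: real\<bar> \<le> \<bar>of_int (2 * u * t)\<bar> + \<bar>of_int (int q * t\<^sup>2)\<bar>"
        unfolding w_def of_int_add by (rule abs_triangle_ineq)
      then have "\<bar>of_int w :: real\<bar> \<le> 8 * (real N)\<^sup>2 / K ^ 27 + 32 * (real N)\<^sup>2 / K ^ 27" using 1 2 by linarith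
      then show "\<bar>of_int w :: real\<bar> \<le> 40 * (real N)\<^sup>2 / K ^ 27" by (simp add: add_divide_distrib[symmetric])
      show "\<bar>\<kappa>\<bar> \<le> 512 * K ^ 6 / (real N)\<^sup>2" using kappa(2) q(3) by simp
    qed (use K0 in auto)
    also have "\<dots> = 20480 * K ^ 6 / K ^ 27" using N0 by (simp add: field_simps)
    finally have "norm (?\<phi> (u + int q * t) - ?\<phi> u * echar (real q * \<gamma> * of_int t)) \<le> 143360 * K ^ 6 / K ^ 27" by simp
    also have "\<dots> \<le> 1 / (4 * K)"
    proof -
      have "573440 * K ^ 7 \<le> K ^ 27" by (rule absorb_const[OF K, of _ 20]) auto
      moreover have "K ^ 7 = K * K ^ 6" by (simp flip: power_Suc)
      ultimately show ?thesis using K0 by (simp add: field_simps)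
    qed
    finally show ?thesis .
  qed
  have "norm (average {0..<L} (\<lambda>t. ?\<phi> (u + int q * t)) - average {0..<L} (\<lambda>t. ?\<phi> u * echar (real q * \<gamma> * of_int t))) \<le> 1 / (4 * K)"
    unfolding average_diff[symmetric] by (rule norm_average_le_const[OF close]) (use K0 in auto)
  then have "1 / (2 * K) - 1 / (4 * K) \<le> norm (average {0..<L} (\<lambda>t. ?\<phi> u * echar (real q * \<gamma> * of_int t)))"
    using u(2) norm_triangle_ineq2[of "average {0..<L} (\<lambda>t. ?\<phi> (u + int q * t))" "average {0..<L} (\<lambda>t. ?\<phi> u * echar (real q * \<gamma> * of_int t))"]
    by linarith
  also have "norm (average {0..<L} (\<lambda>t. ?\<phi> u * echar (real q * \<gamma> * of_int t))) = norm (\<Sum>t\<in>{0..<L}. echar (real q * \<gamma> * of_int t)) / of_int L"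
    using L(1) by (simp add: average_mult_left norm_mult average_complex norm_divide)
  finally have "of_int L / (4 * K) \<le> norm (\<Sum>t\<in>{0..<L}. echar (real q * \<gamma> * of_int t))"
    using L0 K0 by (simp add: field_simps)
  then have "of_int L / (4 * K) * norm_circle (real q * \<gamma>) \<le> norm (\<Sum>t\<in>{0..<L}. echar (real q * \<gamma> * of_int t)) * norm_circle (real q * \<gamma>)"
    by (intro mult_right_mono) auto
  also have "\<dots> \<le> 1" by (rule geometric_echar_bound)
  finally have "norm_circle (real q * \<gamma>) \<le> 4 * K / of_int L" using L0 K0 by (simp add: field_simps)
  also have "\<dots> \<le> 4 * K / (real N / K ^ 27 / 2)" using L(3) K0 N0 L0 by (intro divide_left_mono) auto
  also have "\<dots> = 8 * K ^ 28 / real N" using K0 N0 by (simp add: field_simps flip: power_Suc)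
  also have "\<dots> \<le> K ^ 31 / real N" by (intro divide_right_mono absorb_const[OF K, of _ 3]) auto
  finally have g: "norm_circle (real q * \<gamma>) \<le> K ^ 31 / real N" .
  have "512 * K ^ 6 / (real N)\<^sup>2 \<le> K ^ 31 / (real N)\<^sup>2" by (intro divide_right_mono absorb_const[OF K, of _ 9]) auto
  moreover have "32 * K ^ 2 \<le> K ^ 31" by (rule absorb_const[OF K, of _ 5]) auto
  ultimately show ?thesis using q g by (intro exI[of _ q]) auto
qed

section \<open>Major arcs\<close>

text \<open>The tolerance is of the order of \<open>1 / M\<close>, so each fraction with denominator
  \<open>q\<close> captures only \<open>O(K)\<close> frequencies and the count in
  \<open>card_major\<close> does not grow with \<open>N\<close>.\<close>

definition major :: "nat \<Rightarrow> real \<Rightarrow> int set" where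
  "major N K = {j. \<exists>q::nat. 0 < q \<and> real q \<le> K \<and>
     norm_circle (real q * (of_int j / of_int (2 * (int N)\<^sup>2))) \<le> K / (real N)\<^sup>2}"

lemma major_mono: "K \<le> K' \<Longrightarrow> major N K \<subseteq> major N K'"
proof
  fix j assume K: "K \<le> K'" and "j \<in> major N K"
  then obtain q :: nat where "0 < q" "real q \<le> K"
    "norm_circle (real q * (of_int j / of_int (2 * (int N)\<^sup>2))) \<le> K / (real N)\<^sup>2"
    unfolding major_def by blast
  moreover have "K / (real N)\<^sup>2 \<le> K' / (real N)\<^sup>2" using K by (rule divide_right_mono) simp
  ultimately show "j \<in> major N K'" unfolding major_def using K by (intro CollectI exI[of _ q]) linarith
qed

lemma major_mod:
  assumes "N > 0"
  shows "j mod (2 * (int N)\<^sup>2) \<in> major N K \<longleftrightarrow> j \<in> major N K"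
proof -
  let ?M = "2 * (int N)\<^sup>2"
  have "norm_circle (real q * (of_int (j mod ?M) / of_int ?M)) = norm_circle (real q * (of_int j / of_int ?M))" for q
  proof -
    have M: "(of_int ?M :: real) \<noteq> 0" using assms by simp
    have "of_int j = (of_int (j mod ?M) + of_int ?M * of_int (j div ?M) :: real)"
      by (simp only: of_int_mult[symmetric] of_int_add[symmetric] mod_mult_div_eq)
    then have "of_int j / of_int ?M = (of_int (j mod ?M) / of_int ?M + of_int (j div ?M) :: real)"
      using nonzero_mult_div_cancel_left[OF M] by (simp only: add_divide_distrib)
    then have "real q * (of_int j / of_int ?M) = real q * (of_int (j mod ?M) / of_int ?M) + of_int (int q * (j div ?M))"
      by (simp add: distrib_left)
    then show ?thesis by (simp only: norm_circle_add_int)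
  qed
  then show ?thesis by (simp add: major_def)
qed

text \<open>A frequency \<open>j\<close> is encoded by its denominator, the nearest integer
  \<open>r\<close> to \<open>q * j / M\<close> and the remainder \<open>q * j - r * M\<close>. The
  code determines \<open>q * j\<close>, and each entry has a range bounded in terms of
  \<open>K\<close>.\<close>

lemma card_major:
  assumes K: "K \<ge> 2" and N: "N > 0"
  shows "real (card (major N K \<inter> {0..<2 * (int N)\<^sup>2})) \<le> K ^ 7"
proof -
  let ?M = "2 * (int N)\<^sup>2"
  define k where "k = \<lfloor>2 * K\<rfloor>"
  have M0: "(of_int ?M :: real) > 0" "?M > 0" using N by simp_all
  let ?T = "{1..\<lfloor>K\<rfloor>} \<times> {0..\<lfloor>K\<rfloor> + 1} \<times> {- k..k}"
  let ?P = "\<lambda>j q. 0 < q \<and> real q \<le> K \<and> norm_circle (real q * (of_int j / of_int ?M)) \<le> K / (real N)\<^sup>2"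
  define q where "q = (\<lambda>j. SOME q::nat. ?P j q)"
  define r where "r = (\<lambda>j. round (real (q j) * (of_int j / of_int ?M)))"
  let ?f = "\<lambda>j. (int (q j), r j, int (q j) * j - r j * ?M)"
  let ?A = "major N K \<inter> {0..<?M}"
  have q: "?P j (q j)" if "j \<in> ?A" for j
    using that unfolding q_def major_def by (intro someI_ex[of "?P j"]) auto
  have "inj_on ?f ?A"
  proof (rule inj_onI)
    fix x y assume xy: "x \<in> ?A" "y \<in> ?A" "?f x = ?f y"
    then have "int (q x) * x = int (q x) * y" by auto
    then show "x = y" using q[OF xy(1)] by simp
  qed
  moreover have "?f ` ?A \<subseteq> ?T"
  proof
    fix t assume "t \<in> ?f ` ?A"
    then obtain j where j: "j \<in> ?A" "t = ?f j" by auto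
    have qj: "?P j (q j)" by (rule q[OF j(1)])
    have j01: "0 \<le> (of_int j :: real) / of_int ?M" "of_int j / of_int ?M \<le> (1 :: real)"
    proof -
      have "0 \<le> j" "j < ?M" using j by auto
      then have "0 \<le> (of_int j :: real)" "(of_int j :: real) \<le> of_int ?M" by (simp only: of_int_0_le_iff, simp only: of_int_le_iff less_imp_le)
      then show "0 \<le> (of_int j :: real) / of_int ?M" "of_int j / of_int ?M \<le> (1 :: real)" using M0 by (simp_all only: divide_le_eq_1_pos divide_nonneg_pos)
    qed
    have x: "0 \<le> real (q j) * (of_int j / of_int ?M)" "real (q j) * (of_int j / of_int ?M) \<le> K"
      using mult_nonneg_nonneg[OF of_nat_0_le_iff j01(1)] j01 qj mult_mono[of "real (q j)" K "of_int j / of_int ?M" 1]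
      by simp_all
    have "\<bar>of_int (int (q j) * j - r j * ?M) :: real\<bar> = of_int ?M * \<bar>real (q j) * (of_int j / of_int ?M) - of_int (r j)\<bar>"
    proof -
      have "of_int (int (q j) * j - r j * ?M) = of_int ?M * (real (q j) * (of_int j / of_int ?M) - of_int (r j))"
        using M0(1) by (simp add: field_simps)
      then show ?thesis using M0(1) by (simp only: abs_mult abs_of_pos)
    qed
    also have "\<dots> \<le> of_int ?M * (K / (real N)\<^sup>2)"
      using qj M0 unfolding r_def norm_circle_round[symmetric] by (intro mult_left_mono) auto
    also have "\<dots> = 2 * K" using N by simp
    finally have "\<bar>of_int (int (q j) * j - r j * ?M)\<bar> \<le> 2 * K" .
    then have b: "- k \<le> int (q j) * j - r j * ?M" "int (q j) * j - r j * ?M \<le> k"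
      unfolding k_def by linarith+
    have "round (0::real) \<le> r j" "r j \<le> round K"
      unfolding r_def using x by (intro round_mono; simp)+
    then have r: "0 \<le> r j" "r j \<le> \<lfloor>K\<rfloor> + 1" unfolding round_def by (simp, linarith)
    have "int (q j) \<le> \<lfloor>K\<rfloor>" "1 \<le> int (q j)" using qj by (auto simp: le_floor_iff)
    then show "t \<in> ?T" using b r j(2) by simp
  qed
  ultimately have "card ?A \<le> card ?T" by (intro card_inj_on_le) auto
  also have "real \<dots> = of_int \<lfloor>K\<rfloor> * (of_int (\<lfloor>K\<rfloor> + 2) * of_int (2 * k + 1))"
    using K by (simp add: card_cartesian_product k_def)
  also have "\<dots> \<le> K * ((2 * K) * (5 * K))"
  proof (intro mult_mono)
    show "of_int (2 * k + 1) \<le> 5 * K" "of_int (\<lfloor>K\<rfloor> + 2) \<le> 2 * K" using K unfolding k_def by linarith+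
  qed (use K in \<open>auto simp: k_def\<close>)
  also have "\<dots> = 10 * K ^ 3" by (simp add: power3_eq_cube)
  also have "\<dots> \<le> K ^ 7" by (rule absorb_const[OF K, of _ 4]) auto
  finally show ?thesis by simp
qed

lemma card_major_diff:
  assumes K: "K \<ge> 2" and N: "N > 0"
  shows "real (card {s' \<in> {0..<2 * (int N)\<^sup>2}. s - s' \<in> major N K}) \<le> K ^ 7"
proof -
  let ?M = "2 * (int N)\<^sup>2"
  have M: "?M > 0" using N by simp
  have "inj_on (\<lambda>s'. (s - s') mod ?M) {s' \<in> {0..<?M}. s - s' \<in> major N K}"
  proof (rule inj_onI)
    fix x y assume xy: "x \<in> {s' \<in> {0..<?M}. s - s' \<in> major N K}" "y \<in> {s' \<in> {0..<?M}. s - s' \<in> major N K}"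
      "(s - x) mod ?M = (s - y) mod ?M"
    then have "(s - (s - x) mod ?M) mod ?M = (s - (s - y) mod ?M) mod ?M" by simp
    then have "x mod ?M = y mod ?M" unfolding mod_diff_right_eq by simp
    then show "x = y" using xy by simp
  qed
  moreover have "(\<lambda>s'. (s - s') mod ?M) ` {s' \<in> {0..<?M}. s - s' \<in> major N K} \<subseteq> major N K \<inter> {0..<?M}"
    using M by (auto simp: major_mod[OF N])
  ultimately have "card {s' \<in> {0..<?M}. s - s' \<in> major N K} \<le> card (major N K \<inter> {0..<?M})"
    by (intro card_inj_on_le) auto
  then show ?thesis using card_major[OF K N] by linarith
qed

text \<open>Each of the two variables contributes one factor \<open>1 / N\<close>: the geometric sum
  in \<open>t\<close> shows that \<open>2 * s * l / M\<close> is near an integer for many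
  \<open>l\<close>, and Vinogradov's lemma in \<open>l\<close> sharpens this to the tolerance
  \<open>1 / N\<^sup>2\<close> of the major arcs.\<close>

lemma average_eM_major:
  assumes K: "K \<ge> 2" and N: "K ^ 12 \<le> real N" and n: "real N / K \<le> of_int n" and p: "real N / K \<le> of_int p"
    and big: "1 / K \<le> average {a..<a + n} (\<lambda>l. (norm (average {b..<b + p} (\<lambda>t. eM (2 * (int N)\<^sup>2) (2 * l * t * s))))\<^sup>2)"
  shows "s \<in> major N (K ^ 12)"
proof -
  let ?M = "2 * (int N)\<^sup>2"
  let ?f = "\<lambda>l. (norm (average {b..<b + p} (\<lambda>t. eM ?M (2 * l * t * s))))\<^sup>2"
  let ?\<beta> = "2 * of_int s / of_int ?M :: real"
  have K0: "K > 0" using K by simp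
  have "(1::real) \<le> K ^ 12" using K by (simp add: one_le_power)
  then have N0: "real N > 0" using N by linarith
  have n0: "(of_int n :: real) > 0" "(of_int p :: real) > 0" using n p N0 K0 by (smt (verit) divide_pos_pos)+
  then have np: "n > 0" "p > 0" by simp_all
  have nle: "norm (average {b..<b + p} (\<lambda>t. eM ?M (2 * l * t * s))) \<le> 1" for l
    by (intro norm_average_le_const) auto
  let ?S = "{l \<in> {a..<a + n}. 1 / K / 2 \<le> ?f l}"
  have cS: "1 / K / 2 * real (card {a..<a + n}) \<le> real (card ?S)"
    using big nle K0 by (intro average_many) (auto intro: power_le_one)
  have close: "norm_circle (?\<beta> * of_int l) \<le> 2 * K\<^sup>2 / real N" if l: "l \<in> ?S" for l
  proof -
    let ?x = "norm (average {b..<b + p} (\<lambda>t. eM ?M (2 * l * t * s)))"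
    have "?x\<^sup>2 \<le> ?x" using nle[of l] by (simp add: power2_eq_square mult_left_le)
    then have x: "1 / (2 * K) \<le> ?x" using l by simp
    have "eM ?M (2 * l * t * s) = echar (?\<beta> * of_int l * of_int t)" for t
      by (simp add: eM_def mult_ac)
    then have "?x = norm (\<Sum>t\<in>{b..<b + p}. echar (?\<beta> * of_int l * of_int t)) / of_int p"
      using np by (simp add: average_complex norm_divide)
    then have "of_int p / (2 * K) \<le> norm (\<Sum>t\<in>{b..<b + p}. echar (?\<beta> * of_int l * of_int t))"
      using mult_left_mono[OF x, of "of_int p"] n0 by simp
    then have "of_int p / (2 * K) * norm_circle (?\<beta> * of_int l)
        \<le> norm (\<Sum>t\<in>{b..<b + p}. echar (?\<beta> * of_int l * of_int t)) * norm_circle (?\<beta> * of_int l)"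
      by (intro mult_right_mono) auto
    also have "\<dots> \<le> 1" by (rule geometric_echar_bound)
    finally have "norm_circle (?\<beta> * of_int l) \<le> 2 * K / of_int p" using n0 K0 by (simp add: field_simps)
    also have "\<dots> \<le> 2 * K / (real N / K)" using p K0 N0 n0 by (intro divide_left_mono) auto
    finally show ?thesis by (simp add: power2_eq_square)
  qed
  have "\<exists>q::nat. 0 < q \<and> real q \<le> 4 * (2 * K) \<and> norm_circle (real q * ?\<beta>) \<le> 16 * (2 * K)\<^sup>2 * (2 * K\<^sup>2 / real N) / of_int n"
  proof (rule vinogradov[where S = ?S and a = a])
    show "?S \<subseteq> {a..<a + n}" by auto
    show "of_int n / (2 * K) \<le> real (card ?S)" using cS np by simp
    have "128 * K ^ 3 \<le> K ^ 10" by (rule absorb_const[OF K, of _ 7]) auto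
    also have "\<dots> < K ^ 12" using K by (intro power_strict_increasing) auto
    finally show "32 * (2 * K) * (2 * K\<^sup>2 / real N) < 1" using N0 N by (simp add: field_simps power2_eq_square power3_eq_cube)
    have "32 * K ^ 3 \<le> K ^ 12" by (rule absorb_const[OF K, of _ 5]) auto
    then have "32 * K ^ 3 \<le> real N" using N by linarith
    then have "32 * K\<^sup>2 \<le> real N / K" using K0 by (simp add: field_simps power2_eq_square power3_eq_cube)
    then show "8 * (2 * K)\<^sup>2 \<le> of_int n" using n by simp
  qed (use K close in auto)
  then obtain q :: nat where q: "0 < q" "real q \<le> 4 * (2 * K)"
    "norm_circle (real q * ?\<beta>) \<le> 16 * (2 * K)\<^sup>2 * (2 * K\<^sup>2 / real N) / of_int n" by blast
  have "16 * (2 * K)\<^sup>2 * (2 * K\<^sup>2 / real N) / of_int n \<le> 16 * (2 * K)\<^sup>2 * (2 * K\<^sup>2 / real N) / (real N / K)"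
    using n n0 N0 K0 by (intro divide_left_mono) auto
  also have "\<dots> = 128 * K ^ 5 / (real N)\<^sup>2" by (simp add: field_simps power2_eq_square eval_nat_numeral)
  also have "\<dots> \<le> K ^ 12 / (real N)\<^sup>2" by (intro divide_right_mono absorb_const[OF K, of _ 7]) auto
  finally have nc: "norm_circle (real q * ?\<beta>) \<le> K ^ 12 / (real N)\<^sup>2" using q(3) by linarith
  have "16 * K ^ 1 \<le> K ^ 12" by (rule absorb_const[OF K, of _ 4]) auto
  then have "real (2 * q) \<le> K ^ 12" using q(2) by simp
  moreover have "real (2 * q) * (of_int s / of_int ?M) = real q * ?\<beta>" by simp
  ultimately show ?thesis unfolding major_def using q(1) nc by (intro CollectI exI[of _ "2 * q"]) auto
qed

section \<open>Multiplicities of linear forms\<close>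

text \<open>Telescoping with \<open>1 / (n * (n + 1))\<close>.\<close>

lemma sum_inverse_squares_le: "(\<Sum>g\<in>{G<..L::nat}. 1 / (real g)\<^sup>2) \<le> 1 / real G" if "G > 0"
proof -
  have "(\<Sum>g\<in>{G<..L}. 1 / (real g)\<^sup>2) \<le> 1 / real G - 1 / real L" if "G \<le> L"
    using that
  proof (induction L rule: dec_induct)
    case (step n)
    have "{G<..Suc n} = insert (Suc n) {G<..n}" using step.hyps by auto
    moreover have "1 / (real (Suc n))\<^sup>2 \<le> 1 / real n - 1 / real (Suc n)"
    proof -
      have n: "real n > 0" using step.hyps \<open>G > 0\<close> by simp
      have "1 / (real (Suc n))\<^sup>2 \<le> 1 / (real n * real (Suc n))"
        using n by (intro divide_left_mono) (auto simp: power2_eq_square)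
      also have "\<dots> = 1 / real n - 1 / real (Suc n)" using n by (simp add: field_simps)
      finally show ?thesis .
    qed
    ultimately show ?case using step.IH by simp
  qed simp
  then show ?thesis using that by (cases "G \<le> L") (auto intro: order_trans)
qed

lemma card_multiples:
  fixes A :: "int set"
  assumes "g > 0" "\<And>l. l \<in> A \<Longrightarrow> \<bar>v - l\<bar> \<le> int L"
  shows "real (card {l \<in> A. v - l \<noteq> 0 \<and> int g dvd v - l}) \<le> 2 * real L / real g"
proof -
  let ?S = "{l \<in> A. v - l \<noteq> 0 \<and> int g dvd v - l}"
  let ?k = "int L div int g"
  have "inj_on (\<lambda>l. (v - l) div int g) ?S"
  proof (rule inj_onI)
    fix x y assume xy: "x \<in> ?S" "y \<in> ?S" "(v - x) div int g = (v - y) div int g"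
    have "v - x = int g * ((v - x) div int g)" "v - y = int g * ((v - y) div int g)" using xy(1,2) by auto
    then have "v - x = v - y" using xy(3) by simp
    then show "x = y" by simp
  qed
  moreover have "(\<lambda>l. (v - l) div int g) ` ?S \<subseteq> {- ?k..?k} - {0}"
  proof
    fix z assume "z \<in> (\<lambda>l. (v - l) div int g) ` ?S"
    then obtain l where l: "l \<in> A" "v - l \<noteq> 0" "int g dvd v - l" "z = (v - l) div int g" by blast
    then have l3: "v - l = int g * z" by simp
    note l = l(1,2) l3
    then have "int g * \<bar>z\<bar> \<le> int L" using assms(2)[OF l(1)] by (simp add: abs_mult)
    then have "\<bar>z\<bar> \<le> ?k" using zdiv_mono1[of "int g * \<bar>z\<bar>" "int L" "int g"] assms(1) by simp
    moreover have "z \<noteq> 0" using l by auto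
    ultimately show "z \<in> {- ?k..?k} - {0}" by auto
  qed
  ultimately have "card ?S \<le> card ({- ?k..?k} - {0})" by (intro card_inj_on_le) auto
  also have "\<dots> = 2 * (L div g)"
    by (simp add: nat_mult_distrib nat_int_add flip: of_nat_div)
  also have "real \<dots> \<le> 2 * real L / real g" using of_nat_div_le_of_nat[where ?'a = real, of L g] by simp
  finally show ?thesis by simp
qed

text \<open>Sort the pairs by the value \<open>g\<close> of the gcd. Both entries are nonzero
  multiples of \<open>g\<close>, which gives at most \<open>(2 * L / g)\<^sup>2\<close> pairs, and
  the tail of the inverse squares is at most \<open>1 / G\<close>.\<close>

lemma card_gcd_large:
  fixes A :: "int set"
  assumes "G > 0" "finite A" "\<And>l. l \<in> A \<Longrightarrow> \<bar>v - l\<bar> \<le> int L"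
  shows "real (card {(l, l') \<in> A \<times> A. v - l \<noteq> 0 \<and> v - l' \<noteq> 0 \<and> gcd (v - l) (v - l') > int G}) \<le> 4 * (real L)\<^sup>2 / real G"
proof -
  let ?S = "\<lambda>g. {l \<in> A. v - l \<noteq> 0 \<and> int g dvd v - l}"
  have "{(l, l') \<in> A \<times> A. v - l \<noteq> 0 \<and> v - l' \<noteq> 0 \<and> gcd (v - l) (v - l') > int G} \<subseteq> (\<Union>g\<in>{G<..L}. ?S g \<times> ?S g)"
  proof (clarify)
    fix l l' assume l: "l \<in> A" "l' \<in> A" "v - l \<noteq> 0" "v - l' \<noteq> 0" "gcd (v - l) (v - l') > int G"
    define g where "g = nat (gcd (v - l) (v - l'))"
    have g: "int g = gcd (v - l) (v - l')" by (simp add: g_def)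
    have "int g \<le> \<bar>v - l\<bar>" unfolding g using l(3) dvd_imp_le_int[of "v - l" "gcd (v - l) (v - l')"] by simp
    then have "g \<in> {G<..L}" using l(5) assms(3)[OF l(1)] g by auto
    moreover have "int g dvd v - l" "int g dvd v - l'" unfolding g by auto
    ultimately show "(l, l') \<in> (\<Union>g\<in>{G<..L}. ?S g \<times> ?S g)" using l by blast
  qed
  then have "card {(l, l') \<in> A \<times> A. v - l \<noteq> 0 \<and> v - l' \<noteq> 0 \<and> gcd (v - l) (v - l') > int G} \<le> card (\<Union>g\<in>{G<..L}. ?S g \<times> ?S g)"
    using assms(2) by (intro card_mono) auto
  also have "\<dots> \<le> (\<Sum>g\<in>{G<..L}. card (?S g \<times> ?S g))" by (rule card_UN_le) simp
  also have "real \<dots> = (\<Sum>g\<in>{G<..L}. (real (card (?S g)))\<^sup>2)" by (simp add: card_cartesian_product power2_eq_square)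
  also have "\<dots> \<le> (\<Sum>g\<in>{G<..L}. (2 * real L / real g)\<^sup>2)"
    using assms by (intro sum_mono power_mono card_multiples) auto
  also have "\<dots> = 4 * (real L)\<^sup>2 * (\<Sum>g\<in>{G<..L}. 1 / (real g)\<^sup>2)"
    by (simp add: sum_distrib_left power_divide power_mult_distrib)
  also have "\<dots> \<le> 4 * (real L)\<^sup>2 * (1 / real G)"
    using assms(1) by (intro mult_left_mono sum_inverse_squares_le) auto
  finally show ?thesis by simp
qed

text \<open>For fixed \<open>j, j'\<close> the numbers \<open>2 j' r' - 2 j r\<close> cover the residues modulo \<open>M\<close> evenly,
  up to a factor that depends only on \<open>gcd j j'\<close> and on the sizes.\<close>

lemma linear_form_multiplicity:
  fixes P :: nat and j j' M :: int
  assumes P: "P > 0" and G: "G > 0" and M: "2 * (int P)\<^sup>2 \<le> M"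
    and j: "\<bar>j\<bar> \<le> 3 * int P" "\<bar>j'\<bar> \<le> 3 * int P" "int P \<le> int G * \<bar>j'\<bar>" "gcd j j' \<le> int G"
  shows "card {(r, r') \<in> {- int P..<int P} \<times> {- int P..<int P}. (2 * j' * r' - 2 * j * r) mod M = b} \<le> 64 * G\<^sup>2"
proof -
  let ?A = "{- int P..<int P}"
  let ?F = "{(r, r') \<in> ?A \<times> ?A. (2 * j' * r' - 2 * j * r) mod M = b}"
  define g where "g = gcd j j'"
  define k where "k = j div g"
  define t where "t = j' div g"
  define m where "m = \<bar>t\<bar>"
  have j'0: "j' \<noteq> 0" using j(3) P by auto
  have g0: "g > 0" using j'0 by (simp add: g_def)
  have kt: "j = g * k" "j' = g * t" unfolding k_def t_def g_def by simp_all
  have gm: "\<bar>j'\<bar> = g * m" using g0 by (simp add: m_def kt(2) abs_mult)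
  have m0: "m > 0" using j'0 kt(2) by (auto simp: m_def)
  have M0: "M > 0" using M P by (smt (verit) of_nat_0_less_iff zero_less_power)
  have Pm: "int P \<le> (int G)\<^sup>2 * m"
  proof -
    have "int P \<le> int G * (g * m)" using j(3) gm by simp
    also have "\<dots> \<le> int G * (int G * m)" using j(4) m0 unfolding g_def by (intro mult_left_mono mult_right_mono) auto
    finally show ?thesis by (simp add: power2_eq_square)
  qed
  \<comment> \<open>The quotient by \<open>M\<close> recovers the value of the form from its
    residue. Given that value, \<open>r\<close> is determined modulo
    \<open>m = \<bar>j'\<bar> / gcd j j'\<close>, so the block number \<open>r div m\<close> fixes
    it, and then \<open>r'\<close> follows.\<close>
  let ?f = "\<lambda>(r, r'). ((2 * j' * r' - 2 * j * r) div M, r div m)"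
  have inj: "inj_on ?f ?F"
  proof (rule inj_onI, clarify)
    fix r r' s s' assume *: "(2 * j' * r' - 2 * j * r) div M = (2 * j' * s' - 2 * j * s) div M" "r div m = s div m"
      "b = (2 * j' * r' - 2 * j * r) mod M" "(2 * j' * s' - 2 * j * s) mod M = (2 * j' * r' - 2 * j * r) mod M"
    have "2 * j' * r' - 2 * j * r = 2 * j' * s' - 2 * j * s" using *(1,4) by (metis mult_div_mod_eq)
    then have eq: "j' * (r' - s') = j * (r - s)" by (simp add: algebra_simps)
    have "m dvd r - s"
    proof -
      have "g * (t * (r' - s')) = g * (k * (r - s))" using eq unfolding kt by (simp only: mult.assoc)
      then have "t * (r' - s') = k * (r - s)" using g0 by simp
      then have "t dvd k * (r - s)" by (metis dvd_triv_left)
      moreover have "coprime k t" unfolding k_def t_def g_def using j'0 by (intro div_gcd_coprime) auto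
      ultimately show ?thesis unfolding m_def by (simp add: coprime_dvd_mult_right_iff coprime_commute)
    qed
    then have "r mod m = s mod m" by (simp add: mod_eq_dvd_iff)
    then have "r = s" using *(2) by (metis mult_div_mod_eq)
    then show "r = s \<and> r' = s'" using eq j'0 by simp
  qed
  have img: "?f ` ?F \<subseteq> {-7..6} \<times> {- int P div m..int P div m}"
  proof (clarify)
    fix r r' assume r: "r \<in> ?A" "r' \<in> ?A"
    have b1: "\<bar>j' * r'\<bar> \<le> 3 * int P * int P" "\<bar>j * r\<bar> \<le> 3 * int P * int P"
      unfolding abs_mult using j(1,2) r by (intro mult_mono; auto)+
    then have "\<bar>2 * j' * r' - 2 * j * r\<bar> \<le> 12 * (int P * int P)" by (auto simp: abs_le_iff mult.assoc)
    also have "\<dots> \<le> 6 * M" using M by (simp add: power2_eq_square)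
    finally have x: "- 6 * M \<le> 2 * j' * r' - 2 * j * r" "2 * j' * r' - 2 * j * r \<le> 6 * M" by auto
    have "- 6 * M div M \<le> (2 * j' * r' - 2 * j * r) div M" "(2 * j' * r' - 2 * j * r) div M \<le> 6 * M div M"
      by (intro zdiv_mono1 x M0)+
    then have "(2 * j' * r' - 2 * j * r) div M \<in> {-7..6}"
      using nonzero_mult_div_cancel_right[of M "- 6"] M0 by simp
    moreover have "r div m \<in> {- int P div m..int P div m}" using r m0 by (auto intro: zdiv_mono1)
    ultimately show "(2 * j' * r' - 2 * j * r) div M \<in> {-7..6} \<and> r div m \<in> {- int P div m..int P div m}" by blast
  qed
  have "card ?F \<le> card ({-7..6::int} \<times> {- int P div m..int P div m})"
    by (rule card_inj_on_le[OF inj img]) auto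
  also have "\<dots> = 14 * nat (int P div m - (- int P div m) + 1)" by (simp add: card_cartesian_product)
  \<comment> \<open>The hypotheses on \<open>j'\<close> and on the gcd give
    \<open>P \<le> G\<^sup>2 * m\<close>, so only \<open>O(G\<^sup>2)\<close> blocks of length
    \<open>m\<close> meet the range of \<open>r\<close>.\<close>
  also have "\<dots> \<le> 14 * nat (4 * (int G)\<^sup>2)"
  proof -
    have "int P div m \<le> ((int G)\<^sup>2 * m) div m" "- ((int G)\<^sup>2 * m) div m \<le> - int P div m"
      using Pm m0 by (intro zdiv_mono1; simp)+
    moreover have "- ((int G)\<^sup>2 * m) div m = - (int G)\<^sup>2" using m0 by (metis less_irrefl minus_mult_left nonzero_mult_div_cancel_right)
    ultimately have "int P div m \<le> (int G)\<^sup>2" "- (int G)\<^sup>2 \<le> - int P div m" using m0 by simp_all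
    moreover have "1 \<le> (int G)\<^sup>2" using G by (simp add: one_le_power)
    ultimately show ?thesis by linarith
  qed
  also have "\<dots> \<le> 64 * G\<^sup>2" by (simp add: nat_mult_distrib nat_power_eq)
  finally show ?thesis .
qed

lemma sum_indicator_real: "finite A \<Longrightarrow> sum (indicator B) A = real (card (A \<inter> B))"
  by (simp add: indicator_def sum.If_cases)

text \<open>The linear form in \<open>r, r'\<close> is replaced by a uniform residue
  \<open>b\<close>. Pairs \<open>l, l'\<close> with degenerate coefficients have density at most
  \<open>12 / G\<close> and are bounded trivially; for all others
  \<open>linear_form_multiplicity\<close> bounds how often a residue is hit.\<close>

lemma decouple:
  fixes \<Phi> :: "int \<Rightarrow> int \<Rightarrow> int \<Rightarrow> real" and P G :: nat
  assumes P: "G \<le> P" and G: "G > 0" and M: "2 * (int P)\<^sup>2 \<le> M" and v: "\<bar>v\<bar> \<le> 2 * int P"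
    and \<Phi>: "\<And>l l' b. 0 \<le> \<Phi> l l' b" "\<And>l l' b. \<Phi> l l' b \<le> 1" "\<And>l l' b. \<Phi> l l' (b + M) = \<Phi> l l' b"
    and A: "A = {- int P..<int P}"
  shows "average A (\<lambda>l. average A (\<lambda>r. average A (\<lambda>l'. average A (\<lambda>r'. \<Phi> l l' (2 * (v - l') * r' - 2 * (v - l) * r)))))
    \<le> 12 / real G + 16 * (real G)\<^sup>2 * of_int M / (real P)\<^sup>2 * average A (\<lambda>l. average A (\<lambda>l'. average {0..<M} (\<Phi> l l')))"
proof -
  have P0: "P > 0" using P G by simp
  have M0: "M > 0" using M P0 by (smt (verit) of_nat_0_less_iff zero_less_power)
  have cA: "card A = 2 * P" "finite A" by (simp_all add: A)
  have vA: "\<bar>v - l\<bar> \<le> int (3 * P)" if "l \<in> A" for l using that v unfolding A by auto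
  define C where "C = 16 * (real G)\<^sup>2 * of_int M / (real P)\<^sup>2"
  \<comment> \<open>Three kinds of degeneracy: \<open>l = v\<close>, \<open>l'\<close> closer to
    \<open>v\<close> than \<open>P / G\<close>, and a common divisor above \<open>G\<close>.\<close>
  define S1 where "S1 = {l \<in> A. v - l = 0}"
  define S2 where "S2 = {l \<in> A. int G * \<bar>v - l\<bar> < int P}"
  define S3 where "S3 = {(l, l') \<in> A \<times> A. v - l \<noteq> 0 \<and> v - l' \<noteq> 0 \<and> gcd (v - l) (v - l') > int G}"
  define Bad where "Bad = S1 \<times> A \<union> (A \<times> S2 \<union> S3)"
  have Bad: "Bad \<subseteq> A \<times> A" unfolding Bad_def S1_def S2_def S3_def by auto
  let ?L = "\<lambda>l l' r r'. 2 * (v - l') * r' - 2 * (v - l) * r"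
  let ?\<psi> = "\<lambda>l l'. average A (\<lambda>r. average A (\<lambda>r'. \<Phi> l l' (?L l l' r r')))"
  have "real (card Bad) \<le> real (card (S1 \<times> A)) + (real (card (A \<times> S2)) + real (card S3))"
    unfolding Bad_def using card_Un_le[of "S1 \<times> A" "A \<times> S2 \<union> S3"] card_Un_le[of "A \<times> S2" S3] by linarith
  moreover have "real (card (S1 \<times> A)) \<le> 2 * real P"
  proof -
    have "card S1 \<le> card {v}" by (rule card_mono) (auto simp: S1_def)
    then have "real (card S1) * (2 * real P) \<le> 1 * (2 * real P)" by (intro mult_right_mono) auto
    then show ?thesis by (simp add: card_cartesian_product cA)
  qed
  moreover have "real (card (A \<times> S2)) \<le> 2 * real P * (2 * (real P / real G) + 1)"
  proof -
    have "S2 \<subseteq> {v - int (P div G)..v + int (P div G)}"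
    proof
      fix l assume "l \<in> S2"
      then have "int G * \<bar>v - l\<bar> \<le> int P" by (simp add: S2_def)
      then have "\<bar>v - l\<bar> \<le> int (P div G)"
        using zdiv_mono1[of "int G * \<bar>v - l\<bar>" "int P" "int G"] G by (simp add: zdiv_int)
      then show "l \<in> {v - int (P div G)..v + int (P div G)}" by auto
    qed
    then have "card S2 \<le> card {v - int (P div G)..v + int (P div G)}" by (intro card_mono) auto
    also have "\<dots> = 2 * (P div G) + 1" by simp
    finally have "real (card S2) \<le> 2 * real (P div G) + 1" by linarith
    then have "real (card S2) \<le> 2 * (real P / real G) + 1" using of_nat_div_le_of_nat[where ?'a = real, of P G] by linarith
    then show ?thesis by (simp add: card_cartesian_product cA mult_left_mono)
  qed
  moreover have "real (card S3) \<le> 4 * (real (3 * P))\<^sup>2 / real G"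
    unfolding S3_def by (rule card_gcd_large[OF G cA(2) vA])
  ultimately have "real (card Bad) \<le> 2 * real P + (2 * real P * (2 * (real P / real G) + 1) + 36 * (real P)\<^sup>2 / real G)"
    by (simp add: power_mult_distrib)
  also have "\<dots> = 40 * (real P)\<^sup>2 / real G + 4 * real P" by (simp add: field_simps power2_eq_square)
  also have "\<dots> \<le> 48 * (real P)\<^sup>2 / real G"
  proof -
    have "real G * real P \<le> real P * real P" using P by (intro mult_right_mono) auto
    moreover have "0 \<le> real P * real P" by simp
    ultimately have "real G * real P \<le> real P * (real P * 2)" by linarith
    then show ?thesis using G by (simp add: field_simps power2_eq_square)
  qed
  finally have cBad: "real (card Bad) \<le> 48 * (real P)\<^sup>2 / real G" .
  have main: "?\<psi> l l' \<le> indicator Bad (l, l') + C * average {0..<M} (\<Phi> l l')" if l: "l \<in> A" "l' \<in> A" for l l'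
  proof (cases "(l, l') \<in> Bad")
    case True
    have "?\<psi> l l' \<le> 1" by (intro average_le \<Phi>) auto
    moreover have "0 \<le> C * average {0..<M} (\<Phi> l l')"
      unfolding C_def using M0 by (intro mult_nonneg_nonneg divide_nonneg_nonneg average_nonneg \<Phi>) auto
    ultimately show ?thesis using True by simp
  next
    case False
    then have g: "v - l \<noteq> 0" "int P \<le> int G * \<bar>v - l'\<bar>" "gcd (v - l) (v - l') \<le> int G"
      using l P0 by (auto simp: Bad_def S1_def S2_def S3_def not_less)
    let ?F = "\<lambda>b. {z \<in> A \<times> A. ?L l l' (fst z) (snd z) mod M = b}"
    have cF: "real (card (?F b)) \<le> 64 * (real G)\<^sup>2" for b
    proof -
      have "?F b = {(r, r') \<in> {- int P..<int P} \<times> {- int P..<int P}. ?L l l' r r' mod M = b}" by (auto simp: A)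
      then have "card (?F b) \<le> 64 * G\<^sup>2"
        using linear_form_multiplicity[OF P0 G M _ _ g(2,3), of b] vA[OF l(1)] vA[OF l(2)] by simp
      then have "real (card (?F b)) \<le> real (64 * G\<^sup>2)" by (simp only: of_nat_le_iff)
      then show ?thesis by simp
    qed
    have "(\<Sum>r\<in>A. \<Sum>r'\<in>A. \<Phi> l l' (?L l l' r r')) = (\<Sum>z\<in>A \<times> A. \<Phi> l l' (?L l l' (fst z) (snd z) mod M))"
      unfolding sum.cartesian_product periodic_mod[of "\<Phi> l l'" M, OF \<Phi>(3)]
      by (intro sum.cong refl) clarsimp
    also have "\<dots> = (\<Sum>b\<in>{0..<M}. \<Sum>z\<in>?F b. \<Phi> l l' (?L l l' (fst z) (snd z) mod M))"
      using cA(2) M0 by (subst sum.group) auto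
    also have "\<dots> = (\<Sum>b\<in>{0..<M}. real (card (?F b)) * \<Phi> l l' b)"
      by (intro sum.cong refl) simp
    also have "\<dots> \<le> (\<Sum>b\<in>{0..<M}. 64 * (real G)\<^sup>2 * \<Phi> l l' b)"
      by (intro sum_mono mult_right_mono cF \<Phi>)
    finally have "(\<Sum>r\<in>A. \<Sum>r'\<in>A. \<Phi> l l' (?L l l' r r')) \<le> 64 * (real G)\<^sup>2 * sum (\<Phi> l l') {0..<M}"
      by (simp add: sum_distrib_left)
    then have "(\<Sum>r\<in>A. \<Sum>r'\<in>A. \<Phi> l l' (?L l l' r r')) / (4 * (real P)\<^sup>2) \<le> 64 * (real G)\<^sup>2 * sum (\<Phi> l l') {0..<M} / (4 * (real P)\<^sup>2)"
      by (intro divide_right_mono) auto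
    also have "\<dots> = C * average {0..<M} (\<Phi> l l')"
      using M0 P0 by (simp add: C_def average_real field_simps)
    also have "(\<Sum>r\<in>A. \<Sum>r'\<in>A. \<Phi> l l' (?L l l' r r')) / (4 * (real P)\<^sup>2) = ?\<psi> l l'"
      by (simp add: average_real cA sum_divide_distrib power2_eq_square mult_ac)
    finally show ?thesis using False by simp
  qed
  have "average A (\<lambda>l. average A (\<lambda>r. average A (\<lambda>l'. average A (\<lambda>r'. \<Phi> l l' (?L l l' r r')))))
      = average A (\<lambda>l. average A (\<lambda>l'. ?\<psi> l l'))"
    by (intro average_cong average_swap)
  also have "\<dots> \<le> average A (\<lambda>l. average A (\<lambda>l'. indicator Bad (l, l') + C * average {0..<M} (\<Phi> l l')))"
    by (intro average_mono main)
  also have "\<dots> = average (A \<times> A) (indicator Bad) + C * average A (\<lambda>l. average A (\<lambda>l'. average {0..<M} (\<Phi> l l')))"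
    by (simp add: average_add average_mult_left average_Times)
  also have "average (A \<times> A) (indicator Bad) = real (card Bad) / (4 * (real P)\<^sup>2)"
    using Bad cA by (simp add: average_real sum_indicator_real Int_absorb1 card_cartesian_product power2_eq_square)
  also have "\<dots> \<le> (48 * (real P)\<^sup>2 / real G) / (4 * (real P)\<^sup>2)" by (intro divide_right_mono cBad) simp
  also have "\<dots> = 12 / real G" using P0 by simp
  finally show ?thesis unfolding C_def by simp
qed

section \<open>Concatenation\<close>

text \<open>Averaging translates over \<open>p1\<close> is a convolution, so on the Fourier side it
  becomes a weight depending on \<open>l'\<close> and the frequency; the translation by
  \<open>- 2 * l * p\<close> only changes phases. Parseval then gives the sum over
  \<open>g\<close>.\<close>

lemma average_shift_square_ft:
  assumes M: "M > 0" and Z: "ubp M Z"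
  shows "average B (\<lambda>p. average B (\<lambda>p'. average {0..<M} (\<lambda>y. (norm (average B (\<lambda>p1.
          Z (y - 2 * l * p - 2 * l' * p1) * cnj (Z (y - 2 * l * p' - 2 * l' * p1)))))\<^sup>2)))
    = average B (\<lambda>p. average B (\<lambda>p'. \<Sum>g\<in>{0..<M}.
        (norm (ft M (\<lambda>y. Z y * cnj (Z (y + 2 * l * (p - p')))) g))\<^sup>2 * (norm (average B (\<lambda>p1. eM M (2 * l' * p1 * g))))\<^sup>2))"
proof (intro average_cong)
  fix p p'
  let ?W = "\<lambda>y. Z y * cnj (Z (y + 2 * l * (p - p')))"
  have W: "ubp M ?W" by (intro ubp_intros Z)
  have sh: "Z (y - 2 * l * p - 2 * l' * p1) * cnj (Z (y - 2 * l * p' - 2 * l' * p1)) = ?W (y + (- 2 * l * p - 2 * l' * p1))" for y p1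
    by (simp add: algebra_simps)
  have ft: "ft M (\<lambda>y. average B (\<lambda>p1. ?W (y + (- 2 * l * p - 2 * l' * p1)))) g
      = eM M (g * (- 2 * l * p)) * ft M ?W g * cnj (average B (\<lambda>p1. eM M (2 * l' * p1 * g)))" for g
  proof -
    have e: "eM M (g * (- 2 * l * p - 2 * l' * p1)) = eM M (g * (- 2 * l * p)) * cnj (eM M (2 * l' * p1 * g))" for p1
      by (simp add: right_diff_distrib eM_diff mult_ac)
    show ?thesis unfolding ft_average ft_shift[OF M W] e average_cnj[symmetric] average_mult_left[symmetric]
      by (intro average_cong) (simp add: mult_ac)
  qed
  have "average {0..<M} (\<lambda>y. (norm (average B (\<lambda>p1. ?W (y + (- 2 * l * p - 2 * l' * p1)))))\<^sup>2)
      = (\<Sum>g\<in>{0..<M}. (norm (ft M ?W g))\<^sup>2 * (norm (average B (\<lambda>p1. eM M (2 * l' * p1 * g))))\<^sup>2)"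
    unfolding parseval[OF M, symmetric] ft by (simp add: norm_mult power_mult_distrib)
  then show "average {0..<M} (\<lambda>y. (norm (average B (\<lambda>p1.
          Z (y - 2 * l * p - 2 * l' * p1) * cnj (Z (y - 2 * l * p' - 2 * l' * p1)))))\<^sup>2)
      = (\<Sum>g\<in>{0..<M}. (norm (ft M ?W g))\<^sup>2 * (norm (average B (\<lambda>p1. eM M (2 * l' * p1 * g))))\<^sup>2)"
    unfolding sh .
qed

text \<open>Plancherel for the modulated and the translated copy of \<open>Z\<close>: modulation
  shifts frequencies, translation multiplies by phases.\<close>

lemma ft_difference:
  assumes M: "M > 0" and Z: "ubp M Z"
  shows "ft M (\<lambda>y. Z y * cnj (Z (y + c))) g = (\<Sum>j\<in>{0..<M}. ft M Z (j + g) * cnj (ft M Z j) * eM M (- (j * c)))"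
proof -
  have "ft M (\<lambda>y. Z y * cnj (Z (y + c))) g = average {0..<M} (\<lambda>y. (Z y * eM M (- (g * y))) * cnj (Z (y + c)))"
    by (simp add: ft_def mult_ac)
  also have "\<dots> = (\<Sum>j\<in>{0..<M}. ft M Z (j + g) * cnj (eM M (j * c) * ft M Z j))"
    by (simp only: plancherel[OF M] ft_modulate ft_shift[OF M Z])
  finally show ?thesis by (simp add: eM_minus mult_ac)
qed

text \<open>The differences \<open>2 l (t - t')\<close> are so well distributed that large Fourier coefficients of the
  differenced function on average force a large Fourier coefficient of the function itself.\<close>

lemma difference_coefficients:
  fixes K X :: real and N :: nat
  assumes K: "K \<ge> 2" and N: "K ^ 12 \<le> real N" and n: "real N / K \<le> of_int n" and p: "real N / K \<le> of_int p"
    and M: "M = 2 * (int N)\<^sup>2" and Z: "ubp M Z" and X: "\<And>j. norm (ft M Z j) \<le> X"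
  shows "average {a..<a + n} (\<lambda>l. average {b..<b + p} (\<lambda>t. average {b..<b + p} (\<lambda>t'.
      (norm (ft M (\<lambda>y. Z y * cnj (Z (y + 2 * l * (t - t')))) g))\<^sup>2))) \<le> 1 / K + K ^ 84 * X"
proof -
  have K0: "K > 0" using K by simp
  have "(1::real) \<le> K ^ 12" using K by (simp add: one_le_power)
  then have N0: "N > 0" using N by (cases N) auto
  then have M0: "M > 0" by (simp add: M)
  have X0: "X \<ge> 0" using X[of 0] norm_ge_zero order_trans by blast
  let ?A = "{a..<a + n}" and ?B = "{b..<b + p}" and ?Y = "{0..<M}"
  define c where "c j = ft M Z (j + g) * cnj (ft M Z j)" for j
  \<comment> \<open>The kernel that couples frequencies at distance \<open>w\<close> when the square
    is expanded; it is below \<open>1 / K\<close> off the major arcs.\<close>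
  define m where "m w = average ?A (\<lambda>l. (norm (average ?B (\<lambda>t. eM M (2 * l * t * w))))\<^sup>2)" for w
  have m1: "m w \<le> 1" for w
    unfolding m_def by (intro average_le power_le_one norm_average_le_const) auto
  have m0: "m w \<ge> 0" for w
    unfolding m_def by (intro average_nonneg) auto
  have K12: "K ^ 12 \<ge> 2" using K power_increasing[of 1 12 K] by simp
  have mK: "m w \<le> 1 / K + indicator (major N (K ^ 12)) w" for w
  proof (cases "w \<in> major N (K ^ 12)")
    case True
    then show ?thesis using m1[of w] K0 by (simp add: add_increasing)
  next
    case False
    then have "\<not> 1 / K \<le> m w" using average_eM_major[OF K N n p, of a b w] unfolding m_def M by blast
    then show ?thesis using False by simp
  qed
  have c_le: "norm (c j) \<le> X" for j
    unfolding c_def norm_mult complex_mod_cnj using X[of "j + g"] ft_norm_le[OF Z, of j] X0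
    by (metis mult_mono' mult_1_right norm_ge_zero)
  have sum_c: "(\<Sum>j\<in>?Y. norm (c j)) \<le> 1"
  proof -
    have "(\<Sum>j\<in>?Y. norm (c j)) = (\<Sum>j\<in>?Y. norm (ft M Z (j + g)) * norm (ft M Z j))" by (simp add: c_def norm_mult)
    also have "\<dots> \<le> (\<Sum>j\<in>?Y. ((norm (ft M Z (j + g)))\<^sup>2 + (norm (ft M Z j))\<^sup>2) / 2)"
    proof (rule sum_mono)
      show "norm (ft M Z (j + g)) * norm (ft M Z j) \<le> ((norm (ft M Z (j + g)))\<^sup>2 + (norm (ft M Z j))\<^sup>2) / 2" for j
        using sum_squares_bound[of "norm (ft M Z (j + g))" "norm (ft M Z j)"] by simp
    qed
    also have "\<dots> \<le> 1"
      using parseval_shift_le[OF M0 Z, of g] parseval_le[OF M0 Z]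
      by (simp add: sum_divide_distrib[symmetric] sum.distrib)
    finally show ?thesis .
  qed
  have expand: "complex_of_real ((norm (ft M (\<lambda>y. Z y * cnj (Z (y + 2 * l * (t - t')))) g))\<^sup>2)
     = (\<Sum>j\<in>?Y. \<Sum>j'\<in>?Y. c j * cnj (c j') * (eM M (2 * l * t * (j' - j)) * cnj (eM M (2 * l * t' * (j' - j)))))" for l t t'
  proof -
    have e: "eM M (- (j * (2 * l * (t - t')))) * cnj (eM M (- (j' * (2 * l * (t - t')))))
       = eM M (2 * l * t * (j' - j)) * cnj (eM M (2 * l * t' * (j' - j)))" for j j'
      unfolding eM_diff[symmetric] by (simp add: algebra_simps)
    have "complex_of_real ((norm (ft M (\<lambda>y. Z y * cnj (Z (y + 2 * l * (t - t')))) g))\<^sup>2)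
      = (\<Sum>j\<in>?Y. c j * eM M (- (j * (2 * l * (t - t'))))) * cnj (\<Sum>j\<in>?Y. c j * eM M (- (j * (2 * l * (t - t')))))"
      unfolding complex_norm_square ft_difference[OF M0 Z] c_def ..
    also have "\<dots> = (\<Sum>j\<in>?Y. \<Sum>j'\<in>?Y. c j * cnj (c j') * (eM M (- (j * (2 * l * (t - t')))) * cnj (eM M (- (j' * (2 * l * (t - t')))))))"
      unfolding cnj_sum sum_product complex_cnj_mult by (intro sum.cong refl) (simp only: mult_ac)
    finally show ?thesis unfolding e .
  qed
  \<comment> \<open>The phase factors into a part in \<open>t\<close> and the conjugate part in
    \<open>t'\<close>, so the averages over \<open>t\<close> and \<open>t'\<close> combine to a
    squared modulus.\<close>
  have "complex_of_real (average ?A (\<lambda>l. average ?B (\<lambda>t. average ?B (\<lambda>t'. (norm (ft M (\<lambda>y. Z y * cnj (Z (y + 2 * l * (t - t')))) g))\<^sup>2))))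
     = (\<Sum>j\<in>?Y. \<Sum>j'\<in>?Y. c j * cnj (c j') * average ?A (\<lambda>l. average ?B (\<lambda>t. average ?B (\<lambda>t'. eM M (2 * l * t * (j' - j)) * cnj (eM M (2 * l * t' * (j' - j)))))))"
    by (simp only: average_of_real[symmetric] expand average_sum average_mult_left)
  also have "\<dots> = (\<Sum>j\<in>?Y. \<Sum>j'\<in>?Y. c j * cnj (c j') * complex_of_real (m (j' - j)))"
    unfolding average_norm_square[symmetric] average_of_real m_def ..
  finally have of_real: "complex_of_real (average ?A (\<lambda>l. average ?B (\<lambda>t. average ?B (\<lambda>t'. (norm (ft M (\<lambda>y. Z y * cnj (Z (y + 2 * l * (t - t')))) g))\<^sup>2))))
     = (\<Sum>j\<in>?Y. \<Sum>j'\<in>?Y. c j * cnj (c j') * complex_of_real (m (j' - j)))" .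
  have "average ?A (\<lambda>l. average ?B (\<lambda>t. average ?B (\<lambda>t'. (norm (ft M (\<lambda>y. Z y * cnj (Z (y + 2 * l * (t - t')))) g))\<^sup>2)))
     = norm (\<Sum>j\<in>?Y. \<Sum>j'\<in>?Y. c j * cnj (c j') * complex_of_real (m (j' - j)))"
    unfolding of_real[symmetric] norm_of_real by (rule abs_of_nonneg[symmetric]) (intro average_nonneg zero_le_power2)
  also have "\<dots> \<le> (\<Sum>j\<in>?Y. \<Sum>j'\<in>?Y. norm (c j * cnj (c j') * complex_of_real (m (j' - j))))"
    by (intro order_trans[OF norm_sum sum_mono] norm_sum)
  also have "\<dots> \<le> (\<Sum>j\<in>?Y. \<Sum>j'\<in>?Y. norm (c j) * norm (c j') * (1 / K + indicator (major N (K ^ 12)) (j' - j)))"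
    using mK m0 by (intro sum_mono) (auto simp: norm_mult intro!: mult_left_mono)
  also have "\<dots> = (\<Sum>j'\<in>?Y. \<Sum>j\<in>?Y. norm (c j) * norm (c j') * (1 / K + indicator (major N (K ^ 12)) (j' - j)))"
    by (rule sum.swap)
  also have "\<dots> = (\<Sum>j'\<in>?Y. norm (c j') * (\<Sum>j\<in>?Y. norm (c j)) * (1 / K) + norm (c j') * (\<Sum>j\<in>?Y. norm (c j) * indicator (major N (K ^ 12)) (j' - j)))"
    unfolding sum_distrib_left sum_distrib_right sum.distrib[symmetric] by (intro sum.cong refl) (simp only: distrib_left mult_ac)
  also have "\<dots> = (\<Sum>j\<in>?Y. norm (c j)) * (\<Sum>j\<in>?Y. norm (c j)) * (1 / K)
      + (\<Sum>j'\<in>?Y. norm (c j') * (\<Sum>j\<in>?Y. norm (c j) * indicator (major N (K ^ 12)) (j' - j)))"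
    by (simp only: sum.distrib sum_distrib_right[symmetric])
  \<comment> \<open>For fixed \<open>j'\<close> at most \<open>(K ^ 12) ^ 7\<close> values of
    \<open>j\<close> give a major difference, and each of them contributes at most
    \<open>X\<close>.\<close>
  also have "\<dots> \<le> 1 * (1 / K) + (\<Sum>j'\<in>?Y. norm (c j') * (K ^ 84 * X))"
  proof (intro add_mono mult_right_mono sum_mono mult_left_mono)
    show "(\<Sum>j\<in>?Y. norm (c j)) * (\<Sum>j\<in>?Y. norm (c j)) \<le> 1"
      using sum_c by (intro mult_le_one) (auto intro: sum_nonneg)
    fix j'
    have "(\<Sum>j\<in>?Y. norm (c j) * indicator (major N (K ^ 12)) (j' - j)) \<le> (\<Sum>j\<in>?Y. X * indicator {j. j' - j \<in> major N (K ^ 12)} j)"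
      using c_le by (intro sum_mono) (auto simp: indicator_def)
    also have "\<dots> = X * real (card {j \<in> ?Y. j' - j \<in> major N (K ^ 12)})"
      by (simp add: sum_distrib_left[symmetric] sum_indicator_real Int_def)
    also have "\<dots> \<le> X * (K ^ 12) ^ 7"
      using card_major_diff[OF K12 N0, of j'] X0 unfolding M by (intro mult_left_mono) auto
    finally show "(\<Sum>j\<in>?Y. norm (c j) * indicator (major N (K ^ 12)) (j' - j)) \<le> K ^ 84 * X"
      by (simp add: mult.commute flip: power_mult)
  qed (use K0 in auto)
  also have "\<dots> \<le> 1 / K + K ^ 84 * X"
    using sum_c X0 K0 mult_right_mono[OF sum_c, of "K ^ 84 * X"] by (simp add: sum_distrib_right)
  finally show ?thesis .
qed

section \<open>Largest Fourier coefficients and multiplicative derivatives\<close>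

definition supft :: "int \<Rightarrow> (int \<Rightarrow> complex) \<Rightarrow> real" where
  "supft M F = Max ((\<lambda>j. norm (ft M F j)) ` {0..<M})"

lemma ft_le_supft: "M > 0 \<Longrightarrow> norm (ft M F j) \<le> supft M F"
  unfolding supft_def by (subst ft_mod[symmetric]) (auto intro!: Max_ge)

lemma supft_attained: "M > 0 \<Longrightarrow> \<exists>j\<in>{0..<M}. supft M F = norm (ft M F j)"
proof -
  assume "M > 0"
  then have "supft M F \<in> (\<lambda>j. norm (ft M F j)) ` {0..<M}" unfolding supft_def by (intro Max_in) auto
  then show ?thesis by auto
qed

lemma supft_nonneg: "M > 0 \<Longrightarrow> 0 \<le> supft M F"
  using ft_le_supft[of M F 0] norm_ge_zero order_trans by blast

lemma supft_le_1: "M > 0 \<Longrightarrow> ubp M F \<Longrightarrow> supft M F \<le> 1"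
  using supft_attained[of M F] ft_norm_le by metis

definition diff :: "int \<Rightarrow> (int \<Rightarrow> complex) \<Rightarrow> int \<Rightarrow> complex" where
  "diff c F y = F y * cnj (F (y + c))"

lemma ubp_diff: "ubp M F \<Longrightarrow> ubp M (diff c F)"
  unfolding diff_def by (intro ubp_intros)

lemma diff_commute: "diff a (diff b F) = diff b (diff a F)"
  by (rule ext) (simp add: diff_def ac_simps)

lemma diff_periodic: "ubp M F \<Longrightarrow> diff (c + M) F = diff c F"
  by (rule ext) (simp add: diff_def ubp_def add.assoc[symmetric])

text \<open>After \<open>concatenate_aux\<close> and \<open>decouple\<close>, the step
  \<open>b\<close> of the derivative is uniform modulo \<open>M\<close>. The average over
  \<open>l'\<close> of the weights concentrates the sum over frequencies on the major arcs, and for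
  each major frequency the averages over \<open>l, p, p'\<close> are handled by
  \<open>difference_coefficients\<close>. Two parameters are required because the number
  \<open>K ^ 84\<close> of major frequencies multiplies the error \<open>1 / K'\<close>, so
  \<open>K'\<close> has to be chosen far larger than \<open>K\<close>. The ratio of \<open>N\<close>
  to \<open>P\<close> is measured by \<open>L\<close>.\<close>

lemma concatenate:
  fixes K K' L :: real and N P G :: nat
  assumes K: "K \<ge> 2" "K \<le> K'" and L: "0 < L" "L \<le> K" and N: "K' ^ 12 \<le> real N"
    and P: "real N / L \<le> real P" "P \<le> N" "G \<le> P" "G > 0"
    and M: "M = 2 * (int N)\<^sup>2" and T: "ubp M T" and v: "\<bar>v\<bar> \<le> 2 * int P"
    and A: "A = {- int P..<int P}" and B: "B = {0..<int P}"
  shows "(average A (\<lambda>l. average A (\<lambda>r. average {0..<M} (\<lambda>y. (norm (average B (\<lambda>p.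
            T (y + 2 * l * p) * cnj (T (y + 2 * l * p + 2 * (v - l) * r)))))\<^sup>2))))^8
    \<le> 12 / real G + 32 * (real G)\<^sup>2 * L\<^sup>2 * (1 / K + K ^ 84 * (1 / K' + K' ^ 84 * average {0..<M} (\<lambda>b. supft M (diff b T))))"
proof -
  have K0: "K > 0" "K' \<ge> 2" "K' > 0" using K by auto
  have P0: "P > 0" using P by simp
  then have N0: "N > 0" using P by simp
  then have M0: "M > 0" by (simp add: M)
  have N': "K ^ 12 \<le> real N" by (rule order_trans[OF power_mono[OF K(2)] N]) (use K0 in simp)
  have NK: "real N / K \<le> real N / L" using L K0 N0 by (intro divide_left_mono) auto
  have NK': "real N / K' \<le> real N / K" using K K0 N0 by (intro divide_left_mono) auto
  have A': "A = {- int P..<- int P + 2 * int P}" and B': "B = {0..<0 + int P}" unfolding A B by auto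
  have sz: "real N / K \<le> of_int (int P)" "real N / K' \<le> of_int (int P)" "real N / K \<le> of_int (2 * int P)" "real N / K' \<le> of_int (2 * int P)"
    using NK NK' P by simp_all
  let ?Y = "{0..<M}"
  define D where "D b l p p' = diff (2 * l * (p - p')) (diff b T)" for b l p p'
  define \<alpha> where "\<alpha> l' g = (norm (average B (\<lambda>p1. eM M (2 * l' * p1 * g))))\<^sup>2" for l' g
  define \<Phi> where "\<Phi> l l' b = average B (\<lambda>p. average B (\<lambda>p'. \<Sum>g\<in>?Y. (norm (ft M (D b l p p') g))\<^sup>2 * \<alpha> l' g))" for l l' b
  have D: "ubp M (D b l p p')" for b l p p' unfolding D_def by (intro ubp_diff T)
  have \<alpha>: "0 \<le> \<alpha> l' g" "\<alpha> l' g \<le> 1" for l' g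
    unfolding \<alpha>_def by (auto intro!: power_le_one norm_average_le_const)
  have \<Phi>0: "0 \<le> \<Phi> l l' b" for l l' b
    unfolding \<Phi>_def by (intro average_nonneg sum_nonneg mult_nonneg_nonneg \<alpha>) auto
  have \<Phi>1: "\<Phi> l l' b \<le> 1" for l l' b
    unfolding \<Phi>_def
  proof (intro average_le)
    fix p p'
    have "(\<Sum>g\<in>?Y. (norm (ft M (D b l p p') g))\<^sup>2 * \<alpha> l' g) \<le> (\<Sum>g\<in>?Y. (norm (ft M (D b l p p') g))\<^sup>2)"
      by (intro sum_mono mult_left_le \<alpha>) auto
    also have "\<dots> \<le> 1" by (rule parseval_le[OF M0 D])
    finally show "(\<Sum>g\<in>?Y. (norm (ft M (D b l p p') g))\<^sup>2 * \<alpha> l' g) \<le> 1" .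
  qed auto
  have \<Phi>M: "\<Phi> l l' (b + M) = \<Phi> l l' b" for l l' b
    unfolding \<Phi>_def D_def by (simp only: diff_periodic[OF T])
  have "2 * (int P)\<^sup>2 \<le> M" unfolding M using P(2) by (simp add: power_mono)
  note dec = decouple[where \<Phi> = \<Phi>, OF P(3,4) this v \<Phi>0 \<Phi>1 \<Phi>M A]
  have eq: "average B (\<lambda>p. average B (\<lambda>p'. average ?Y (\<lambda>y. (norm (average B (\<lambda>p1.
          (\<lambda>z. T z * cnj (T (z + b))) (y - 2 * l * p - 2 * l' * p1) *
          cnj ((\<lambda>z. T z * cnj (T (z + b))) (y - 2 * l * p' - 2 * l' * p1)))))\<^sup>2))) = \<Phi> l l' b" for l l' b
    using average_shift_square_ft[OF M0 ubp_diff[OF T], of B b l l'] unfolding \<Phi>_def D_def \<alpha>_def diff_def .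
  let ?E = "average A (\<lambda>l. average A (\<lambda>l'. average ?Y (\<Phi> l l')))"
  have "(average A (\<lambda>l. average A (\<lambda>r. average {0..<M} (\<lambda>y. (norm (average B (\<lambda>p.
            T (y + 2 * l * p) * cnj (T (y + 2 * l * p + 2 * (v - l) * r)))))\<^sup>2))))^8
      \<le> average A (\<lambda>l. average A (\<lambda>r. average A (\<lambda>l'. average A (\<lambda>r'. \<Phi> l l' (2 * (v - l') * r' - 2 * (v - l) * r)))))"
    using concatenate_aux[OF M0 T, of A A B v] unfolding eq .
  also note dec
  also have "12 / real G + 16 * (real G)\<^sup>2 * of_int M / (real P)\<^sup>2 * ?E
      \<le> 12 / real G + 32 * (real G)\<^sup>2 * L\<^sup>2 * (1 / K + K ^ 84 * (1 / K' + K' ^ 84 * average ?Y (\<lambda>b. supft M (diff b T))))"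
  proof (intro add_left_mono mult_mono)
    have "real N \<le> L * real P" using P(1) L by (simp add: field_simps)
    then have "(real N)\<^sup>2 \<le> (L * real P)\<^sup>2" by (intro power_mono) auto
    then have "16 * (real G)\<^sup>2 * (2 * (real N)\<^sup>2) \<le> 16 * (real G)\<^sup>2 * (2 * (L * real P)\<^sup>2)"
      by (intro mult_left_mono) auto
    then show "16 * (real G)\<^sup>2 * of_int M / (real P)\<^sup>2 \<le> 32 * (real G)\<^sup>2 * L\<^sup>2"
      using P0 by (simp add: M field_simps power_mult_distrib)
    have m: "average A (\<lambda>l'. \<alpha> l' g) \<le> 1 / K + indicator (major N (K ^ 12)) g" for g
    proof (cases "g \<in> major N (K ^ 12)")
      case True
      have "average A (\<lambda>l'. \<alpha> l' g) \<le> 1" by (intro average_le \<alpha>) auto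
      then show ?thesis using True K0 by (simp add: add_increasing)
    next
      case False
      then have "\<not> 1 / K \<le> average A (\<lambda>l'. \<alpha> l' g)"
        using average_eM_major[OF K(1) N' sz(3,1), of "- int P" 0 g] unfolding \<alpha>_def M A' B' by blast
      then show ?thesis using False by simp
    qed
    let ?Q = "K ^ 84 * (1 / K' + K' ^ 84 * average ?Y (\<lambda>b. supft M (diff b T)))"
    \<comment> \<open>Only the weight involves \<open>l'\<close>, so its average can be taken inside
      the sum over \<open>g\<close>.\<close>
    have "?E = average ?Y (\<lambda>b. average A (\<lambda>l. average B (\<lambda>p. average B (\<lambda>p'. \<Sum>g\<in>?Y. (norm (ft M (D b l p p') g))\<^sup>2 * average A (\<lambda>l'. \<alpha> l' g)))))"
    proof -
      have "?E = average A (\<lambda>l. average ?Y (\<lambda>b. average A (\<lambda>l'. \<Phi> l l' b)))" by (intro average_cong average_swap)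
      also have "\<dots> = average ?Y (\<lambda>b. average A (\<lambda>l. average A (\<lambda>l'. \<Phi> l l' b)))" by (rule average_swap)
      finally have 1: "?E = \<dots>" .
      have 2: "average A (\<lambda>l'. \<Phi> l l' b) = average B (\<lambda>p. average B (\<lambda>p'. \<Sum>g\<in>?Y. (norm (ft M (D b l p p') g))\<^sup>2 * average A (\<lambda>l'. \<alpha> l' g)))" for l b
        unfolding \<Phi>_def by (subst average_swap, intro average_cong, subst average_swap) (simp only: average_sum average_mult_left)
      show ?thesis using 1 unfolding 2 .
    qed
    also have "\<dots> \<le> average ?Y (\<lambda>b. average A (\<lambda>l. average B (\<lambda>p. average B (\<lambda>p'. 1 / K + (\<Sum>g\<in>major N (K ^ 12) \<inter> ?Y. (norm (ft M (D b l p p') g))\<^sup>2)))))"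
    proof (intro average_mono)
      fix b l p p'
      have "(\<Sum>g\<in>?Y. (norm (ft M (D b l p p') g))\<^sup>2 * average A (\<lambda>l'. \<alpha> l' g))
          \<le> (\<Sum>g\<in>?Y. (norm (ft M (D b l p p') g))\<^sup>2 * (1 / K + indicator (major N (K ^ 12)) g))"
        by (intro sum_mono mult_left_mono m) auto
      also have "\<dots> = (\<Sum>g\<in>?Y. (norm (ft M (D b l p p') g))\<^sup>2) * (1 / K) + (\<Sum>g\<in>?Y. (norm (ft M (D b l p p') g))\<^sup>2 * indicator (major N (K ^ 12)) g)"
        by (simp add: distrib_left sum.distrib sum_divide_distrib)
      also have "(\<Sum>g\<in>?Y. (norm (ft M (D b l p p') g))\<^sup>2 * indicator (major N (K ^ 12)) g) = (\<Sum>g\<in>major N (K ^ 12) \<inter> ?Y. (norm (ft M (D b l p p') g))\<^sup>2)"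
        by (simp add: indicator_def if_distrib sum.If_cases Int_commute cong: if_cong)
      also have "(\<Sum>g\<in>?Y. (norm (ft M (D b l p p') g))\<^sup>2) * (1 / K) \<le> 1 * (1 / K)"
        using parseval_le[OF M0 D] K0 by (intro mult_right_mono) auto
      finally show "(\<Sum>g\<in>?Y. (norm (ft M (D b l p p') g))\<^sup>2 * average A (\<lambda>l'. \<alpha> l' g)) \<le> 1 / K + (\<Sum>g\<in>major N (K ^ 12) \<inter> ?Y. (norm (ft M (D b l p p') g))\<^sup>2)"
        by simp
    qed
    also have "\<dots> = 1 / K + average ?Y (\<lambda>b. \<Sum>g\<in>major N (K ^ 12) \<inter> ?Y. average A (\<lambda>l. average B (\<lambda>p. average B (\<lambda>p'. (norm (ft M (D b l p p') g))\<^sup>2))))"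
    proof -
      have ne: "finite A" "A \<noteq> {}" "finite B" "B \<noteq> {}" "finite ?Y" "?Y \<noteq> {}" using P0 M0 by (auto simp: A B)
      show ?thesis unfolding average_add average_const[OF ne(1,2)] average_const[OF ne(3,4)] average_const[OF ne(5,6)] average_sum ..
    qed
    \<comment> \<open>Here the frequency \<open>g\<close> is fixed and the differencing directions
      are averaged, which brings down the largest coefficient of \<open>diff b T\<close>
      itself.\<close>
    also have "\<dots> \<le> 1 / K + average ?Y (\<lambda>b. \<Sum>g\<in>major N (K ^ 12) \<inter> ?Y. 1 / K' + K' ^ 84 * supft M (diff b T))"
    proof (intro add_left_mono average_mono sum_mono)
      fix b g
      show "average A (\<lambda>l. average B (\<lambda>p. average B (\<lambda>p'. (norm (ft M (D b l p p') g))\<^sup>2))) \<le> 1 / K' + K' ^ 84 * supft M (diff b T)"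
        using difference_coefficients[OF K0(2) N sz(4,2) M ubp_diff[OF T] ft_le_supft[OF M0], of "- int P" 0 b g]
        unfolding D_def diff_def[of "2 * _ * _"] A' B' by (simp only: diff_def[abs_def])
    qed
    also have "\<dots> \<le> 1 / K + ?Q"
    proof -
      have "average ?Y (\<lambda>b. \<Sum>g\<in>major N (K ^ 12) \<inter> ?Y. 1 / K' + K' ^ 84 * supft M (diff b T))
          \<le> average ?Y (\<lambda>b. K ^ 84 * (1 / K' + K' ^ 84 * supft M (diff b T)))"
      proof (intro average_mono)
        fix b
        have "K ^ 12 \<ge> 2" using K power_increasing[of 1 12 K] by simp
        from card_major[OF this N0] have c: "real (card (major N (K ^ 12) \<inter> ?Y)) \<le> K ^ 84" unfolding M by (simp flip: power_mult)
        have "0 \<le> 1 / K' + K' ^ 84 * supft M (diff b T)" using K0 supft_nonneg[OF M0] by (intro add_nonneg_nonneg mult_nonneg_nonneg) auto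
        from mult_right_mono[OF c this]
        show "(\<Sum>g\<in>major N (K ^ 12) \<inter> ?Y. 1 / K' + K' ^ 84 * supft M (diff b T)) \<le> K ^ 84 * (1 / K' + K' ^ 84 * supft M (diff b T))"
          by simp
      qed
      also have "\<dots> = ?Q"
        using M0 by (simp only: average_mult_left average_add) (simp add: average_const)
      finally show ?thesis by simp
    qed
    finally show "?E \<le> 1 / K + ?Q" .
  qed (use L in \<open>auto intro!: average_nonneg \<Phi>0\<close>)
  finally show ?thesis .
qed

section \<open>Reducing the quadratic configuration to derivatives of \<open>H\<close>\<close>

lemma sum_differences_le:
  fixes f :: "int \<Rightarrow> real" and P :: nat
  assumes "\<And>k. 0 \<le> f k"
  shows "(\<Sum>t\<in>{0..<int P}. \<Sum>t'\<in>{0..<int P}. f (t - t')) \<le> real P * sum f {- int P..<int P}"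
proof -
  have "(\<Sum>t\<in>{0..<int P}. \<Sum>t'\<in>{0..<int P}. f (t - t')) \<le> (\<Sum>t\<in>{0..<int P}. sum f {- int P..<int P})"
  proof (rule sum_mono)
    fix t assume t: "t \<in> {0..<int P}"
    have "(\<Sum>t'\<in>{0..<int P}. f (t - t')) = sum f ((\<lambda>t'. t - t') ` {0..<int P})"
      by (subst sum.reindex) (auto simp: inj_on_def)
    also have "\<dots> \<le> sum f {- int P..<int P}" using t assms by (intro sum_mono2) auto
    finally show "(\<Sum>t'\<in>{0..<int P}. f (t - t')) \<le> sum f {- int P..<int P}" .
  qed
  then show ?thesis by simp
qed

text \<open>Each difference is represented by at most \<open>P\<close> of the
  \<open>P\<^sup>2\<close> pairs, and the range of differences has length \<open>2 * P\<close>,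
  hence the factor 2.\<close>

lemma average_differences_le:
  fixes f :: "int \<Rightarrow> real" and P :: nat
  assumes "\<And>k. 0 \<le> f k"
  shows "average {0..<int P} (\<lambda>t. average {0..<int P} (\<lambda>t'. f (t - t'))) \<le> 2 * average {- int P..<int P} f"
proof (cases "P = 0")
  case False
  then show ?thesis using sum_differences_le[of f P, OF assms]
    by (simp add: average_real sum_divide_distrib[symmetric] field_simps)
qed (simp add: average_real)

lemma average_differences_le':
  fixes f :: "int \<Rightarrow> real" and P :: nat
  assumes "\<And>k. 0 \<le> f k"
  shows "average {0..<int P} (\<lambda>t. average {0..<int P} (\<lambda>t'. f (t' - t))) \<le> 2 * average {- int P..<int P} f"
  using average_differences_le[of f P, OF assms] by (subst average_swap) simp

lemma average_sums_le:
  fixes f :: "int \<Rightarrow> int \<Rightarrow> real" and P :: nat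
  assumes "\<And>k v. 0 \<le> f k v"
  shows "average {- int P..<int P} (\<lambda>k. average {- int P..<int P} (\<lambda>l. f k (k + l)))
    \<le> 2 * average {- (2 * int P)..<2 * int P} (\<lambda>v. average {- int P..<int P} (\<lambda>k. f k v))"
proof (cases "P = 0")
  case False
  let ?A = "{- int P..<int P}" and ?V = "{- (2 * int P)..<2 * int P}"
  have "(\<Sum>k\<in>?A. \<Sum>l\<in>?A. f k (k + l)) \<le> (\<Sum>k\<in>?A. sum (f k) ?V)"
  proof (rule sum_mono)
    fix k assume k: "k \<in> ?A"
    have "(\<Sum>l\<in>?A. f k (k + l)) = sum (f k) ((\<lambda>l. k + l) ` ?A)"
      by (subst sum.reindex) (auto simp: inj_on_def)
    also have "\<dots> \<le> sum (f k) ?V" using k assms by (intro sum_mono2) auto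
    finally show "(\<Sum>l\<in>?A. f k (k + l)) \<le> sum (f k) ?V" .
  qed
  also have "\<dots> = (\<Sum>v\<in>?V. \<Sum>k\<in>?A. f k v)" by (rule sum.swap)
  finally show ?thesis using False
    by (simp add: average_real sum_divide_distrib[symmetric] field_simps)
qed (simp add: average_real)

text \<open>The left-hand side of \<open>concatenate\<close> before averaging, for the function
  \<open>diff (2 * v * e) H\<close>: \<open>k\<close> is the direction of averaging and
  \<open>v\<close> the sum of the two directions produced by \<open>linearize\<close>.\<close>

definition spread :: "int \<Rightarrow> nat \<Rightarrow> (int \<Rightarrow> complex) \<Rightarrow> int \<Rightarrow> int \<Rightarrow> int \<Rightarrow> int \<Rightarrow> real" where
  "spread M P H k v e r = average {0..<M} (\<lambda>y. (norm (average {0..<int P} (\<lambda>p.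
     diff (2 * v * e) H (y + 2 * k * p) * cnj (diff (2 * v * e) H (y + 2 * k * p + 2 * (v - k) * r)))))\<^sup>2)"

lemma spread_nonneg: "0 \<le> spread M P H k v e r"
  unfolding spread_def by (intro average_nonneg) auto

text \<open>The three moving factors have directions \<open>- 2 * k\<close>, \<open>- 2 * l\<close>
  and their sum. Subtracting either of the first two from the third leaves the other one, so
  \<open>three_shifts\<close> produces steps in \<open>k + l\<close> and in \<open>l\<close> and an
  average along \<open>k\<close>; the constants disappear by translation.\<close>

lemma linear_configuration_spread:
  assumes M: "M > 0" and H: "ubp M H" and B: "B = {0..<int P}"
  shows "(norm (average B (\<lambda>r. average B (\<lambda>s. average B (\<lambda>t. average {0..<M} (\<lambda>y.
        H y * (cnj (H (y - 2 * k * (w + (r + s + t)) - k\<^sup>2)) *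
        (cnj (H (y - 2 * h * l - 2 * l * (w + (r + s + t)) - l\<^sup>2)) *
         H (y - 2 * h * l - 2 * (k + l) * (w + (r + s + t)) - (k + l)\<^sup>2))))))))) ^ 8
    \<le> average B (\<lambda>r. average B (\<lambda>r'. average B (\<lambda>s. average B (\<lambda>s'.
        spread M P H (- k) (- (k + l)) (r' - r) (s' - s)))))"
proof -
  let ?g1 = "\<lambda>y. cnj (H (y - 2 * k * w - k\<^sup>2))"
  let ?g2 = "\<lambda>y. cnj (H (y - 2 * h * l - 2 * l * w - l\<^sup>2))"
  let ?c = "- 2 * h * l - 2 * (k + l) * w - (k + l)\<^sup>2"
  let ?g3 = "\<lambda>y. H (y + ?c)"
  have ub: "ubp M ?g1" "ubp M ?g2" "ubp M ?g3" by (intro ubp_intros H)+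
  have e: "y + (- 2 * k) * x - 2 * k * w - k\<^sup>2 = y - 2 * k * (w + x) - k\<^sup>2"
    "y + (- 2 * l) * x - 2 * h * l - 2 * l * w - l\<^sup>2 = y - 2 * h * l - 2 * l * (w + x) - l\<^sup>2"
    "y + (- 2 * (k + l)) * x + ?c = y - 2 * h * l - 2 * (k + l) * (w + x) - (k + l)\<^sup>2" for y x
    by (simp_all add: algebra_simps)
  note three_shifts[OF M H ub, of B B B "- 2 * k" "- 2 * l" "- 2 * (k + l)", unfolded e]
  also have "average B (\<lambda>r. average B (\<lambda>r'. average B (\<lambda>s. average B (\<lambda>s'. average {0..<M} (\<lambda>y. (norm (average B (\<lambda>t.
          ?g3 (y + (- 2 * (k + l)) * r + (- 2 * (k + l) - (- 2 * k)) * s + (- 2 * (k + l) - (- 2 * l)) * t) *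
          cnj (?g3 (y + (- 2 * (k + l)) * r' + (- 2 * (k + l) - (- 2 * k)) * s + (- 2 * (k + l) - (- 2 * l)) * t)) *
          cnj (?g3 (y + (- 2 * (k + l)) * r + (- 2 * (k + l) - (- 2 * k)) * s' + (- 2 * (k + l) - (- 2 * l)) * t) *
          cnj (?g3 (y + (- 2 * (k + l)) * r' + (- 2 * (k + l) - (- 2 * k)) * s' + (- 2 * (k + l) - (- 2 * l)) * t))))))\<^sup>2)))))
     = average B (\<lambda>r. average B (\<lambda>r'. average B (\<lambda>s. average B (\<lambda>s'. spread M P H (- k) (- (k + l)) (r' - r) (s' - s)))))"
  proof (intro average_cong)
    fix r r' s s'
    let ?D = "diff (2 * (- (k + l)) * (r' - r)) H"
    let ?\<Psi> = "\<lambda>y. complex_of_real ((norm (average B (\<lambda>p. ?D (y + 2 * (- k) * p) * cnj (?D (y + 2 * (- k) * p + 2 * (- (k + l) - (- k)) * (s' - s))))))\<^sup>2)"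
    have "ubp M ?\<Psi>"
      unfolding complex_norm_square by (intro ubp_intros ubp_diff H)
    from ubp_average_shift[OF M this, of "- 2 * (k + l) * r - 2 * l * s + ?c"]
    have "average {0..<M} (\<lambda>y. (norm (average B (\<lambda>p. ?D (y + (- 2 * (k + l) * r - 2 * l * s + ?c) + 2 * (- k) * p) * cnj (?D (y + (- 2 * (k + l) * r - 2 * l * s + ?c) + 2 * (- k) * p + 2 * (- (k + l) - (- k)) * (s' - s))))))\<^sup>2)
       = spread M P H (- k) (- (k + l)) (r' - r) (s' - s)"
      unfolding spread_def B average_of_real of_real_eq_iff .
    moreover have "?D (y + (- 2 * (k + l) * r - 2 * l * s + ?c) + 2 * (- k) * p) * cnj (?D (y + (- 2 * (k + l) * r - 2 * l * s + ?c) + 2 * (- k) * p + 2 * (- (k + l) - (- k)) * (s' - s)))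
      = ?g3 (y + (- 2 * (k + l)) * r + (- 2 * (k + l) - (- 2 * k)) * s + (- 2 * (k + l) - (- 2 * l)) * p) *
          cnj (?g3 (y + (- 2 * (k + l)) * r' + (- 2 * (k + l) - (- 2 * k)) * s + (- 2 * (k + l) - (- 2 * l)) * p)) *
          cnj (?g3 (y + (- 2 * (k + l)) * r + (- 2 * (k + l) - (- 2 * k)) * s' + (- 2 * (k + l) - (- 2 * l)) * p) *
          cnj (?g3 (y + (- 2 * (k + l)) * r' + (- 2 * (k + l) - (- 2 * k)) * s' + (- 2 * (k + l) - (- 2 * l)) * p)))" for y p
    proof -
      define c where "c = ?c"
      have a: "y + (- 2 * (k + l) * r - 2 * l * s + c) + 2 * (- k) * p
            = y + (- 2 * (k + l)) * r + (- 2 * (k + l) - (- 2 * k)) * s + (- 2 * (k + l) - (- 2 * l)) * p + c"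
        "y + (- 2 * (k + l) * r - 2 * l * s + c) + 2 * (- k) * p + 2 * (- (k + l)) * (r' - r)
            = y + (- 2 * (k + l)) * r' + (- 2 * (k + l) - (- 2 * k)) * s + (- 2 * (k + l) - (- 2 * l)) * p + c"
        "y + (- 2 * (k + l) * r - 2 * l * s + c) + 2 * (- k) * p + 2 * (- (k + l) - (- k)) * (s' - s)
            = y + (- 2 * (k + l)) * r + (- 2 * (k + l) - (- 2 * k)) * s' + (- 2 * (k + l) - (- 2 * l)) * p + c"
        "y + (- 2 * (k + l) * r - 2 * l * s + c) + 2 * (- k) * p + 2 * (- (k + l) - (- k)) * (s' - s) + 2 * (- (k + l)) * (r' - r)
            = y + (- 2 * (k + l)) * r' + (- 2 * (k + l) - (- 2 * k)) * s' + (- 2 * (k + l) - (- 2 * l)) * p + c"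
        by (simp_all add: algebra_simps)
      show ?thesis unfolding c_def[symmetric] diff_def unfolding a(4) unfolding a(3) unfolding a(2) unfolding a(1)
        by (simp only: mult.assoc)
    qed
    ultimately show "average {0..<M} (\<lambda>y. (norm (average B (\<lambda>t.
          ?g3 (y + (- 2 * (k + l)) * r + (- 2 * (k + l) - (- 2 * k)) * s + (- 2 * (k + l) - (- 2 * l)) * t) *
          cnj (?g3 (y + (- 2 * (k + l)) * r' + (- 2 * (k + l) - (- 2 * k)) * s + (- 2 * (k + l) - (- 2 * l)) * t)) *
          cnj (?g3 (y + (- 2 * (k + l)) * r + (- 2 * (k + l) - (- 2 * k)) * s' + (- 2 * (k + l) - (- 2 * l)) * t) *
          cnj (?g3 (y + (- 2 * (k + l)) * r' + (- 2 * (k + l) - (- 2 * k)) * s' + (- 2 * (k + l) - (- 2 * l)) * t))))))\<^sup>2)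
     = spread M P H (- k) (- (k + l)) (r' - r) (s' - s)" by (simp only:)
  qed
  finally show ?thesis .
qed

text \<open>The exponent is 4 from \<open>linearize\<close> times 8 from
  \<open>three_shifts\<close>. The constant 32 comes from replacing four pairs of variables by their
  differences and one pair of differences by its sum, a factor 2 each.\<close>

lemma quadratic_configuration_spread:
  assumes M: "M > 0" and H: "ubp M H" and F: "ubp M F" and F': "ubp M F'"
    and B: "B = {0..<int P}" and A: "A = {- int P..<int P}" and V: "V = {- (2 * int P)..<2 * int P}"
  shows "(norm (average B (\<lambda>t. average B (\<lambda>s. average B (\<lambda>t1. average B (\<lambda>t2. average B (\<lambda>t3. average {0..<M} (\<lambda>y.
            H y * (F (y + (u + t + s + (t1 + t2 + t3))\<^sup>2) * F' (y + (u + h + t + s + (t1 + t2 + t3))\<^sup>2)))))))))) ^ 32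
    \<le> 32 * average V (\<lambda>v. average A (\<lambda>e. average A (\<lambda>k. average A (\<lambda>r. spread M P H k v e r))))"
    (is "?X ^ 32 \<le> _")
proof -
  let ?C = "B \<times> B \<times> B"
  let ?\<sigma> = "\<lambda>\<tau>. fst \<tau> + fst (snd \<tau>) + snd (snd \<tau>)"
  let ?lin = "\<lambda>t t' s s'. norm (average ?C (\<lambda>\<tau>. average {0..<M} (\<lambda>y.
          H y * (cnj (H (y - 2 * (t' - t) * (u + t + s + ?\<sigma> \<tau>) - (t' - t)\<^sup>2)) *
          (cnj (H (y - 2 * h * (s' - s) - 2 * (s' - s) * (u + t + s + ?\<sigma> \<tau>) - (s' - s)\<^sup>2)) *
           H (y - 2 * h * (s' - s) - 2 * (t' - t + (s' - s)) * (u + t + s + ?\<sigma> \<tau>) - (t' - t + (s' - s))\<^sup>2))))))"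
  have "?X = norm (average B (\<lambda>t. average B (\<lambda>s. average ?C (\<lambda>\<tau>. average {0..<M} (\<lambda>y.
            H y * (F (y + (u + t + s + ?\<sigma> \<tau>)\<^sup>2) * F' (y + (u + h + t + s + ?\<sigma> \<tau>)\<^sup>2)))))))"
    by (simp add: average_Times)
  then have "?X ^ 4 \<le> average B (\<lambda>t. average B (\<lambda>t'. average B (\<lambda>s. average B (\<lambda>s'. ?lin t t' s s'))))"
    using linearize[OF M H F F', of B B ?C u ?\<sigma> h] by simp
  then have "(?X ^ 4) ^ 8 \<le> (average B (\<lambda>t. average B (\<lambda>t'. average B (\<lambda>s. average B (\<lambda>s'. ?lin t t' s s'))))) ^ 8"
    by (intro power_mono) auto
  also have "\<dots> \<le> average B (\<lambda>t. average B (\<lambda>t'. average B (\<lambda>s. average B (\<lambda>s'. (?lin t t' s s') ^ 8))))"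
    by (intro order_trans[OF average_power8_le average_mono] average_power8_le order.refl)
  also have "\<dots> \<le> average B (\<lambda>t. average B (\<lambda>t'. average B (\<lambda>s. average B (\<lambda>s'.
      average B (\<lambda>r. average B (\<lambda>r'. average B (\<lambda>q. average B (\<lambda>q'.
        spread M P H (- (t' - t)) (- (t' - t + (s' - s))) (r' - r) (q' - q)))))))))"
  proof (intro average_mono[where S = B] order.refl)
    fix t t' s s'
    have "?lin t t' s s' = norm (average B (\<lambda>r. average B (\<lambda>q. average B (\<lambda>p. average {0..<M} (\<lambda>y.
        H y * (cnj (H (y - 2 * (t' - t) * (u + t + s + (r + q + p)) - (t' - t)\<^sup>2)) *
        (cnj (H (y - 2 * h * (s' - s) - 2 * (s' - s) * (u + t + s + (r + q + p)) - (s' - s)\<^sup>2)) *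
         H (y - 2 * h * (s' - s) - 2 * (t' - t + (s' - s)) * (u + t + s + (r + q + p)) - (t' - t + (s' - s))\<^sup>2))))))))"
      by (simp add: average_Times)
    then show "(?lin t t' s s') ^ 8 \<le> average B (\<lambda>r. average B (\<lambda>r'. average B (\<lambda>q. average B (\<lambda>q'.
        spread M P H (- (t' - t)) (- (t' - t + (s' - s))) (r' - r) (q' - q)))))"
      using linear_configuration_spread[OF M H B, of "t' - t" "u + t + s" h "s' - s"] by simp
  qed
  also have "\<dots> = average B (\<lambda>t. average B (\<lambda>t'. average B (\<lambda>s. average B (\<lambda>s'.
      average B (\<lambda>r. average B (\<lambda>r'. average B (\<lambda>q. average B (\<lambda>q'.
        spread M P H (t - t') (t - t' + (s - s')) (r' - r) (q' - q)))))))))"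
  proof -
    have "- (t' - t) = t - t'" "- (t' - t + (s' - s)) = t - t' + (s - s')" for t t' s s' :: int by auto
    then show ?thesis by (simp only:)
  qed
  also have "\<dots> \<le> average B (\<lambda>t. average B (\<lambda>t'. average B (\<lambda>s. average B (\<lambda>s'.
      4 * average A (\<lambda>e. average A (\<lambda>r. spread M P H (t - t') (t - t' + (s - s')) e r))))))"
  proof (intro average_mono[where S = B])
    fix t t' s s'
    let ?f = "\<lambda>e r. spread M P H (t - t') (t - t' + (s - s')) e r"
    have "average B (\<lambda>r. average B (\<lambda>r'. average B (\<lambda>q. average B (\<lambda>q'. ?f (r' - r) (q' - q)))))
        \<le> average B (\<lambda>r. average B (\<lambda>r'. 2 * average A (?f (r' - r))))"
      unfolding A B by (intro average_mono average_differences_le' spread_nonneg)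
    also have "\<dots> \<le> 2 * average A (\<lambda>e. 2 * average A (?f e))"
      unfolding A B by (rule average_differences_le'[of "\<lambda>e. 2 * average {- int P..<int P} (?f e)"])
        (intro mult_nonneg_nonneg average_nonneg spread_nonneg, simp)
    finally show "average B (\<lambda>r. average B (\<lambda>r'. average B (\<lambda>q. average B (\<lambda>q'. ?f (r' - r) (q' - q)))))
        \<le> 4 * average A (\<lambda>e. average A (\<lambda>r. ?f e r))" by (simp add: average_mult_left)
  qed
  also have "\<dots> \<le> 16 * average A (\<lambda>k. average A (\<lambda>l. average A (\<lambda>e. average A (\<lambda>r. spread M P H k (k + l) e r))))"
  proof -
    let ?f = "\<lambda>k l. average A (\<lambda>e. average A (\<lambda>r. spread M P H k (k + l) e r))"
    have nn: "0 \<le> ?f k l" for k l by (intro average_nonneg spread_nonneg)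
    have "average B (\<lambda>t. average B (\<lambda>t'. average B (\<lambda>s. average B (\<lambda>s'. 4 * ?f (t - t') (s - s')))))
        \<le> average B (\<lambda>t. average B (\<lambda>t'. 2 * average A (\<lambda>l. 4 * ?f (t - t') l)))"
      unfolding A B by (intro average_mono average_differences_le mult_nonneg_nonneg average_nonneg spread_nonneg) auto
    also have "\<dots> \<le> 2 * average A (\<lambda>k. 2 * average A (\<lambda>l. 4 * ?f k l))"
      unfolding A B
      by (rule average_differences_le[of "\<lambda>k. 2 * average {- int P..<int P} (\<lambda>l. 4 * average {- int P..<int P} (\<lambda>e. average {- int P..<int P} (\<lambda>r. spread M P H k (k + l) e r)))"])
        (intro mult_nonneg_nonneg average_nonneg spread_nonneg; simp)
    finally show ?thesis by (simp add: average_mult_left)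
  qed
  also have "\<dots> \<le> 16 * (2 * average V (\<lambda>v. average A (\<lambda>k. average A (\<lambda>e. average A (\<lambda>r. spread M P H k v e r)))))"
    unfolding A V by (intro mult_left_mono average_sums_le average_nonneg spread_nonneg) auto
  also have "average V (\<lambda>v. average A (\<lambda>k. average A (\<lambda>e. average A (\<lambda>r. spread M P H k v e r))))
     = average V (\<lambda>v. average A (\<lambda>e. average A (\<lambda>k. average A (\<lambda>r. spread M P H k v e r))))"
    by (intro average_cong[where S = V] average_swap)
  finally show ?thesis by (simp flip: power_mult)
qed

text \<open>The parameters of \<open>concatenate\<close> are tuned so that its first three terms
  cannot account for the lower bound, which forces the term with \<open>supft\<close> to be
  large.\<close>

lemma many_large_coefficients:
  fixes x :: real and N P :: nat
  assumes x: "x \<ge> 2" and N: "x ^ 8000000 \<le> real N" and P: "real N / x \<le> real P" "P \<le> N"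
    and M: "M = 2 * (int N)\<^sup>2" and H: "ubp M H"
    and A: "A = {- int P..<int P}" and V: "V = {- (2 * int P)..<2 * int P}"
    and big: "(1 / x) ^ 32 \<le> 32 * average V (\<lambda>v. average A (\<lambda>e. average A (\<lambda>k. average A (\<lambda>r. spread M P H k v e r))))"
  shows "1 / x ^ 7300000 \<le> average V (\<lambda>v. average A (\<lambda>e. average {0..<M} (\<lambda>b. supft M (diff b (diff (2 * v * e) H)))))"
    (is "_ \<le> ?E")
proof -
  have x0: "x > 0" "x \<ge> 1" using x by auto
  define G where "G = nat \<lceil>2 ^ 46 * x ^ 256\<rceil>"
  \<comment> \<open>With this \<open>D\<close> the eighth power of the hypothesis is exactly
    \<open>4 / D\<close>; three error terms of size at most \<open>1 / D\<close> leave
    \<open>1 / D\<close> for the last one.\<close>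
  define D where "D = 2 ^ 42 * x ^ 256"
  define K where "K = x ^ 1000"
  \<comment> \<open>Beyond \<open>K ^ 84 = x ^ 84000\<close> there are 1000 further powers to beat
    the factors from \<open>G\<close>, \<open>L\<close> and \<open>D\<close>.\<close>
  define K' where "K' = x ^ 85000"
  have D0: "D > 0" using x0 by (simp add: D_def)
  have xx: "(1::real) \<le> 2 ^ 46 * x ^ 256" using one_le_power[OF x0(2), of 256] by simp
  have G1: "2 ^ 46 * x ^ 256 \<le> real G" unfolding G_def by linarith
  have "real G \<le> 2 ^ 46 * x ^ 256 + 1" using xx unfolding G_def by linarith
  also have "\<dots> \<le> 2 ^ 47 * x ^ 256" using xx by simp
  also have "\<dots> \<le> x ^ 303" by (rule absorb_const[OF x, of _ 47]) auto
  finally have G2: "real G \<le> x ^ 303" .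
  have G0: "G > 0" "real G > 0" using order_trans[OF xx G1] by simp_all
  have PG: "G \<le> P"
  proof -
    have "real G * x \<le> x ^ 303 * x" using G2 x0 by (intro mult_right_mono) auto
    also have "\<dots> = x ^ 304" by (simp add: power_Suc2[symmetric] eval_nat_numeral del: power_Suc)
    also have "\<dots> \<le> x ^ 8000000" using x0 by (intro power_increasing) auto
    finally have "real G \<le> real N / x" using N x0 by (simp add: field_simps)
    then show ?thesis using P by linarith
  qed
  have P0: "P > 0" using PG G0 by simp
  then have N0: "N > 0" using P by simp
  have M0: "M > 0" using N0 by (simp add: M)
  have K: "K \<ge> 2" "K \<le> K'" "x \<le> K" unfolding K_def K'_def
    using x power_increasing[of 1 1000 x] x0 by (auto intro: power_increasing)
  have N': "K' ^ 12 \<le> real N"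
    unfolding K'_def power_mult[symmetric] using N x0 by (intro order_trans[OF power_increasing N]) auto
  let ?Q = "\<lambda>v e. average A (\<lambda>k. average A (\<lambda>r. spread M P H k v e r))"
  let ?S = "\<lambda>v e. average {0..<M} (\<lambda>b. supft M (diff b (diff (2 * v * e) H)))"
  let ?R = "\<lambda>s. 12 / real G + 32 * (real G)\<^sup>2 * x\<^sup>2 * (1 / K + K ^ 84 * (1 / K' + K' ^ 84 * s))"
  have Q: "(?Q v e) ^ 8 \<le> ?R (?S v e)" if "v \<in> V" for v e
  proof -
    have "\<bar>v\<bar> \<le> 2 * int P" using that by (auto simp: V)
    from concatenate[OF K(1,2) x0(1) K(3) N' P PG G0(1) M ubp_diff[OF H] this A refl, of "2 * v * e"]
    show ?thesis unfolding spread_def .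
  qed
  have "((1 / x) ^ 32 / 32) ^ 8 \<le> (average V (\<lambda>v. average A (?Q v))) ^ 8"
    using big x0 by (intro power_mono) auto
  also have "\<dots> \<le> average V (\<lambda>v. average A (\<lambda>e. (?Q v e) ^ 8))"
    by (intro order_trans[OF average_power8_le average_mono] average_power8_le order.refl)
  also have "\<dots> \<le> average V (\<lambda>v. average A (\<lambda>e. ?R (?S v e)))"
    by (intro average_mono Q)
  also have "\<dots> = ?R ?E"
  proof -
    have ne: "finite A" "A \<noteq> {}" "finite V" "V \<noteq> {}" using P0 by (auto simp: A V)
    show ?thesis unfolding average_add average_mult_left average_const[OF ne(1,2)] average_const[OF ne(3,4)] ..
  qed
  finally have main: "((1 / x) ^ 32 / 32) ^ 8 \<le> ?R ?E" .
  have four: "((1 / x) ^ 32 / 32) ^ 8 = 4 / D"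
    unfolding D_def power_divide power_mult[symmetric] by simp
  have T1: "12 / real G \<le> 1 / D"
  proof -
    have "12 / real G \<le> 12 / (2 ^ 46 * x ^ 256)" using G1 x0 G0 by (intro divide_left_mono) auto
    also have "\<dots> \<le> 1 / D" unfolding D_def using x0 by (simp add: field_simps)
    finally show ?thesis .
  qed
  have c: "32 * (real G)\<^sup>2 * x\<^sup>2 \<le> 32 * x ^ 608"
  proof -
    have "(real G)\<^sup>2 \<le> (x ^ 303)\<^sup>2" using G2 by (intro power_mono) auto
    then have "32 * (real G)\<^sup>2 * x\<^sup>2 \<le> 32 * (x ^ 303)\<^sup>2 * x\<^sup>2" by (intro mult_right_mono mult_left_mono) auto
    also have "\<dots> = 32 * x ^ 608" by (simp flip: power_mult power_add)
    finally show ?thesis .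
  qed
  have T2: "32 * (real G)\<^sup>2 * x\<^sup>2 * (1 / K) \<le> 1 / D"
  proof -
    have "2 ^ 47 * x ^ 864 \<le> x ^ 1000" by (rule absorb_const[OF x, of _ 47]) auto
    moreover have "32 * x ^ 608 * D = 2 ^ 47 * x ^ 864" unfolding D_def by (simp add: power_add[symmetric])
    ultimately have "32 * x ^ 608 * (1 / K) \<le> 1 / D" unfolding K_def using x0 D0 by (simp add: field_simps)
    moreover have "32 * (real G)\<^sup>2 * x\<^sup>2 * (1 / K) \<le> 32 * x ^ 608 * (1 / K)" using c K by (intro mult_right_mono) auto
    ultimately show ?thesis by linarith
  qed
  have K84: "K ^ 84 = x ^ 84000" unfolding K_def by (simp flip: power_mult)
  have K'84: "K' ^ 84 = x ^ 7140000" unfolding K'_def by (simp flip: power_mult)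
  have T3: "32 * (real G)\<^sup>2 * x\<^sup>2 * (K ^ 84 * (1 / K')) \<le> 1 / D"
  proof -
    have "2 ^ 47 * x ^ 84864 \<le> x ^ 85000" by (rule absorb_const[OF x, of _ 47]) auto
    moreover have "32 * x ^ 608 * x ^ 84000 * D = 2 ^ 47 * x ^ 84864" unfolding D_def by (simp add: power_add[symmetric])
    ultimately have "32 * x ^ 608 * (K ^ 84 * (1 / K')) \<le> 1 / D" unfolding K'_def K84 using x0 D0 by (simp add: field_simps)
    moreover have "32 * (real G)\<^sup>2 * x\<^sup>2 * (K ^ 84 * (1 / K')) \<le> 32 * x ^ 608 * (K ^ 84 * (1 / K'))"
      using c K x0 by (intro mult_right_mono) auto
    ultimately show ?thesis by linarith
  qed
  have E0: "?E \<ge> 0" by (intro average_nonneg supft_nonneg M0)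
  have T4: "32 * (real G)\<^sup>2 * x\<^sup>2 * (K ^ 84 * (K' ^ 84 * ?E)) \<le> 32 * x ^ 608 * (x ^ 84000 * (x ^ 7140000 * ?E))"
    unfolding K84 K'84 using c x0 E0 by (intro mult_right_mono) auto
  have split: "?R ?E = 12 / real G + 32 * (real G)\<^sup>2 * x\<^sup>2 * (1 / K) + 32 * (real G)\<^sup>2 * x\<^sup>2 * (K ^ 84 * (1 / K')) + 32 * (real G)\<^sup>2 * x\<^sup>2 * (K ^ 84 * (K' ^ 84 * ?E))"
    by (simp only: distrib_left add.assoc)
  have "4 / D \<le> 1 / D + 1 / D + 1 / D + 32 * x ^ 608 * (x ^ 84000 * (x ^ 7140000 * ?E))"
    using main unfolding four split by (rule order_trans) (intro add_mono T1 T2 T3 T4)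
  then have "1 / D \<le> 32 * x ^ 608 * (x ^ 84000 * (x ^ 7140000 * ?E))" by simp
  also have "\<dots> = 32 * x ^ 7224608 * ?E" by (simp flip: power_add)
  finally have "1 \<le> D * (32 * x ^ 7224608 * ?E)" using D0 by (simp add: field_simps)
  also have "\<dots> = (2 ^ 47 * x ^ 7224864) * ?E" unfolding D_def by (simp add: power_add[symmetric])
  also have "\<dots> \<le> x ^ 7300000 * ?E" by (intro mult_right_mono absorb_const[OF x, of _ 47] E0) auto
  finally show ?thesis using x0 by (simp add: field_simps)
qed

section \<open>Degree lowering\<close>

lemma ubp_eM_affine: "M \<noteq> 0 \<Longrightarrow> ubp M (\<lambda>y. eM M (- (j * (y - c))))"
  using ubp_shift'[OF ubp_eM[of M "- j"], of c] by simp

lemma ubp_eM_minus: "M \<noteq> 0 \<Longrightarrow> ubp M (\<lambda>y. eM M (- (j * y)))"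
  using ubp_eM[of M "- j"] by simp

lemma correlation_ft:
  assumes M: "M > 0" and F: "ubp M F" "ubp M F'"
  shows "average {0..<M} (\<lambda>y. F (y + c) * F' (y + d) * eM M (- (\<alpha> * y)))
    = (\<Sum>j\<in>{0..<M}. ft M F (j + \<alpha>) * cnj (ft M (\<lambda>y. cnj (F' y)) j) * eM M ((j + \<alpha>) * c - j * d))"
proof -
  have "average {0..<M} (\<lambda>y. F (y + c) * F' (y + d) * eM M (- (\<alpha> * y)))
      = average {0..<M} (\<lambda>y. (F (y + c) * eM M (- (\<alpha> * y))) * cnj (cnj (F' (y + d))))"
    by (simp add: mult_ac)
  also have "\<dots> = (\<Sum>j\<in>{0..<M}. (eM M ((j + \<alpha>) * c) * ft M F (j + \<alpha>)) * cnj (eM M (j * d) * ft M (\<lambda>y. cnj (F' y)) j))"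
    by (simp only: plancherel[OF M] ft_modulate ft_shift[OF M F(1)] ft_shift[OF M ubp_cnj[OF F(2)]])
  finally show ?thesis by (simp add: eM_diff mult_ac)
qed

lemma sum_ft_product_le:
  assumes M: "M > 0" and F: "ubp M F" "ubp M F'"
  shows "(\<Sum>j\<in>{0..<M}. norm (ft M F (j + \<alpha>)) * norm (ft M F' j)) \<le> 1"
proof -
  have "(\<Sum>j\<in>{0..<M}. norm (ft M F (j + \<alpha>)) * norm (ft M F' j))
      \<le> (\<Sum>j\<in>{0..<M}. ((norm (ft M F (j + \<alpha>)))\<^sup>2 + (norm (ft M F' j))\<^sup>2) / 2)"
  proof (rule sum_mono)
    show "norm (ft M F (j + \<alpha>)) * norm (ft M F' j) \<le> ((norm (ft M F (j + \<alpha>)))\<^sup>2 + (norm (ft M F' j))\<^sup>2) / 2" for j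
      using sum_squares_bound[of "norm (ft M F (j + \<alpha>))" "norm (ft M F' j)"] by simp
  qed
  also have "\<dots> \<le> 1"
    using parseval_shift_le[OF M F(1), of \<alpha>] parseval_le[OF M F(2)]
    by (simp add: sum_divide_distrib[symmetric] sum.distrib)
  finally show ?thesis .
qed

text \<open>The quadratic phase survives only if its leading coefficient lies on a major arc.\<close>

lemma minor_correlation_small:
  fixes K :: real and N :: nat
  assumes K: "K \<ge> 2" and N: "K ^ 31 \<le> real N" and M: "M = 2 * (int N)\<^sup>2"
    and F: "ubp M F" "ubp M F'" and J: "b - a \<le> int N" "\<And>u. u \<in> {a..<b} \<Longrightarrow> \<bar>u\<bar> \<le> 4 * int N"
    and minor: "\<alpha> \<notin> major N (K ^ 31)"
  shows "norm (\<Sum>u\<in>{a..<b}. average {0..<M} (\<lambda>y. F (y + u\<^sup>2) * F' (y + (u + h)\<^sup>2) * eM M (- (\<alpha> * y)))) \<le> real N / K"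
proof -
  have "(1::real) \<le> K ^ 31" using K by (simp add: one_le_power)
  then have N0: "N > 0" using N by (cases N) auto
  then have M0: "M > 0" by (simp add: M)
  let ?c = "\<lambda>j. ft M F (j + \<alpha>) * cnj (ft M (\<lambda>y. cnj (F' y)) j)"
  \<comment> \<open>The coefficient of \<open>u\<^sup>2\<close> is \<open>\<alpha>\<close> for every
    \<open>j\<close>, so one estimate serves all frequencies and Parseval sums them up.\<close>
  have phase: "(j + \<alpha>) * u\<^sup>2 - j * (u + h)\<^sup>2 = - j * h\<^sup>2 + (\<alpha> * u\<^sup>2 + (- 2 * j * h) * u)" for j u
    by (simp add: power2_eq_square algebra_simps)
  have W: "norm (\<Sum>u\<in>{a..<b}. eM M ((j + \<alpha>) * u\<^sup>2 - j * (u + h)\<^sup>2)) \<le> real N / K" for j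
  proof (rule ccontr)
    assume "\<not> ?thesis"
    then have "real N / K \<le> norm (\<Sum>u\<in>{a..<b}. eM M (- j * h\<^sup>2) * eM M (\<alpha> * u\<^sup>2 + (- 2 * j * h) * u))"
      unfolding phase eM_add by simp
    also have "\<dots> = norm (\<Sum>u\<in>{a..<b}. eM M (\<alpha> * u\<^sup>2 + (- 2 * j * h) * u))"
      by (simp add: sum_distrib_left[symmetric] norm_mult)
    also have "\<dots> = norm (\<Sum>u\<in>{a..<b}. echar ((of_int \<alpha> / of_int M) * of_int (u\<^sup>2) + (of_int (- 2 * j * h) / of_int M) * of_int u))"
      unfolding eM_def by (simp add: add_divide_distrib diff_divide_distrib)
    finally show False using weyl[OF K N J] minor unfolding major_def M by blast
  qed
  have eq: "(\<Sum>u\<in>{a..<b}. average {0..<M} (\<lambda>y. F (y + u\<^sup>2) * F' (y + (u + h)\<^sup>2) * eM M (- (\<alpha> * y))))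
      = (\<Sum>j\<in>{0..<M}. ?c j * (\<Sum>u\<in>{a..<b}. eM M ((j + \<alpha>) * u\<^sup>2 - j * (u + h)\<^sup>2)))"
    unfolding correlation_ft[OF M0 F] by (subst sum.swap) (simp add: sum_distrib_left)
  have "norm (\<Sum>j\<in>{0..<M}. ?c j * (\<Sum>u\<in>{a..<b}. eM M ((j + \<alpha>) * u\<^sup>2 - j * (u + h)\<^sup>2)))
      \<le> (\<Sum>j\<in>{0..<M}. norm (ft M F (j + \<alpha>)) * norm (ft M (\<lambda>y. cnj (F' y)) j) * (real N / K))"
  proof (rule order_trans[OF norm_sum sum_mono])
    fix j
    have "norm (?c j * (\<Sum>u\<in>{a..<b}. eM M ((j + \<alpha>) * u\<^sup>2 - j * (u + h)\<^sup>2)))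
        = norm (ft M F (j + \<alpha>)) * norm (ft M (\<lambda>y. cnj (F' y)) j) * norm (\<Sum>u\<in>{a..<b}. eM M ((j + \<alpha>) * u\<^sup>2 - j * (u + h)\<^sup>2))"
      by (simp only: norm_mult complex_mod_cnj)
    also have "\<dots> \<le> norm (ft M F (j + \<alpha>)) * norm (ft M (\<lambda>y. cnj (F' y)) j) * (real N / K)"
      by (rule mult_left_mono[OF W]) simp
    finally show "norm (?c j * (\<Sum>u\<in>{a..<b}. eM M ((j + \<alpha>) * u\<^sup>2 - j * (u + h)\<^sup>2)))
        \<le> norm (ft M F (j + \<alpha>)) * norm (ft M (\<lambda>y. cnj (F' y)) j) * (real N / K)" .
  qed
  also have "\<dots> = (\<Sum>j\<in>{0..<M}. norm (ft M F (j + \<alpha>)) * norm (ft M (\<lambda>y. cnj (F' y)) j)) * (real N / K)"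
    by (rule sum_distrib_right[symmetric])
  also have "\<dots> \<le> 1 * (real N / K)"
  proof (rule mult_right_mono)
    show "(\<Sum>j\<in>{0..<M}. norm (ft M F (j + \<alpha>)) * norm (ft M (\<lambda>y. cnj (F' y)) j)) \<le> 1"
      by (rule sum_ft_product_le[OF M0 F(1) ubp_cnj[OF F(2)]])
    show "0 \<le> real N / K" using K by simp
  qed
  finally show ?thesis unfolding eq by (simp only: mult_1)
qed

text \<open>Only one copy of the dual function is opened. Translating by \<open>- c\<close> frees
  the other copy \<open>b1\<close> from \<open>c\<close> and \<open>u\<close>, so it is discarded
  while \<open>c\<close> is doubled, and the frequencies enter through
  \<open>\<theta> c - \<theta> c'\<close>. The norms of the weights are kept because later they mark
  the \<open>c\<close> with a large coefficient.\<close>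

lemma dual_difference_interchange:
  assumes M: "M > 0" and \<Phi>: "\<And>u. ubp M (\<Phi> u)" and b1: "ubp M b1" and \<omega>: "\<And>c. norm (\<omega> c) \<le> 1"
  shows "(norm (average C (\<lambda>c. \<omega> c * average {0..<M} (\<lambda>y. average I (\<lambda>u. \<Phi> u y) * b1 (y + c) * eM M (- (\<theta> c * y))))))\<^sup>2
    \<le> average C (\<lambda>c. average C (\<lambda>c'. norm (\<omega> c) * norm (\<omega> c') *
        norm (average I (\<lambda>u. average {0..<M} (\<lambda>y. \<Phi> u (y - c) * cnj (\<Phi> u (y - c')) * eM M (- ((\<theta> c - \<theta> c') * y)))))))"
proof -
  let ?Y = "{0..<M}"
  let ?z = "\<lambda>c u y. \<omega> c * \<Phi> u (y - c) * eM M (- (\<theta> c * (y - c)))"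
  have M': "M \<noteq> 0" using M by simp
  have sh: "\<omega> c * average ?Y (\<lambda>y. average I (\<lambda>u. \<Phi> u y) * b1 (y + c) * eM M (- (\<theta> c * y)))
      = average ?Y (\<lambda>y. b1 y * average I (\<lambda>u. ?z c u y))" for c
  proof -
    have "ubp M (\<lambda>y. \<omega> c * (average I (\<lambda>u. \<Phi> u y) * b1 (y + c) * eM M (- (\<theta> c * y))))"
      by (intro ubp_mult ubp_const \<omega> ubp_average \<Phi> ubp_shift[OF b1] ubp_eM_minus[OF M'])
    from ubp_average_shift[OF M this, of "- c", symmetric] show ?thesis
      unfolding average_mult_left[symmetric] average_mult_right[symmetric]
      by (rule trans) (simp add: mult_ac)
  qed
  have "average C (\<lambda>c. \<omega> c * average ?Y (\<lambda>y. average I (\<lambda>u. \<Phi> u y) * b1 (y + c) * eM M (- (\<theta> c * y))))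
      = average I (\<lambda>u. average ?Y (\<lambda>y. b1 y * average C (\<lambda>c. ?z c u y)))"
  proof -
    have "average C (\<lambda>c. average ?Y (\<lambda>y. average I (\<lambda>u. b1 y * ?z c u y)))
        = average C (\<lambda>c. average I (\<lambda>u. average ?Y (\<lambda>y. b1 y * ?z c u y)))"
      by (intro average_cong average_swap)
    also have "\<dots> = average I (\<lambda>u. average C (\<lambda>c. average ?Y (\<lambda>y. b1 y * ?z c u y)))"
      by (rule average_swap)
    also have "\<dots> = average I (\<lambda>u. average ?Y (\<lambda>y. average C (\<lambda>c. b1 y * ?z c u y)))"
      by (intro average_cong average_swap)
    finally show ?thesis unfolding sh average_mult_left .
  qed
  then have "(norm (average C (\<lambda>c. \<omega> c * average ?Y (\<lambda>y. average I (\<lambda>u. \<Phi> u y) * b1 (y + c) * eM M (- (\<theta> c * y))))))\<^sup>2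
      \<le> average C (\<lambda>c. average C (\<lambda>c'. norm (average I (\<lambda>u. average ?Y (\<lambda>y. ?z c u y * cnj (?z c' u y))))))"
    by (simp only:) (rule average_eliminate, rule ubp_norm[OF b1])
  moreover have "norm (average I (\<lambda>u. average ?Y (\<lambda>y. ?z c u y * cnj (?z c' u y))))
      = norm (\<omega> c) * norm (\<omega> c') * norm (average I (\<lambda>u. average ?Y (\<lambda>y. \<Phi> u (y - c) * cnj (\<Phi> u (y - c')) * eM M (- ((\<theta> c - \<theta> c') * y)))))" for c c'
  proof -
    let ?k = "\<omega> c * cnj (\<omega> c') * eM M (\<theta> c * c - \<theta> c' * c')"
    have e: "eM M (- (\<theta> c * (y - c))) * cnj (eM M (- (\<theta> c' * (y - c')))) = eM M (\<theta> c * c - \<theta> c' * c') * eM M (- ((\<theta> c - \<theta> c') * y))" for y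
      unfolding eM_diff[symmetric] eM_add[symmetric] by (simp add: algebra_simps)
    have "?z c u y * cnj (?z c' u y) = ?k * (\<Phi> u (y - c) * cnj (\<Phi> u (y - c')) * eM M (- ((\<theta> c - \<theta> c') * y)))" for u y
    proof -
      have "?z c u y * cnj (?z c' u y) = \<omega> c * cnj (\<omega> c') * (\<Phi> u (y - c) * cnj (\<Phi> u (y - c'))) * (eM M (- (\<theta> c * (y - c))) * cnj (eM M (- (\<theta> c' * (y - c')))))"
        by (simp only: complex_cnj_mult mult_ac)
      then show ?thesis unfolding e by (simp only: mult_ac)
    qed
    then have "average I (\<lambda>u. average ?Y (\<lambda>y. ?z c u y * cnj (?z c' u y)))
        = ?k * average I (\<lambda>u. average ?Y (\<lambda>y. \<Phi> u (y - c) * cnj (\<Phi> u (y - c')) * eM M (- ((\<theta> c - \<theta> c') * y))))"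
      by (simp only: average_mult_left)
    then show ?thesis by (simp only: norm_mult norm_eM complex_mod_cnj mult_1_right)
  qed
  ultimately show ?thesis by simp
qed

text \<open>The same exchange for two directions. After translating by \<open>- m * e\<close>, both
  \<open>b1\<close> and \<open>b3\<close> are free of \<open>e\<close>, and doubling
  \<open>e\<close> removes them; after translating by \<open>- c\<close>, the doubled
  \<open>b2\<close> is free of \<open>c\<close>, and doubling \<open>c\<close> removes it. The
  frequencies end up in an alternating sum over the four corners.\<close>

lemma dual_difference_interchange_twice:
  assumes M: "M > 0" and \<Phi>: "\<And>u. ubp M (\<Phi> u)" and b: "ubp M b1" "ubp M b2" "ubp M b3" and \<omega>: "\<And>e c. norm (\<omega> e c) \<le> 1"
  shows "(norm (average A (\<lambda>e. average {0..<M} (\<lambda>c. \<omega> e c * average {0..<M} (\<lambda>y.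
            average I (\<lambda>u. \<Phi> u y) * (b1 (y + m * e) * (b2 (y + c) * b3 (y + c + m * e))) * eM M (- (\<theta> e c * y)))))))^4
    \<le> average A (\<lambda>e. average A (\<lambda>e'. average {0..<M} (\<lambda>c. average {0..<M} (\<lambda>c'.
        norm (\<omega> e c) * norm (\<omega> e' c) * (norm (\<omega> e c') * norm (\<omega> e' c')) *
        norm (average I (\<lambda>u. average {0..<M} (\<lambda>y.
          \<Phi> u (y - c - m * e) * cnj (\<Phi> u (y - c - m * e')) * cnj (\<Phi> u (y - c' - m * e) * cnj (\<Phi> u (y - c' - m * e'))) *
          eM M (- ((\<theta> e c - \<theta> e' c - (\<theta> e c' - \<theta> e' c')) * y)))))))))"
    (is "?X ^ 4 \<le> ?rhs")
proof -
  let ?Y = "{0..<M}"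
  have M': "M \<noteq> 0" using M by simp
  let ?z = "\<lambda>e \<tau> y. \<omega> e (fst \<tau>) * \<Phi> (snd \<tau>) (y - m * e) * b2 (y + fst \<tau> - m * e) * eM M (- (\<theta> e (fst \<tau>) * (y - m * e)))"
  let ?w = "\<lambda>\<tau> y. b1 y * b3 (y + fst \<tau>)"
  have sh: "\<omega> e c * average ?Y (\<lambda>y. average I (\<lambda>u. \<Phi> u y) * (b1 (y + m * e) * (b2 (y + c) * b3 (y + c + m * e))) * eM M (- (\<theta> e c * y)))
      = average ?Y (\<lambda>y. average I (\<lambda>u. ?w (c, u) y * ?z e (c, u) y))" for e c
  proof -
    have "ubp M (\<lambda>y. \<omega> e c * (average I (\<lambda>u. \<Phi> u y) * (b1 (y + m * e) * (b2 (y + c) * b3 (y + c + m * e))) * eM M (- (\<theta> e c * y))))"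
      by (intro ubp_mult ubp_const \<omega> ubp_average \<Phi> ubp_shift[OF b(1)] ubp_shift[OF b(2)] ubp_shift[OF ubp_shift[OF b(3)]] ubp_eM_minus[OF M'])
    from ubp_average_shift[OF M this, of "- m * e", symmetric] show ?thesis
      unfolding average_mult_left[symmetric] average_mult_right[symmetric]
      by (rule trans) (simp add: algebra_simps)
  qed
  have eq: "average A (\<lambda>e. average ?Y (\<lambda>c. \<omega> e c * average ?Y (\<lambda>y.
            average I (\<lambda>u. \<Phi> u y) * (b1 (y + m * e) * (b2 (y + c) * b3 (y + c + m * e))) * eM M (- (\<theta> e c * y)))))
      = average (?Y \<times> I) (\<lambda>\<tau>. average ?Y (\<lambda>y. ?w \<tau> y * average A (\<lambda>e. ?z e \<tau> y)))"
  proof -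
    have "average A (\<lambda>e. average ?Y (\<lambda>c. average ?Y (\<lambda>y. average I (\<lambda>u. ?w (c, u) y * ?z e (c, u) y))))
        = average A (\<lambda>e. average ?Y (\<lambda>c. average I (\<lambda>u. average ?Y (\<lambda>y. ?w (c, u) y * ?z e (c, u) y))))"
      by (intro average_cong average_swap)
    also have "\<dots> = average A (\<lambda>e. average (?Y \<times> I) (\<lambda>\<tau>. average ?Y (\<lambda>y. ?w \<tau> y * ?z e \<tau> y)))"
      by (simp only: average_Times)
    also have "\<dots> = average (?Y \<times> I) (\<lambda>\<tau>. average A (\<lambda>e. average ?Y (\<lambda>y. ?w \<tau> y * ?z e \<tau> y)))"
      by (rule average_swap)
    also have "\<dots> = average (?Y \<times> I) (\<lambda>\<tau>. average ?Y (\<lambda>y. average A (\<lambda>e. ?w \<tau> y * ?z e \<tau> y)))"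
      by (intro average_cong average_swap)
    finally show ?thesis unfolding sh average_mult_left .
  qed
  have "?X\<^sup>2 \<le> average A (\<lambda>e. average A (\<lambda>e'. norm (average (?Y \<times> I) (\<lambda>\<tau>. average ?Y (\<lambda>y. ?z e \<tau> y * cnj (?z e' \<tau> y))))))"
    unfolding eq by (rule average_eliminate) (rule ubp_norm[OF ubp_mult[OF b(1) ubp_shift[OF b(3)]]])
  then have "?X ^ 4 \<le> (average A (\<lambda>e. average A (\<lambda>e'. norm (average (?Y \<times> I) (\<lambda>\<tau>. average ?Y (\<lambda>y. ?z e \<tau> y * cnj (?z e' \<tau> y)))))))\<^sup>2"
    using power_mono[of "?X\<^sup>2" _ 2] by (simp flip: power_mult)
  also have "\<dots> \<le> average A (\<lambda>e. average A (\<lambda>e'. (norm (average (?Y \<times> I) (\<lambda>\<tau>. average ?Y (\<lambda>y. ?z e \<tau> y * cnj (?z e' \<tau> y)))))\<^sup>2))"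
    by (rule order_trans[OF average_square_le average_mono]) (rule average_square_le)
  also have "\<dots> \<le> ?rhs"
  proof (intro average_mono[where S = A])
    fix e e'
    let ?W = "\<lambda>y. b2 (y - m * e) * cnj (b2 (y - m * e'))"
    let ?x = "\<lambda>c u y. (\<omega> e c * cnj (\<omega> e' c)) * (\<Phi> u (y - c - m * e) * cnj (\<Phi> u (y - c - m * e'))) *
        (eM M (- (\<theta> e c * (y - c - m * e))) * cnj (eM M (- (\<theta> e' c * (y - c - m * e')))))"
    have sh2: "average ?Y (\<lambda>y. ?z e (c, u) y * cnj (?z e' (c, u) y)) = average ?Y (\<lambda>y. ?W y * ?x c u y)" for c u
    proof -
      have "ubp M (\<lambda>y. \<omega> e c * \<Phi> u (y - m * e) * b2 (y + c - m * e) * eM M (- (\<theta> e c * (y - m * e))))" for e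
        by (intro ubp_mult ubp_const \<omega> ubp_shift'[OF \<Phi>] ubp_shift[OF ubp_shift'[OF b(2)]] ubp_eM_affine[OF M'])
      from ubp_mult[OF this[of e] ubp_cnj[OF this[of e']]] have "ubp M (\<lambda>y. ?z e (c, u) y * cnj (?z e' (c, u) y))" by (simp only: fst_conv snd_conv)
      from ubp_average_shift[OF M this, of "- c", symmetric] show ?thesis
        by (rule trans) (intro average_cong, simp add: algebra_simps)
    qed
    have "average (?Y \<times> I) (\<lambda>\<tau>. average ?Y (\<lambda>y. ?z e \<tau> y * cnj (?z e' \<tau> y)))
        = average I (\<lambda>u. average ?Y (\<lambda>c. average ?Y (\<lambda>y. ?W y * ?x c u y)))"
      unfolding average_Times sh2 by (rule average_swap)
    also have "\<dots> = average I (\<lambda>u. average ?Y (\<lambda>y. ?W y * average ?Y (\<lambda>c. ?x c u y)))"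
      unfolding average_mult_left[symmetric] by (intro average_cong average_swap)
    finally have eq2: "average (?Y \<times> I) (\<lambda>\<tau>. average ?Y (\<lambda>y. ?z e \<tau> y * cnj (?z e' \<tau> y))) = \<dots>" .
    have "(norm (average (?Y \<times> I) (\<lambda>\<tau>. average ?Y (\<lambda>y. ?z e \<tau> y * cnj (?z e' \<tau> y)))))\<^sup>2
        \<le> average ?Y (\<lambda>c. average ?Y (\<lambda>c'. norm (average I (\<lambda>u. average ?Y (\<lambda>y. ?x c u y * cnj (?x c' u y))))))"
      unfolding eq2 by (rule average_eliminate) (rule ubp_norm[OF ubp_mult[OF ubp_shift'[OF b(2)] ubp_cnj[OF ubp_shift'[OF b(2)]]]])
    moreover have "norm (average I (\<lambda>u. average ?Y (\<lambda>y. ?x c u y * cnj (?x c' u y))))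
        = norm (\<omega> e c) * norm (\<omega> e' c) * (norm (\<omega> e c') * norm (\<omega> e' c')) *
        norm (average I (\<lambda>u. average {0..<M} (\<lambda>y.
          \<Phi> u (y - c - m * e) * cnj (\<Phi> u (y - c - m * e')) * cnj (\<Phi> u (y - c' - m * e) * cnj (\<Phi> u (y - c' - m * e'))) *
          eM M (- ((\<theta> e c - \<theta> e' c - (\<theta> e c' - \<theta> e' c')) * y)))))" for c c'
    proof -
      let ?t = "\<theta> e c * (c + m * e) - \<theta> e' c * (c + m * e') - (\<theta> e c' * (c' + m * e) - \<theta> e' c' * (c' + m * e'))"
      let ?k = "\<omega> e c * cnj (\<omega> e' c) * cnj (\<omega> e c' * cnj (\<omega> e' c')) * eM M ?t"
      let ?f = "\<lambda>u y. \<Phi> u (y - c - m * e) * cnj (\<Phi> u (y - c - m * e')) * cnj (\<Phi> u (y - c' - m * e) * cnj (\<Phi> u (y - c' - m * e')))"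
      let ?p = "\<lambda>c y. eM M (- (\<theta> e c * (y - c - m * e))) * cnj (eM M (- (\<theta> e' c * (y - c - m * e'))))"
      have e: "?p c y * cnj (?p c' y) = eM M ?t * eM M (- ((\<theta> e c - \<theta> e' c - (\<theta> e c' - \<theta> e' c')) * y))" for y
        unfolding eM_diff[symmetric] eM_add[symmetric] by (simp add: algebra_simps)
      have "?x c u y * cnj (?x c' u y) = ?k * (?f u y * eM M (- ((\<theta> e c - \<theta> e' c - (\<theta> e c' - \<theta> e' c')) * y)))" for u y
      proof -
        have "?x c u y * cnj (?x c' u y) = (\<omega> e c * cnj (\<omega> e' c) * cnj (\<omega> e c' * cnj (\<omega> e' c'))) * ?f u y * (?p c y * cnj (?p c' y))"
          by (simp only: complex_cnj_mult complex_cnj_cnj mult_ac)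
        then show ?thesis unfolding e by (simp only: mult_ac)
      qed
      then have "average I (\<lambda>u. average ?Y (\<lambda>y. ?x c u y * cnj (?x c' u y)))
          = ?k * average I (\<lambda>u. average ?Y (\<lambda>y. ?f u y * eM M (- ((\<theta> e c - \<theta> e' c - (\<theta> e c' - \<theta> e' c')) * y))))"
        by (simp only: average_mult_left)
      then show ?thesis by (simp only: norm_mult norm_eM complex_mod_cnj mult_1_right)
    qed
    ultimately show "(norm (average (?Y \<times> I) (\<lambda>\<tau>. average ?Y (\<lambda>y. ?z e \<tau> y * cnj (?z e' \<tau> y)))))\<^sup>2
      \<le> average ?Y (\<lambda>c. average ?Y (\<lambda>c'. norm (\<omega> e c) * norm (\<omega> e' c) * (norm (\<omega> e c') * norm (\<omega> e' c')) *
        norm (average I (\<lambda>u. average {0..<M} (\<lambda>y.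
          \<Phi> u (y - c - m * e) * cnj (\<Phi> u (y - c - m * e')) * cnj (\<Phi> u (y - c' - m * e) * cnj (\<Phi> u (y - c' - m * e'))) *
          eM M (- ((\<theta> e c - \<theta> e' c - (\<theta> e c' - \<theta> e' c')) * y)))))))"
      by (simp only:)
  qed
  finally show ?thesis .
qed

lemma mult_cnj_mult: "(a * x) * cnj (b * y) = a * cnj b * (x * cnj (y :: complex))"
  by (simp add: mult_ac)

text \<open>Substituting \<open>z = y + d\<close> in the expanded square turns the modulation into a
  phase in \<open>d\<close> alone.\<close>

lemma norm_ft_square:
  assumes M: "M > 0" and W: "ubp M W"
  shows "complex_of_real ((norm (ft M W \<phi>))\<^sup>2) = average {0..<M} (\<lambda>d. eM M (\<phi> * d) * average {0..<M} (diff d W))"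
proof -
  let ?Y = "{0..<M}"
  let ?w = "\<lambda>y. W y * eM M (- (\<phi> * y))"
  have w: "ubp M ?w" using M by (intro ubp_mult W ubp_eM_minus) simp
  have "complex_of_real ((norm (ft M W \<phi>))\<^sup>2) = average ?Y (\<lambda>y. average ?Y (\<lambda>z. ?w y * cnj (?w z)))"
    unfolding ft_def by (rule average_norm_square)
  also have "\<dots> = average ?Y (\<lambda>y. average ?Y (\<lambda>d. ?w y * cnj (?w (y + d))))"
  proof (rule average_cong)
    fix y
    show "average ?Y (\<lambda>z. ?w y * cnj (?w z)) = average ?Y (\<lambda>d. ?w y * cnj (?w (y + d)))"
      using ubp_average_shift[OF M ubp_cnj[OF w], of y] by (simp add: average_mult_left add.commute)
  qed
  also have "\<dots> = average ?Y (\<lambda>d. average ?Y (\<lambda>y. ?w y * cnj (?w (y + d))))" by (rule average_swap)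
  also have "\<dots> = average ?Y (\<lambda>d. eM M (\<phi> * d) * average ?Y (diff d W))"
  proof (rule average_cong)
    fix d
    have "?w y * cnj (?w (y + d)) = eM M (\<phi> * d) * diff d W y" for y
    proof -
      have "eM M (- (\<phi> * y)) * cnj (eM M (- (\<phi> * (y + d)))) = eM M (\<phi> * d)"
        unfolding eM_diff[symmetric] by (simp add: algebra_simps)
      then show ?thesis unfolding diff_def mult_cnj_mult by (simp add: mult.commute)
    qed
    then show "average ?Y (\<lambda>y. ?w y * cnj (?w (y + d))) = eM M (\<phi> * d) * average ?Y (diff d W)"
      by (simp only: average_mult_left)
  qed
  finally show ?thesis .
qed

text \<open>If the frequency splits into a function of \<open>e\<close> plus a function of
  \<open>c\<close>, the squared coefficient gives phases in \<open>e, d\<close> and in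
  \<open>c, d\<close> separately. For fixed \<open>d\<close>, doubling \<open>e\<close> discards the
  phase in \<open>c\<close>, and the phases in \<open>e\<close> become constants of modulus 1. Hence
  the bound is uniform in \<open>\<psi>1\<close> and \<open>\<psi>2\<close>; averaging over the full
  period of \<open>c\<close> factors the rest into a squared mean.\<close>

lemma box_bound:
  assumes M: "M > 0" and H: "ubp M H"
  shows "(average A (\<lambda>e. average {0..<M} (\<lambda>c. (norm (ft M (diff c (diff (m * e) H)) (\<psi>1 e + \<psi>2 c)))\<^sup>2)))\<^sup>2
    \<le> average {0..<M} (\<lambda>d. average A (\<lambda>e. average A (\<lambda>e'. (norm (ft M (diff (m * (e' - e)) (diff d H)) 0))\<^sup>2)))"
    (is "?L\<^sup>2 \<le> ?rhs")
proof -
  let ?Y = "{0..<M}"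
  let ?T = "\<lambda>d. average A (\<lambda>e. average ?Y (\<lambda>c. eM M (\<psi>1 e * d) * eM M (\<psi>2 c * d) * average ?Y (diff c (diff (m * e) (diff d H)))))"
  have "complex_of_real ?L = average A (\<lambda>e. average ?Y (\<lambda>c. average ?Y (\<lambda>d. eM M ((\<psi>1 e + \<psi>2 c) * d) * average ?Y (diff d (diff c (diff (m * e) H))))))"
    by (simp only: average_of_real[symmetric] norm_ft_square[OF M ubp_diff[OF ubp_diff[OF H]]])
  also have "\<dots> = average A (\<lambda>e. average ?Y (\<lambda>d. average ?Y (\<lambda>c. eM M ((\<psi>1 e + \<psi>2 c) * d) * average ?Y (diff d (diff c (diff (m * e) H))))))"
    by (intro average_cong average_swap)
  also have "\<dots> = average ?Y (\<lambda>d. average A (\<lambda>e. average ?Y (\<lambda>c. eM M ((\<psi>1 e + \<psi>2 c) * d) * average ?Y (diff d (diff c (diff (m * e) H))))))"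
    by (rule average_swap)
  also have "\<dots> = average ?Y ?T"
    by (intro average_cong) (simp only: distrib_right eM_add diff_commute)
  finally have eq: "complex_of_real ?L = average ?Y ?T" .
  have "?L\<^sup>2 = (norm (average ?Y ?T))\<^sup>2" unfolding eq[symmetric] by simp
  also have "\<dots> \<le> average ?Y (\<lambda>d. (norm (?T d))\<^sup>2)" by (rule norm_average_square_le)
  also have "\<dots> \<le> ?rhs"
  proof (intro average_mono)
    fix d
    let ?X = "diff d H"
    have X: "ubp M ?X" by (rule ubp_diff[OF H])
    let ?w = "\<lambda>c y. eM M (\<psi>2 c * d) * (?X y * cnj (?X (y + c)))"
    let ?z = "\<lambda>e c y. eM M (\<psi>1 e * d) * (cnj (?X (y + m * e)) * ?X (y + c + m * e))"
    have "?T d = average A (\<lambda>e. average ?Y (\<lambda>c. average ?Y (\<lambda>y. ?w c y * ?z e c y)))"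
      unfolding average_mult_left[symmetric]
      by (intro average_cong) (simp add: diff_def[of _ "diff _ (diff d H)"] diff_def[of _ "diff d H"] mult_ac)
    also have "\<dots> = average ?Y (\<lambda>c. average A (\<lambda>e. average ?Y (\<lambda>y. ?w c y * ?z e c y)))" by (rule average_swap)
    also have "\<dots> = average ?Y (\<lambda>c. average ?Y (\<lambda>y. average A (\<lambda>e. ?w c y * ?z e c y)))" by (intro average_cong average_swap)
    also have "\<dots> = average ?Y (\<lambda>c. average ?Y (\<lambda>y. ?w c y * average A (\<lambda>e. ?z e c y)))" by (simp only: average_mult_left)
    finally have Td: "?T d = \<dots>" .
    have "(norm (?T d))\<^sup>2 \<le> average A (\<lambda>e. average A (\<lambda>e'. norm (average ?Y (\<lambda>c. average ?Y (\<lambda>y. ?z e c y * cnj (?z e' c y))))))"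
      unfolding Td
      by (rule average_eliminate)
        (rule ubp_norm[OF ubp_mult[OF ubp_const ubp_mult[OF X ubp_cnj[OF ubp_shift[OF X]]]]], simp)
    moreover have "norm (average ?Y (\<lambda>c. average ?Y (\<lambda>y. ?z e c y * cnj (?z e' c y)))) = (norm (ft M (diff (m * (e' - e)) ?X) 0))\<^sup>2" for e e'
    proof -
      let ?Q = "\<lambda>y. ?X (y + m * e) * cnj (?X (y + m * e'))"
      let ?k = "eM M (\<psi>1 e * d) * cnj (eM M (\<psi>1 e' * d))"
      have Q: "ubp M ?Q" by (intro ubp_mult ubp_cnj ubp_shift X)
      have "average ?Y (\<lambda>c. average ?Y (\<lambda>y. ?z e c y * cnj (?z e' c y))) = average ?Y (\<lambda>c. average ?Y (\<lambda>y. ?k * (cnj (?Q y) * ?Q (y + c))))"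
        by (intro average_cong) (simp add: mult_ac)
      also have "\<dots> = average ?Y (\<lambda>y. average ?Y (\<lambda>c. ?k * (cnj (?Q y) * ?Q (y + c))))" by (rule average_swap)
      also have "\<dots> = average ?Y (\<lambda>y. ?k * (cnj (?Q y) * average ?Y (\<lambda>c. ?Q (c + y))))"
        by (simp only: average_mult_left add.commute[of _ "_ :: int"])
      also have "\<dots> = ?k * (cnj (average ?Y ?Q) * average ?Y ?Q)"
        by (simp only: ubp_average_shift[OF M Q] average_mult_left average_mult_right average_cnj)
      finally have "norm (average ?Y (\<lambda>c. average ?Y (\<lambda>y. ?z e c y * cnj (?z e' c y)))) = (norm (average ?Y ?Q))\<^sup>2"
        by (simp add: norm_mult power2_eq_square)
      moreover have "average ?Y ?Q = ft M (diff (m * (e' - e)) ?X) 0"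
      proof -
        have "ubp M (diff (m * (e' - e)) ?X)" by (rule ubp_diff[OF X])
        from ubp_average_shift[OF M this, of "m * e"]
        have "average ?Y (\<lambda>y. diff (m * (e' - e)) ?X (y + m * e)) = ft M (diff (m * (e' - e)) ?X) 0" by (simp add: ft_def)
        moreover have "diff (m * (e' - e)) ?X (y + m * e) = ?Q y" for y
        proof -
          have "y + m * e + m * (e' - e) = y + m * e'" by (simp add: algebra_simps)
          then show ?thesis unfolding diff_def[of "m * (e' - e)"] by (simp only:)
        qed
        ultimately show ?thesis by (simp only:)
      qed
      ultimately show ?thesis by simp
    qed
    ultimately show "(norm (?T d))\<^sup>2 \<le> average A (\<lambda>e. average A (\<lambda>e'. (norm (ft M (diff (m * (e' - e)) ?X) 0))\<^sup>2))"
      by (simp only:)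
  qed
  finally show ?thesis .
qed

lemma average_square_ft_diff:
  assumes M: "M > 0" and H: "ubp M H"
  shows "average {0..<M} (\<lambda>c. (norm (ft M (diff c H) g))\<^sup>2) = (\<Sum>j\<in>{0..<M}. (norm (ft M H (j + g)))\<^sup>2 * (norm (ft M H j))\<^sup>2)"
proof -
  let ?Y = "{0..<M}"
  let ?d = "\<lambda>j. ft M H (j + g) * cnj (ft M H j)"
  have "complex_of_real ((norm (ft M (diff c H) g))\<^sup>2) = (\<Sum>j\<in>?Y. \<Sum>j'\<in>?Y. ?d j * cnj (?d j') * eM M ((j' - j) * c))" for c
  proof -
    have "ft M (diff c H) g = (\<Sum>j\<in>?Y. ?d j * eM M (- (j * c)))"
      using ft_difference[OF M H] unfolding diff_def[abs_def] .
    moreover have "eM M (- (j * c)) * cnj (eM M (- (j' * c))) = eM M ((j' - j) * c)" for j j'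
      unfolding eM_diff[symmetric] by (simp add: algebra_simps)
    then have "(?d j * eM M (- (j * c))) * cnj (?d j' * eM M (- (j' * c))) = ?d j * cnj (?d j') * eM M ((j' - j) * c)" for j j'
      by (simp only: mult_cnj_mult)
    ultimately show ?thesis unfolding complex_norm_square by (simp only: cnj_sum sum_product)
  qed
  then have "complex_of_real (average ?Y (\<lambda>c. (norm (ft M (diff c H) g))\<^sup>2))
      = (\<Sum>j\<in>?Y. \<Sum>j'\<in>?Y. ?d j * cnj (?d j') * average ?Y (\<lambda>c. eM M ((j' - j) * c)))"
    by (simp only: average_of_real[symmetric] average_sum average_mult_left)
  also have "\<dots> = (\<Sum>j\<in>?Y. \<Sum>j'\<in>?Y. if j' = j then ?d j * cnj (?d j) else 0)"
  proof (intro sum.cong refl)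
    fix j j' assume "j \<in> ?Y" "j' \<in> ?Y"
    then have "M dvd j' - j \<longleftrightarrow> j' = j" by (simp flip: mod_eq_dvd_iff)
    then show "?d j * cnj (?d j') * average ?Y (\<lambda>c. eM M ((j' - j) * c)) = (if j' = j then ?d j * cnj (?d j) else 0)"
      using average_eM[OF M, of "j' - j"] by simp
  qed
  also have "\<dots> = (\<Sum>j\<in>?Y. ?d j * cnj (?d j))" by simp
  also have "\<dots> = complex_of_real (\<Sum>j\<in>?Y. (norm (ft M H (j + g)))\<^sup>2 * (norm (ft M H j))\<^sup>2)"
    unfolding of_real_sum by (intro sum.cong refl) (simp only: complex_norm_square[symmetric] norm_mult complex_mod_cnj power_mult_distrib)
  finally show ?thesis by (simp only: of_real_eq_iff)
qed

text \<open>In the preceding identity one factor is bounded by the largest coefficient and the other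
  summed by Parseval. For a frequency that does not depend on \<open>c\<close>, first derivatives
  thus control the function itself.\<close>

lemma average_square_ft_diff_le:
  assumes M: "M > 0" and H: "ubp M H"
  shows "average {0..<M} (\<lambda>c. (norm (ft M (diff c H) g))\<^sup>2) \<le> (supft M H)\<^sup>2"
proof -
  have "(\<Sum>j\<in>{0..<M}. (norm (ft M H (j + g)))\<^sup>2 * (norm (ft M H j))\<^sup>2) \<le> (\<Sum>j\<in>{0..<M}. (supft M H)\<^sup>2 * (norm (ft M H j))\<^sup>2)"
    by (intro sum_mono mult_right_mono power_mono ft_le_supft[OF M]) auto
  also have "\<dots> \<le> (supft M H)\<^sup>2 * 1"
    unfolding sum_distrib_left[symmetric] by (intro mult_left_mono parseval_le[OF M H]) auto
  finally show ?thesis unfolding average_square_ft_diff[OF M H] by simp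
qed

text \<open>Rotates a coefficient onto its modulus and cuts off the small ones, so that the norm of
  the weight is the indicator of a large coefficient.\<close>

definition phase_weight :: "real \<Rightarrow> complex \<Rightarrow> complex" where
  "phase_weight \<eta> z = (if \<eta> \<le> norm z then cnj (sgn z) else 0)"

lemma phase_weight:
  assumes "\<eta> > 0"
  shows "norm (phase_weight \<eta> z) \<le> 1" "phase_weight \<eta> z * z = of_real (if \<eta> \<le> norm z then norm z else 0)"
    "norm (phase_weight \<eta> z) = (if \<eta> \<le> norm z then 1 else 0)"
proof -
  have "cnj (sgn z) * z = of_real (norm z)" if "z \<noteq> 0"
    using that by (simp add: sgn_eq complex_norm_square[symmetric] mult.commute[of "cnj z"] power2_eq_square)
  moreover have "z \<noteq> 0" if "\<eta> \<le> norm z" using that assms by auto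
  ultimately show "norm (phase_weight \<eta> z) \<le> 1" "phase_weight \<eta> z * z = of_real (if \<eta> \<le> norm z then norm z else 0)"
    "norm (phase_weight \<eta> z) = (if \<eta> \<le> norm z then 1 else 0)"
    by (auto simp: phase_weight_def norm_sgn)
qed

lemma ubp_double_shift: "ubp M F \<Longrightarrow> ubp M (\<lambda>y. F (y - c - d))"
  using ubp_shift'[of M F "c + d"] by (simp add: diff_diff_add)

text \<open>Let \<open>\<theta> c\<close> be the frequency of the largest coefficient of the
  derivative. The interchange shows that \<open>\<theta> c - \<theta> c'\<close> lies in
  \<open>S0\<close> for many pairs. Fixing a good \<open>c'\<close> confines
  \<open>\<theta> c\<close> to a translate of \<open>S0\<close>, that is to at most
  \<open>Cm\<close> frequencies independent of \<open>c\<close>, and each is bounded by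
  \<open>average_square_ft_diff_le\<close>.\<close>

lemma degree_lowering_one_parameter:
  fixes \<eta> \<eta>' Cm :: real
  assumes M: "M > 0" and \<Phi>: "\<And>u. ubp M (\<Phi> u)" and H: "H = (\<lambda>y. average I (\<lambda>u. \<Phi> u y))"
    and small: "\<And>\<alpha> c c'. \<alpha> \<notin> S0 \<Longrightarrow> norm (average I (\<lambda>u. average {0..<M} (\<lambda>y. \<Phi> u (y - c) * cnj (\<Phi> u (y - c')) * eM M (- (\<alpha> * y))))) \<le> \<eta>'"
    and S0: "\<And>j. j mod M \<in> S0 \<longleftrightarrow> j \<in> S0" "real (card (S0 \<inter> {0..<M})) \<le> Cm"
    and \<eta>: "\<eta> > 0" "\<eta>' \<ge> 0" and big: "2 * \<eta> \<le> average {0..<M} (\<lambda>c. supft M (diff c H))"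
  shows "\<eta>\<^sup>2 * (\<eta>\<^sup>2 - \<eta>') \<le> Cm * (supft M H)\<^sup>2"
proof -
  let ?Y = "{0..<M}"
  have Hu: "ubp M H" unfolding H by (intro ubp_average \<Phi>)
  define \<theta> where "\<theta> c = (SOME j. supft M (diff c H) = norm (ft M (diff c H) j))" for c
  have \<theta>: "supft M (diff c H) = norm (ft M (diff c H) (\<theta> c))" for c
    unfolding \<theta>_def by (rule someI_ex) (use supft_attained[OF M] in blast)
  define f where "f c = ft M (diff c H) (\<theta> c)" for c
  define w where "w c = phase_weight \<eta> (f c)" for c
  have w: "norm (w c) \<le> 1" "w c * f c = of_real (if \<eta> \<le> norm (f c) then norm (f c) else 0)"
    "norm (w c) = (if \<eta> \<le> norm (f c) then 1 else 0)" for c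
    unfolding w_def using phase_weight[OF \<eta>(1)] by blast+
  let ?g = "\<lambda>c. if \<eta> \<le> norm (f c) then norm (f c) else 0"
  have Y: "finite ?Y" "?Y \<noteq> {}" using M by auto
  have "2 * \<eta> \<le> average ?Y (\<lambda>c. ?g c + \<eta>)"
    using big by (rule order_trans) (intro average_mono, use \<eta> in \<open>auto simp: f_def \<theta>\<close>)
  then have g: "\<eta> \<le> average ?Y ?g" by (simp add: average_add average_const[OF Y])
  have fexp: "f c = average ?Y (\<lambda>y. average I (\<lambda>u. \<Phi> u y) * cnj (H (y + c)) * eM M (- (\<theta> c * y)))" for c
    unfolding f_def ft_def diff_def by (simp add: H)
  have "complex_of_real (average ?Y ?g) = average ?Y (\<lambda>c. w c * f c)" unfolding w(2) average_of_real ..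
  then have "norm (average ?Y (\<lambda>c. w c * f c)) = norm (complex_of_real (average ?Y ?g))" by (simp only:)
  then have "average ?Y ?g = norm (average ?Y (\<lambda>c. w c * f c))"
    unfolding norm_of_real using g \<eta>(1) by linarith
  then have "(average ?Y ?g)\<^sup>2 \<le> average ?Y (\<lambda>c. average ?Y (\<lambda>c'. norm (w c) * norm (w c') *
        norm (average I (\<lambda>u. average ?Y (\<lambda>y. \<Phi> u (y - c) * cnj (\<Phi> u (y - c')) * eM M (- ((\<theta> c - \<theta> c') * y)))))))"
    using dual_difference_interchange[OF M \<Phi> ubp_cnj[OF Hu] w(1), where C = ?Y and I = I and \<theta> = \<theta>] unfolding fexp by (simp only:)
  also have "\<dots> \<le> average ?Y (\<lambda>c. average ?Y (\<lambda>c'. \<eta>' + norm (w c) * indicator S0 (\<theta> c - \<theta> c')))"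
  proof (intro average_mono)
    fix c c'
    let ?n = "norm (average I (\<lambda>u. average ?Y (\<lambda>y. \<Phi> u (y - c) * cnj (\<Phi> u (y - c')) * eM M (- ((\<theta> c - \<theta> c') * y)))))"
    show "norm (w c) * norm (w c') * ?n \<le> \<eta>' + norm (w c) * indicator S0 (\<theta> c - \<theta> c')"
    proof (cases "\<theta> c - \<theta> c' \<in> S0")
      case True
      have "?n \<le> 1"
      proof (rule norm_average_le_const)
        show "norm (average ?Y (\<lambda>y. \<Phi> u (y - c) * cnj (\<Phi> u (y - c')) * eM M (- ((\<theta> c - \<theta> c') * y)))) \<le> 1" for u
          using M by (intro ubp_norm_average_le ubp_mult ubp_cnj ubp_shift'[OF \<Phi>] ubp_eM_minus) simp
      qed simp
      then have "norm (w c) * (norm (w c') * ?n) \<le> norm (w c) * 1" using w(1) by (intro mult_left_mono mult_le_one) auto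
      then show ?thesis using True \<eta>(2) by (simp add: mult.assoc)
    next
      case False
      have "norm (w c) * norm (w c') * ?n \<le> 1 * \<eta>'" using w(1) \<eta>(2) by (intro mult_mono mult_le_one small[OF False]) auto
      then show ?thesis using False by simp
    qed
  qed
  also have "\<dots> = average ?Y (\<lambda>c'. \<eta>' + average ?Y (\<lambda>c. norm (w c) * indicator S0 (\<theta> c - \<theta> c')))"
    by (subst average_swap) (simp add: average_add average_const[OF Y])
  finally have "(average ?Y ?g)\<^sup>2 \<le> average ?Y (\<lambda>c'. \<eta>' + average ?Y (\<lambda>c. norm (w c) * indicator S0 (\<theta> c - \<theta> c')))" .
  from average_exists_ge[OF Y(1) this Y(2)]
  obtain c' where c': "(average ?Y ?g)\<^sup>2 \<le> \<eta>' + average ?Y (\<lambda>c. norm (w c) * indicator S0 (\<theta> c - \<theta> c'))"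
    by blast
  have "\<eta>\<^sup>2 \<le> (average ?Y ?g)\<^sup>2" using g \<eta> by (intro power_mono) auto
  then have "\<eta>\<^sup>2 * (\<eta>\<^sup>2 - \<eta>') \<le> \<eta>\<^sup>2 * average ?Y (\<lambda>c. norm (w c) * indicator S0 (\<theta> c - \<theta> c'))"
    using c' by (intro mult_left_mono) auto
  also have "\<dots> = average ?Y (\<lambda>c. \<eta>\<^sup>2 * (norm (w c) * indicator S0 (\<theta> c - \<theta> c')))" by (simp only: average_mult_left)
  also have "\<dots> \<le> average ?Y (\<lambda>c. \<Sum>\<sigma>\<in>S0 \<inter> ?Y. (norm (ft M (diff c H) (\<theta> c' + \<sigma>)))\<^sup>2)"
  proof (intro average_mono)
    fix c
    show "\<eta>\<^sup>2 * (norm (w c) * indicator S0 (\<theta> c - \<theta> c')) \<le> (\<Sum>\<sigma>\<in>S0 \<inter> ?Y. (norm (ft M (diff c H) (\<theta> c' + \<sigma>)))\<^sup>2)"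
    proof (cases "\<theta> c - \<theta> c' \<in> S0 \<and> \<eta> \<le> norm (f c)")
      case True
      let ?\<sigma> = "(\<theta> c - \<theta> c') mod M"
      have "?\<sigma> \<in> S0 \<inter> ?Y" using True S0(1) M by simp
      moreover have "ft M (diff c H) (\<theta> c' + ?\<sigma>) = f c"
        using ft_mod[OF M, of "diff c H" "\<theta> c' + ?\<sigma>"] ft_mod[OF M, of "diff c H" "\<theta> c"] by (simp add: f_def mod_simps)
      ultimately have "(norm (f c))\<^sup>2 \<le> (\<Sum>\<sigma>\<in>S0 \<inter> ?Y. (norm (ft M (diff c H) (\<theta> c' + \<sigma>)))\<^sup>2)"
        using member_le_sum[of ?\<sigma> "S0 \<inter> ?Y" "\<lambda>\<sigma>. (norm (ft M (diff c H) (\<theta> c' + \<sigma>)))\<^sup>2"] by simp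
      moreover have "\<eta>\<^sup>2 \<le> (norm (f c))\<^sup>2" using True \<eta> by (intro power_mono) auto
      ultimately show ?thesis using True w(3)[of c] by simp
    next
      case False
      then have "norm (w c) * indicator S0 (\<theta> c - \<theta> c') = 0" using w(3)[of c] by (auto simp: indicator_def)
      then show ?thesis by (simp only: mult_zero_right) (simp add: sum_nonneg)
    qed
  qed
  also have "\<dots> = (\<Sum>\<sigma>\<in>S0 \<inter> ?Y. average ?Y (\<lambda>c. (norm (ft M (diff c H) (\<theta> c' + \<sigma>)))\<^sup>2))" by (rule average_sum)
  also have "\<dots> \<le> real (card (S0 \<inter> ?Y)) * (supft M H)\<^sup>2"
    by (intro sum_bounded_above average_square_ft_diff_le[OF M Hu])
  also have "\<dots> \<le> Cm * (supft M H)\<^sup>2" by (intro mult_right_mono S0(2)) auto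
  finally show ?thesis .
qed

text \<open>Now the alternating sum of frequencies lies in \<open>S0\<close>. Fixing
  \<open>e'\<close> and \<open>c'\<close> writes \<open>\<theta> e c\<close> as a function of
  \<open>e\<close> plus a function of \<open>c\<close> plus an element of \<open>S0\<close>, which
  is the split form that the hypothesis with \<open>D\<close> controls. The truncation
  \<open>max 0\<close> keeps the fourth power monotone.\<close>

lemma degree_lowering_two_parameters:
  fixes \<eta> \<eta>' Cm D :: real
  assumes M: "M > 0" and \<Phi>: "\<And>u. ubp M (\<Phi> u)" and H: "H = (\<lambda>y. average I (\<lambda>u. \<Phi> u y))"
    and small: "\<And>\<alpha> c1 c2 c3 c4. \<alpha> \<notin> S0 \<Longrightarrow> norm (average I (\<lambda>u. average {0..<M} (\<lambda>y.
        \<Phi> u (y - c1) * cnj (\<Phi> u (y - c2)) * cnj (\<Phi> u (y - c3) * cnj (\<Phi> u (y - c4))) * eM M (- (\<alpha> * y))))) \<le> \<eta>'"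
    and S0: "\<And>j. j mod M \<in> S0 \<longleftrightarrow> j \<in> S0" "real (card (S0 \<inter> {0..<M})) \<le> Cm"
    and \<eta>: "\<eta> > 0" "\<eta>' \<ge> 0" and A: "finite A" "A \<noteq> {}"
    and D: "\<And>\<psi>1 \<psi>2. average A (\<lambda>e. average {0..<M} (\<lambda>c. (norm (ft M (diff c (diff (m * e) H)) (\<psi>1 e + \<psi>2 c)))\<^sup>2)) \<le> D"
  shows "\<eta>\<^sup>2 * ((max 0 (average A (\<lambda>e. average {0..<M} (\<lambda>c. supft M (diff c (diff (m * e) H)))) - \<eta>)) ^ 4 - \<eta>') \<le> Cm * D"
proof -
  let ?Y = "{0..<M}"
  have Hu: "ubp M H" unfolding H by (intro ubp_average \<Phi>)
  let ?W = "\<lambda>e c. diff c (diff (m * e) H)"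
  define \<theta> where "\<theta> e c = (SOME j. supft M (?W e c) = norm (ft M (?W e c) j))" for e c
  have \<theta>: "supft M (?W e c) = norm (ft M (?W e c) (\<theta> e c))" for e c
    unfolding \<theta>_def by (rule someI_ex) (use supft_attained[OF M] in blast)
  define f where "f e c = ft M (?W e c) (\<theta> e c)" for e c
  define w where "w e c = phase_weight \<eta> (f e c)" for e c
  have w: "norm (w e c) \<le> 1" "w e c * f e c = of_real (if \<eta> \<le> norm (f e c) then norm (f e c) else 0)"
    "norm (w e c) = (if \<eta> \<le> norm (f e c) then 1 else 0)" for e c
    unfolding w_def using phase_weight[OF \<eta>(1)] by blast+
  let ?g = "\<lambda>e c. if \<eta> \<le> norm (f e c) then norm (f e c) else 0"
  let ?G = "average A (\<lambda>e. average ?Y (?g e))"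
  have Y: "finite ?Y" "?Y \<noteq> {}" using M by auto
  have G0: "0 \<le> ?G" by (intro average_nonneg) auto
  have "average A (\<lambda>e. average ?Y (\<lambda>c. supft M (?W e c))) \<le> average A (\<lambda>e. average ?Y (\<lambda>c. ?g e c + \<eta>))"
    by (intro average_mono) (use \<eta> in \<open>auto simp: f_def \<theta>\<close>)
  then have g: "max 0 (average A (\<lambda>e. average ?Y (\<lambda>c. supft M (?W e c))) - \<eta>) \<le> ?G"
    using G0 by (simp add: average_add average_const[OF Y] average_const[OF A])
  have fexp: "f e c = average ?Y (\<lambda>y. average I (\<lambda>u. \<Phi> u y) * (cnj (H (y + m * e)) * (cnj (H (y + c)) * H (y + c + m * e))) * eM M (- (\<theta> e c * y)))" for e c
    unfolding f_def ft_def diff_def by (simp add: H mult_ac)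
  have "complex_of_real ?G = average A (\<lambda>e. average ?Y (\<lambda>c. w e c * f e c))" unfolding w(2) average_of_real ..
  then have "norm (average A (\<lambda>e. average ?Y (\<lambda>c. w e c * f e c))) = norm (complex_of_real ?G)" by (simp only:)
  then have Geq: "?G = norm (average A (\<lambda>e. average ?Y (\<lambda>c. w e c * f e c)))"
    unfolding norm_of_real using G0 by linarith
  have Geq': "?G = norm (average A (\<lambda>e. average ?Y (\<lambda>c. w e c * average ?Y (\<lambda>y.
      average I (\<lambda>u. \<Phi> u y) * (cnj (H (y + m * e)) * (cnj (H (y + c)) * H (y + c + m * e))) * eM M (- (\<theta> e c * y))))))"
    using Geq by (simp only: fexp[symmetric])
  let ?\<alpha> = "\<lambda>e e' c c'. \<theta> e c - \<theta> e' c - (\<theta> e c' - \<theta> e' c')"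
  let ?n = "\<lambda>e e' c c'. norm (average I (\<lambda>u. average ?Y (\<lambda>y.
          \<Phi> u (y - c - m * e) * cnj (\<Phi> u (y - c - m * e')) * cnj (\<Phi> u (y - c' - m * e) * cnj (\<Phi> u (y - c' - m * e'))) *
          eM M (- (?\<alpha> e e' c c' * y)))))"
  have "?G ^ 4 \<le> average A (\<lambda>e. average A (\<lambda>e'. average ?Y (\<lambda>c. average ?Y (\<lambda>c'.
        norm (w e c) * norm (w e' c) * (norm (w e c') * norm (w e' c')) * ?n e e' c c'))))"
    unfolding Geq' by (rule dual_difference_interchange_twice[OF M \<Phi> ubp_cnj[OF Hu] ubp_cnj[OF Hu] Hu w(1)])
  also have "\<dots> \<le> average A (\<lambda>e. average A (\<lambda>e'. average ?Y (\<lambda>c. average ?Y (\<lambda>c'. \<eta>' + norm (w e c) * indicator S0 (?\<alpha> e e' c c')))))"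
  proof (intro average_mono)
    fix e e' c c'
    have ww: "norm (w e' c) * (norm (w e c') * norm (w e' c')) \<le> 1" using w(1) by (intro mult_le_one mult_nonneg_nonneg) auto
    show "norm (w e c) * norm (w e' c) * (norm (w e c') * norm (w e' c')) * ?n e e' c c' \<le> \<eta>' + norm (w e c) * indicator S0 (?\<alpha> e e' c c')"
    proof (cases "?\<alpha> e e' c c' \<in> S0")
      case True
      have "?n e e' c c' \<le> 1"
      proof (rule norm_average_le_const)
        show "norm (average ?Y (\<lambda>y.
          \<Phi> u (y - c - m * e) * cnj (\<Phi> u (y - c - m * e')) * cnj (\<Phi> u (y - c' - m * e) * cnj (\<Phi> u (y - c' - m * e'))) *
          eM M (- (?\<alpha> e e' c c' * y)))) \<le> 1" for u
          using M by (intro ubp_norm_average_le ubp_mult ubp_cnj ubp_double_shift[OF \<Phi>] ubp_eM_minus) simp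
      qed simp
      then have "norm (w e c) * ((norm (w e' c) * (norm (w e c') * norm (w e' c'))) * ?n e e' c c') \<le> norm (w e c) * 1"
        by (intro mult_left_mono mult_le_one[OF ww]) auto
      then show ?thesis using True \<eta>(2) by (simp add: mult.assoc)
    next
      case False
      have n: "?n e e' c c' \<le> \<eta>'"
        using small[OF False, of "c + m * e" "c + m * e'" "c' + m * e" "c' + m * e'"] by (simp add: diff_diff_add)
      have "norm (w e c) * (norm (w e' c) * (norm (w e c') * norm (w e' c'))) * ?n e e' c c' \<le> 1 * \<eta>'"
        using w(1) ww \<eta>(2) by (intro mult_mono[OF _ n] mult_le_one) auto
      then show ?thesis using False by (simp add: mult.assoc)
    qed
  qed
  also have "\<dots> = average A (\<lambda>e'. average ?Y (\<lambda>c'. \<eta>' + average A (\<lambda>e. average ?Y (\<lambda>c. norm (w e c) * indicator S0 (?\<alpha> e e' c c')))))"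
  proof -
    let ?h = "\<lambda>e e' c c'. \<eta>' + norm (w e c) * indicator S0 (?\<alpha> e e' c c')"
    have "average A (\<lambda>e. average A (\<lambda>e'. average ?Y (\<lambda>c. average ?Y (\<lambda>c'. ?h e e' c c'))))
        = average A (\<lambda>e'. average A (\<lambda>e. average ?Y (\<lambda>c. average ?Y (\<lambda>c'. ?h e e' c c'))))" by (rule average_swap)
    also have "\<dots> = average A (\<lambda>e'. average A (\<lambda>e. average ?Y (\<lambda>c'. average ?Y (\<lambda>c. ?h e e' c c'))))"
      by (rule average_cong, rule average_cong, rule average_swap)
    also have "\<dots> = average A (\<lambda>e'. average ?Y (\<lambda>c'. average A (\<lambda>e. average ?Y (\<lambda>c. ?h e e' c c'))))"
      by (rule average_cong, rule average_swap)
    finally show ?thesis by (simp only: average_add average_const[OF Y] average_const[OF A])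
  qed
  finally have "?G ^ 4 \<le> average A (\<lambda>e'. average ?Y (\<lambda>c'. \<eta>' + average A (\<lambda>e. average ?Y (\<lambda>c. norm (w e c) * indicator S0 (?\<alpha> e e' c c')))))" .
  from average_exists_ge[OF A(1) this A(2)]
  obtain e' where e': "?G ^ 4 \<le> average ?Y (\<lambda>c'. \<eta>' + average A (\<lambda>e. average ?Y (\<lambda>c. norm (w e c) * indicator S0 (?\<alpha> e e' c c'))))"
    by blast
  from average_exists_ge[OF Y(1) e' Y(2)] obtain c' where c': "?G ^ 4 \<le> \<eta>' + average A (\<lambda>e. average ?Y (\<lambda>c. norm (w e c) * indicator S0 (?\<alpha> e e' c c')))"
    by blast
  have "(max 0 (average A (\<lambda>e. average ?Y (\<lambda>c. supft M (?W e c))) - \<eta>)) ^ 4 \<le> ?G ^ 4" using g by (intro power_mono) auto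
  then have "\<eta>\<^sup>2 * ((max 0 (average A (\<lambda>e. average ?Y (\<lambda>c. supft M (?W e c))) - \<eta>)) ^ 4 - \<eta>')
      \<le> \<eta>\<^sup>2 * average A (\<lambda>e. average ?Y (\<lambda>c. norm (w e c) * indicator S0 (?\<alpha> e e' c c')))"
    using c' by (intro mult_left_mono) auto
  also have "\<dots> = average A (\<lambda>e. average ?Y (\<lambda>c. \<eta>\<^sup>2 * (norm (w e c) * indicator S0 (?\<alpha> e e' c c'))))" by (simp only: average_mult_left)
  also have "\<dots> \<le> average A (\<lambda>e. average ?Y (\<lambda>c. \<Sum>\<sigma>\<in>S0 \<inter> ?Y. (norm (ft M (?W e c) ((\<theta> e c' - \<theta> e' c' + \<sigma>) + \<theta> e' c)))\<^sup>2))"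
  proof (intro average_mono)
    fix e c
    show "\<eta>\<^sup>2 * (norm (w e c) * indicator S0 (?\<alpha> e e' c c')) \<le> (\<Sum>\<sigma>\<in>S0 \<inter> ?Y. (norm (ft M (?W e c) ((\<theta> e c' - \<theta> e' c' + \<sigma>) + \<theta> e' c)))\<^sup>2)"
    proof (cases "?\<alpha> e e' c c' \<in> S0 \<and> \<eta> \<le> norm (f e c)")
      case True
      let ?\<sigma> = "?\<alpha> e e' c c' mod M"
      have "?\<sigma> \<in> S0 \<inter> ?Y" using True S0(1) M by simp
      moreover have "ft M (?W e c) ((\<theta> e c' - \<theta> e' c' + ?\<sigma>) + \<theta> e' c) = f e c"
      proof -
        have "((\<theta> e c' - \<theta> e' c' + ?\<sigma>) + \<theta> e' c) mod M = \<theta> e c mod M"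
        proof -
          have "(a + t mod M + b) mod M = (a + t + b) mod M" for a t b by (metis mod_add_left_eq mod_add_right_eq)
          from this[of "\<theta> e c' - \<theta> e' c'" "?\<alpha> e e' c c'" "\<theta> e' c"] show ?thesis by simp
        qed
        then show ?thesis unfolding f_def using ft_mod[OF M, of "?W e c" "(\<theta> e c' - \<theta> e' c' + ?\<sigma>) + \<theta> e' c"] ft_mod[OF M, of "?W e c" "\<theta> e c"]
          by (simp only:)
      qed
      ultimately have "(norm (f e c))\<^sup>2 \<le> (\<Sum>\<sigma>\<in>S0 \<inter> ?Y. (norm (ft M (?W e c) ((\<theta> e c' - \<theta> e' c' + \<sigma>) + \<theta> e' c)))\<^sup>2)"
        using member_le_sum[of ?\<sigma> "S0 \<inter> ?Y" "\<lambda>\<sigma>. (norm (ft M (?W e c) ((\<theta> e c' - \<theta> e' c' + \<sigma>) + \<theta> e' c)))\<^sup>2"] by simp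
      moreover have "\<eta>\<^sup>2 \<le> (norm (f e c))\<^sup>2" using True \<eta> by (intro power_mono) auto
      ultimately show ?thesis using True w(3)[of e c] by simp
    next
      case False
      then have "norm (w e c) * indicator S0 (?\<alpha> e e' c c') = 0" using w(3)[of e c] by (auto simp: indicator_def)
      then show ?thesis by (simp only: mult_zero_right) (simp add: sum_nonneg)
    qed
  qed
  also have "\<dots> = (\<Sum>\<sigma>\<in>S0 \<inter> ?Y. average A (\<lambda>e. average ?Y (\<lambda>c. (norm (ft M (?W e c) ((\<theta> e c' - \<theta> e' c' + \<sigma>) + \<theta> e' c)))\<^sup>2)))"
    by (simp only: average_sum)
  also have "\<dots> \<le> real (card (S0 \<inter> ?Y)) * D"
    by (rule sum_bounded_above) (rule D)
  also have "\<dots> \<le> Cm * D"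
  proof (rule mult_right_mono[OF S0(2)])
    show "0 \<le> D" by (rule order_trans[OF _ D[of "\<lambda>_. 0" "\<lambda>_. 0"]]) (intro average_nonneg, simp)
  qed
  finally show ?thesis .
qed

section \<open>Dual functions of the quadratic configuration\<close>

definition dual :: "nat \<Rightarrow> int \<Rightarrow> int \<Rightarrow> int \<Rightarrow> (int \<Rightarrow> complex) \<Rightarrow> (int \<Rightarrow> complex) \<Rightarrow> int \<Rightarrow> complex" where
  "dual N a b h F F' y = (\<Sum>u\<in>{a..<b}. F (y + u\<^sup>2) * F' (y + (u + h)\<^sup>2)) / of_nat N"

text \<open>Extension by zero beyond the actual range of \<open>u\<close>, so that
  \<open>dual\<close> becomes an average of unit-bounded functions over a full window of length
  \<open>N\<close>.\<close>

definition dual_term :: "int \<Rightarrow> int \<Rightarrow> int \<Rightarrow> (int \<Rightarrow> complex) \<Rightarrow> (int \<Rightarrow> complex) \<Rightarrow> int \<Rightarrow> int \<Rightarrow> complex" where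
  "dual_term a b h F F' u y = (if u \<in> {a..<b} then F (y + u\<^sup>2) * F' (y + (u + h)\<^sup>2) else 0)"

lemma ubp_dual_term: "ubp M F \<Longrightarrow> ubp M F' \<Longrightarrow> ubp M (dual_term a b h F F' u)"
proof -
  assume "ubp M F" "ubp M F'"
  then have "ubp M (\<lambda>y. F (y + u\<^sup>2) * F' (y + (u + h)\<^sup>2))" by (intro ubp_mult ubp_shift)
  then show ?thesis by (auto simp: dual_term_def[abs_def] ubp_def)
qed

lemma dual_average:
  assumes "b - a \<le> int N"
  shows "dual N a b h F F' = (\<lambda>y. average {a..<a + int N} (\<lambda>u. dual_term a b h F F' u y))"
proof
  fix y
  have "(\<Sum>u\<in>{a..<b}. F (y + u\<^sup>2) * F' (y + (u + h)\<^sup>2)) = (\<Sum>u\<in>{a..<a + int N}. dual_term a b h F F' u y)"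
    using assms by (intro sum.mono_neutral_cong_left) (auto simp: dual_term_def)
  then show "dual N a b h F F' y = average {a..<a + int N} (\<lambda>u. dual_term a b h F F' u y)"
    by (simp add: dual_def average_complex)
qed

lemma ubp_dual: "b - a \<le> int N \<Longrightarrow> ubp M F \<Longrightarrow> ubp M F' \<Longrightarrow> ubp M (dual N a b h F F')"
  unfolding dual_average by (intro ubp_average ubp_dual_term)

lemma norm_average_dual_term:
  assumes "b - a \<le> int N" "N > 0"
    and "\<And>u. u \<in> {a..<b} \<Longrightarrow> g u = average {0..<M} (\<lambda>y. F (y + u\<^sup>2) * F' (y + (u + h)\<^sup>2) * eM M (- (\<alpha> * y)))"
    and "\<And>u. u \<notin> {a..<b} \<Longrightarrow> g u = 0"
    and "norm (\<Sum>u\<in>{a..<b}. average {0..<M} (\<lambda>y. F (y + u\<^sup>2) * F' (y + (u + h)\<^sup>2) * eM M (- (\<alpha> * y)))) \<le> real N / K"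
  shows "norm (average {a..<a + int N} g) \<le> 1 / K"
proof -
  have "sum g {a..<a + int N} = (\<Sum>u\<in>{a..<b}. average {0..<M} (\<lambda>y. F (y + u\<^sup>2) * F' (y + (u + h)\<^sup>2) * eM M (- (\<alpha> * y))))"
    using assms(1,3,4) by (intro sum.mono_neutral_cong_right) auto
  then have "norm (average {a..<a + int N} g) \<le> (real N / K) / real N"
    using assms(2,5) by (simp only: average_complex norm_divide norm_of_nat card_atLeastLessThan_int add_diff_cancel_left' nat_int) (rule divide_right_mono; simp)
  then show ?thesis using assms(2) by simp
qed

text \<open>A product of translates of a dual term, some conjugated, is the dual term of the
  corresponding products of \<open>F\<close> and of \<open>F'\<close>; so both claims are instances
  of \<open>minor_correlation_small\<close>.\<close>

lemma dual_minor:
  fixes K :: real and N :: nat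
  assumes K: "K \<ge> 2" and N: "K ^ 31 \<le> real N" and M: "M = 2 * (int N)\<^sup>2"
    and F: "ubp M F" "ubp M F'" and J: "b - a \<le> int N" "\<And>u. u \<in> {a..<b} \<Longrightarrow> \<bar>u\<bar> \<le> 4 * int N"
    and minor: "\<alpha> \<notin> major N (K ^ 31)"
  shows "norm (average {a..<a + int N} (\<lambda>u. average {0..<M} (\<lambda>y.
      dual_term a b h F F' u (y - c) * cnj (dual_term a b h F F' u (y - c')) * eM M (- (\<alpha> * y))))) \<le> 1 / K" (is ?one)
    and "norm (average {a..<a + int N} (\<lambda>u. average {0..<M} (\<lambda>y.
      dual_term a b h F F' u (y - c1) * cnj (dual_term a b h F F' u (y - c2)) *
      cnj (dual_term a b h F F' u (y - c3) * cnj (dual_term a b h F F' u (y - c4))) * eM M (- (\<alpha> * y))))) \<le> 1 / K" (is ?two)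
proof -
  have "(1::real) \<le> K ^ 31" using K by (simp add: one_le_power)
  then have N0: "N > 0" using N by (cases N) auto
  have ub1: "ubp M (\<lambda>y. f (y - c) * cnj (f (y - c')))" if "ubp M f" for f c c'
    using that by (intro ubp_mult ubp_cnj ubp_shift')
  show ?one
    by (rule norm_average_dual_term[OF J(1) N0 _ _ minor_correlation_small[OF K N M ub1[OF F(1)] ub1[OF F(2)] J minor]])
      (auto simp: dual_term_def average_def algebra_simps intro!: sum.cong)
  have ub2: "ubp M (\<lambda>y. f (y - c1) * cnj (f (y - c2)) * cnj (f (y - c3) * cnj (f (y - c4))))" if "ubp M f" for f
    using that by (intro ubp_mult ubp_cnj ubp_shift')
  show ?two
    by (rule norm_average_dual_term[OF J(1) N0 _ _ minor_correlation_small[OF K N M ub2[OF F(1)] ub2[OF F(2)] J minor]])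
      (auto simp: dual_term_def average_def algebra_simps intro!: sum.cong)
qed

lemma dual_lowering_one_parameter:
  fixes w :: real and N :: nat
  assumes w: "w \<ge> 2" and N: "w ^ 93 \<le> real N" and M: "M = 2 * (int N)\<^sup>2"
    and F: "ubp M F" "ubp M F'" and J: "b - a \<le> int N" "\<And>u. u \<in> {a..<b} \<Longrightarrow> \<bar>u\<bar> \<le> 4 * int N"
    and H: "H = dual N a b h F F'" and big: "2 / w \<le> average {0..<M} (\<lambda>c. supft M (diff c H))"
  shows "1 / w ^ 656 \<le> supft M H"
proof -
  have w0: "w > 0" "w \<ge> 1" using w by auto
  have "(1::real) \<le> w ^ 93" using w by (simp add: one_le_power)
  then have N0: "N > 0" using N by (cases N) auto
  then have M0: "M > 0" by (simp add: M)
  let ?K = "w ^ 3"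
  have K: "?K \<ge> 2" using w power_increasing[of 1 3 w] by simp
  have N': "?K ^ 31 \<le> real N" using N by (simp flip: power_mult)
  have S: "j mod M \<in> major N (?K ^ 31) \<longleftrightarrow> j \<in> major N (?K ^ 31)" for j unfolding M by (rule major_mod[OF N0])
  have K31: "?K ^ 31 \<ge> 2" using w power_increasing[of 1 93 w] by (simp flip: power_mult)
  have C: "real (card (major N (?K ^ 31) \<inter> {0..<M})) \<le> w ^ 651"
    using card_major[OF K31 N0] unfolding M by (simp flip: power_mult)
  \<comment> \<open>Threshold \<open>\<eta> = 1 / w\<close> against minor arc error
    \<open>w ^ -3\<close>. The number of major frequencies is at most \<open>w ^ 651\<close>, since
    \<open>651 = 3 * 31 * 7\<close>; the left-hand side costs five more powers.\<close>
  have "(1 / w)\<^sup>2 * ((1 / w)\<^sup>2 - 1 / ?K) \<le> w ^ 651 * (supft M H)\<^sup>2"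
  proof (rule degree_lowering_one_parameter[OF M0 _ _ _ S C])
    show "H = (\<lambda>y. average {a..<a + int N} (\<lambda>u. dual_term a b h F F' u y))" unfolding H by (rule dual_average[OF J(1)])
    show "2 * (1 / w) \<le> average {0..<M} (\<lambda>c. supft M (diff c H))" using big by simp
  qed (use w0 ubp_dual_term[OF F] dual_minor(1)[OF K N' M F J] in auto)
  moreover have "1 / w ^ 5 \<le> (1 / w)\<^sup>2 * ((1 / w)\<^sup>2 - 1 / ?K)"
  proof -
    have "1 / w ^ 5 = (1 / w)\<^sup>2 * (1 / ?K)" using w0 by (simp add: power_divide flip: power_add)
    also have "\<dots> \<le> (1 / w)\<^sup>2 * ((1 / w)\<^sup>2 - 1 / ?K)"
    proof (rule mult_left_mono)
      have "2 / ?K \<le> w / ?K" using w by (intro divide_right_mono) auto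
      also have "\<dots> = (1 / w)\<^sup>2" using w0 by (simp add: power2_eq_square power3_eq_cube)
      finally show "1 / ?K \<le> (1 / w)\<^sup>2 - 1 / ?K" by simp
    qed simp
    finally show ?thesis .
  qed
  ultimately have "1 / w ^ 5 \<le> w ^ 651 * (supft M H)\<^sup>2" by linarith
  also have "\<dots> \<le> w ^ 651 * supft M H"
    using supft_nonneg[OF M0, of H] supft_le_1[OF M0 ubp_dual[OF J(1) F]] w0 unfolding H
    by (intro mult_left_mono) (auto simp: power2_eq_square mult_left_le)
  finally have "1 \<le> w ^ 5 * (w ^ 651 * supft M H)" using w0 by (simp add: field_simps)
  also have "\<dots> = w ^ 656 * supft M H" by (simp flip: power_add mult.assoc)
  finally show ?thesis using w0 by (simp add: field_simps)
qed

text \<open>For each \<open>v\<close> the degree-lowering lemma reduces the second derivatives to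
  the quantity of \<open>box_bound\<close>; averaged over \<open>v\<close>, the steps
  \<open>2 * v * (e' - e)\<close> are distributed well enough for
  \<open>difference_coefficients\<close> to return to first derivatives.\<close>

lemma dual_lowering_two_parameters:
  fixes z :: real and N P :: nat
  assumes z: "z \<ge> 2" and N: "z ^ 31440 \<le> real N" and P: "real N / z \<le> real P" "P \<le> N" and M: "M = 2 * (int N)\<^sup>2"
    and F: "ubp M F" "ubp M F'" and J: "b - a \<le> int N" "\<And>u. u \<in> {a..<b} \<Longrightarrow> \<bar>u\<bar> \<le> 4 * int N"
    and A: "A = {- int P..<int P}" and V: "V = {- (2 * int P)..<2 * int P}"
    and H: "H = dual N a b h F F'"
    and big: "2 / z \<le> average V (\<lambda>v. average A (\<lambda>e. average {0..<M} (\<lambda>c. supft M (diff c (diff (2 * v * e) H)))))"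
  shows "1 / z ^ 222700 \<le> average {0..<M} (\<lambda>c. supft M (diff c H))"
proof -
  have z0: "z > 0" "z \<ge> 1" using z by auto
  have "(1::real) \<le> z ^ 31440" using z by (simp add: one_le_power)
  then have N0: "N > 0" using N by (cases N) auto
  then have M0: "M > 0" by (simp add: M)
  have "0 < real N / z" using N0 z0 by simp
  then have P0: "P > 0" using P by (cases P) auto
  have AV: "finite A" "A \<noteq> {}" "finite V" "V \<noteq> {}" using P0 by (auto simp: A V)
  have Hu: "ubp M H" unfolding H by (rule ubp_dual[OF J(1) F])
  let ?Y = "{0..<M}"
  let ?K = "z ^ 6"
  \<comment> \<open>Four powers above \<open>z ^ 8 * z ^ 2608\<close>, the loss incurred by the time
    this parameter enters.\<close>
  let ?K2 = "z ^ 2620"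
  have K: "?K \<ge> 2" "?K2 \<ge> 2" using z power_increasing[of 1 6 z] power_increasing[of 1 2620 z] by simp_all
  have N': "?K ^ 31 \<le> real N" "?K2 ^ 12 \<le> real N"
    unfolding power_mult[symmetric] using N z0 by (auto intro: order_trans[OF power_increasing N])
  have S: "j mod M \<in> major N (?K ^ 31) \<longleftrightarrow> j \<in> major N (?K ^ 31)" for j unfolding M by (rule major_mod[OF N0])
  have K31: "?K ^ 31 \<ge> 2" using z power_increasing[of 1 186 z] by (simp flip: power_mult)
  have C: "real (card (major N (?K ^ 31) \<inter> {0..<M})) \<le> z ^ 1302"
    using card_major[OF K31 N0] unfolding M by (simp flip: power_mult)
  let ?a = "\<lambda>v. average A (\<lambda>e. average ?Y (\<lambda>c. supft M (diff c (diff (2 * v * e) H))))"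
  let ?D = "\<lambda>v. average ?Y (\<lambda>d. average A (\<lambda>e. average A (\<lambda>e'. (norm (ft M (diff (2 * v * (e' - e)) (diff d H)) 0))\<^sup>2)))"
  let ?m = "\<lambda>v. max 0 (?a v - 1 / z)"
  have D0: "0 \<le> ?D v" for v by (intro average_nonneg) auto
  have one: "(?m v) ^ 4 \<le> 1 / ?K + z ^ 1304 * sqrt (?D v)" for v
  proof -
    have "(1 / z)\<^sup>2 * ((?m v) ^ 4 - 1 / ?K) \<le> z ^ 1302 * sqrt (?D v)"
    proof (rule degree_lowering_two_parameters[OF M0 _ _ _ S C])
      show "H = (\<lambda>y. average {a..<a + int N} (\<lambda>u. dual_term a b h F F' u y))" unfolding H by (rule dual_average[OF J(1)])
      show "average A (\<lambda>e. average ?Y (\<lambda>c. (norm (ft M (diff c (diff (2 * v * e) H)) (\<psi>1 e + \<psi>2 c)))\<^sup>2)) \<le> sqrt (?D v)" for \<psi>1 \<psi>2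
        by (rule real_le_rsqrt) (rule box_bound[OF M0 Hu])
      show "norm (average {a..<a + int N} (\<lambda>u. average ?Y (\<lambda>y.
          dual_term a b h F F' u (y - c1) * cnj (dual_term a b h F F' u (y - c2)) *
          cnj (dual_term a b h F F' u (y - c3) * cnj (dual_term a b h F F' u (y - c4))) * eM M (- (\<alpha> * y))))) \<le> 1 / ?K"
        if "\<alpha> \<notin> major N (?K ^ 31)" for \<alpha> c1 c2 c3 c4
        by (rule dual_minor(2)[OF K(1) N'(1) M F J that])
      show "0 < 1 / z" "0 \<le> 1 / ?K" using z0 by auto
      show "ubp M (dual_term a b h F F' u)" for u by (rule ubp_dual_term[OF F])
      show "finite A" "A \<noteq> {}" by (rule AV)+
    qed
    then have "(?m v) ^ 4 - 1 / ?K \<le> z\<^sup>2 * (z ^ 1302 * sqrt (?D v))" using z0 by (simp add: power_divide field_simps)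
    also have "z\<^sup>2 * (z ^ 1302 * sqrt (?D v)) = z ^ 1304 * sqrt (?D v)" by (simp flip: power_add mult.assoc)
    finally show ?thesis by linarith
  qed
  \<comment> \<open>Squaring removes the root that came from \<open>box_bound\<close>, so that the
    bound is linear in \<open>?D v\<close> and can be averaged over \<open>v\<close>.\<close>
  have two: "(?m v) ^ 8 \<le> 2 * (1 / ?K)\<^sup>2 + 2 * z ^ 2608 * ?D v" for v
  proof -
    have "(?m v) ^ 8 = ((?m v) ^ 4)\<^sup>2" by (simp flip: power_mult)
    also have "\<dots> \<le> (1 / ?K + z ^ 1304 * sqrt (?D v))\<^sup>2" by (rule power_mono[OF one]) simp
    also have "\<dots> \<le> 2 * (1 / ?K)\<^sup>2 + 2 * (z ^ 1304 * sqrt (?D v))\<^sup>2"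
      using sum_squares_bound[of "1 / ?K" "z ^ 1304 * sqrt (?D v)"] unfolding power2_sum by linarith
    also have "(z ^ 1304 * sqrt (?D v))\<^sup>2 = z ^ 2608 * ?D v" using D0[of v] by (simp add: power_mult_distrib flip: power_mult)
    finally show ?thesis by (simp only: mult.assoc)
  qed
  have Dav: "average V ?D \<le> 1 / ?K2 + ?K2 ^ 84 * average ?Y (\<lambda>c. supft M (diff c H))"
  proof -
    have "average V ?D = average ?Y (\<lambda>d. average V (\<lambda>v. average A (\<lambda>e. average A (\<lambda>e'. (norm (ft M (diff (2 * v * (e' - e)) (diff d H)) 0))\<^sup>2))))"
      by (rule average_swap)
    \<comment> \<open>Exchanging the two averages over \<open>A\<close> matches the orientation
      \<open>t - t'\<close> in \<open>difference_coefficients\<close>.\<close>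
    also have "\<dots> = average ?Y (\<lambda>d. average V (\<lambda>v. average A (\<lambda>e'. average A (\<lambda>e. (norm (ft M (diff (2 * v * (e' - e)) (diff d H)) 0))\<^sup>2))))"
      by (rule average_cong, rule average_cong, rule average_swap)
    also have "\<dots> \<le> average ?Y (\<lambda>d. 1 / ?K2 + ?K2 ^ 84 * supft M (diff d H))"
    proof (rule average_mono)
      fix d
      have "real N / ?K2 \<le> real N / z" using z0 power_increasing[of 1 2620 z] by (intro divide_left_mono) auto
      then have sz: "real N / ?K2 \<le> of_int (4 * int P)" "real N / ?K2 \<le> of_int (2 * int P)" using P by simp_all
      have V': "V = {- (2 * int P)..<- (2 * int P) + 4 * int P}" and A': "A = {- int P..<- int P + 2 * int P}" unfolding V A by auto
      show "average V (\<lambda>v. average A (\<lambda>e'. average A (\<lambda>e. (norm (ft M (diff (2 * v * (e' - e)) (diff d H)) 0))\<^sup>2))) \<le> 1 / ?K2 + ?K2 ^ 84 * supft M (diff d H)"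
        using difference_coefficients[OF K(2) N'(2) sz M ubp_diff[OF Hu] ft_le_supft[OF M0], of "- (2 * int P)" "- int P" d 0]
        unfolding V' A' diff_def[of "2 * _ * _"] by (simp only: diff_def[abs_def])
    qed
    also have "\<dots> = 1 / ?K2 + ?K2 ^ 84 * average ?Y (\<lambda>c. supft M (diff c H))"
      using M0 by (simp only: average_add average_mult_left) (simp add: average_const)
    finally show ?thesis .
  qed
  let ?E = "average ?Y (\<lambda>c. supft M (diff c H))"
  have E0: "?E \<ge> 0" by (intro average_nonneg supft_nonneg M0)
  have "2 / z \<le> average V (\<lambda>v. ?m v + 1 / z)"
    using big by (rule order_trans) (intro average_mono, simp)
  then have "1 / z \<le> average V ?m" by (simp add: average_add average_const[OF AV(3,4)])
  then have "(1 / z) ^ 8 \<le> (average V ?m) ^ 8" using z0 by (intro power_mono) auto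
  also have "\<dots> \<le> average V (\<lambda>v. (?m v) ^ 8)" by (rule average_power8_le)
  also have "\<dots> \<le> average V (\<lambda>v. 2 * (1 / ?K)\<^sup>2 + 2 * z ^ 2608 * ?D v)" by (intro average_mono two)
  also have "\<dots> = 2 * (1 / ?K)\<^sup>2 + 2 * z ^ 2608 * average V ?D"
    by (simp only: average_add average_mult_left average_const[OF AV(3,4)])
  also have "\<dots> \<le> 2 * (1 / ?K)\<^sup>2 + 2 * z ^ 2608 * (1 / ?K2 + ?K2 ^ 84 * ?E)"
    using z0 by (intro add_left_mono mult_left_mono Dav) auto
  finally have main: "(1 / z) ^ 8 \<le> 2 * (1 / ?K)\<^sup>2 + 2 * z ^ 2608 * (1 / ?K2 + ?K2 ^ 84 * ?E)" .
  have "8 * z ^ 8 \<le> z ^ 12" "8 * z ^ 2616 \<le> z ^ 2620" by (rule absorb_const[OF z, of _ 3]; simp)+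
  then have t: "2 * (1 / ?K)\<^sup>2 \<le> 1 / (4 * z ^ 8)" "2 * z ^ 2608 * (1 / ?K2) \<le> 1 / (4 * z ^ 8)"
  proof -
    assume a: "8 * z ^ 8 \<le> z ^ 12" "8 * z ^ 2616 \<le> z ^ 2620"
    have "(1 / ?K)\<^sup>2 = 1 / z ^ 12" by (simp add: power_divide flip: power_mult)
    then show "2 * (1 / ?K)\<^sup>2 \<le> 1 / (4 * z ^ 8)" using a(1) z0 by (simp add: field_simps)
    have "z ^ 2616 = z ^ 2608 * z ^ 8" by (simp flip: power_add)
    then show "2 * z ^ 2608 * (1 / ?K2) \<le> 1 / (4 * z ^ 8)" using a(2) z0 by (simp add: field_simps)
  qed
  have "1 / z ^ 8 \<le> 1 / (4 * z ^ 8) + (1 / (4 * z ^ 8) + 2 * z ^ 2608 * (?K2 ^ 84 * ?E))"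
    using main t unfolding distrib_left[of "2 * z ^ 2608"] by (simp only: power_divide power_one)
  moreover have "1 / (4 * z ^ 8) = (1 / z ^ 8) / 4" by simp
  moreover have "a / 2 \<le> X" if "a \<le> b + (b + X)" "b = a / 4" for a b X :: real using that by linarith
  ultimately have "(1 / z ^ 8) / 2 \<le> 2 * z ^ 2608 * (?K2 ^ 84 * ?E)" by blast
  then have "1 \<le> 4 * (z ^ 8 * z ^ 2608 * ?K2 ^ 84) * ?E" using z0 by (simp add: field_simps)
  also have "z ^ 8 * z ^ 2608 * ?K2 ^ 84 = z ^ 222696" by (simp flip: power_mult power_add)
  also have "4 * z ^ 222696 * ?E \<le> z ^ 222700 * ?E" by (intro mult_right_mono absorb_const[OF z, of _ 2] E0) auto
  finally show ?thesis using z0 by (simp add: field_simps)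
qed

text \<open>The three factors are the losses of concatenation and of the two degree-lowering steps.\<close>

definition dual_exponent :: nat where
  "dual_exponent = 58400001 * 222701 * 656"

text \<open>The squared norm of \<open>H\<close> is the correlation of \<open>H\<close> with its own
  defining configuration, an average over \<open>u\<close>. Averaging over short shifts of
  \<open>u\<close> supplies the variables for the Cauchy--Schwarz steps; then the losses of
  concatenation and of the two lowering steps compose.\<close>

lemma dual_large_coefficient:
  fixes K :: real and N :: nat
  assumes K: "K \<ge> 2" and N: "K ^ dual_exponent \<le> real N" and M: "M = 2 * (int N)\<^sup>2"
    and F: "ubp M F" "ubp M F'" and J: "b - a \<le> int N" "\<And>u. u \<in> {a..<b} \<Longrightarrow> \<bar>u\<bar> \<le> 4 * int N"
    and H: "H = dual N a b h F F'" and big: "1 / K \<le> average {0..<M} (\<lambda>y. (norm (H y))\<^sup>2)"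
  shows "1 / K ^ dual_exponent \<le> supft M H"
proof -
  have K0: "K > 0" "K \<ge> 1" using K by auto
  have NK: "K ^ n \<le> real N" if "n \<le> dual_exponent" for n
    by (rule order_trans[OF power_increasing[OF that K0(2)] N])
  have "K ^ 0 \<le> real N" by (rule NK) simp
  then have N0: "N > 0" "real N > 0" by (cases N; simp)+
  then have M0: "M > 0" by (simp add: M)
  have Hu: "ubp M H" unfolding H by (rule ubp_dual[OF J(1) F])
  let ?Y = "{0..<M}"
  define \<phi> where "\<phi> u = average ?Y (\<lambda>y. H y * (cnj (F (y + u\<^sup>2)) * cnj (F' (y + (u + h)\<^sup>2))))" for u
  have \<phi>1: "norm (\<phi> u) \<le> 1" for u
    unfolding \<phi>_def by (intro ubp_norm_average_le ubp_mult Hu ubp_cnj[OF ubp_shift] F)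
  have "complex_of_real (average ?Y (\<lambda>y. (norm (H y))\<^sup>2)) = (\<Sum>u\<in>{a..<b}. \<phi> u) / of_nat N"
  proof -
    have "complex_of_real ((norm (H y))\<^sup>2) = (\<Sum>u\<in>{a..<b}. H y * (cnj (F (y + u\<^sup>2)) * cnj (F' (y + (u + h)\<^sup>2)))) * (1 / of_nat N)" for y
    proof -
      have "cnj (H y) = (\<Sum>u\<in>{a..<b}. cnj (F (y + u\<^sup>2)) * cnj (F' (y + (u + h)\<^sup>2))) * (1 / of_nat N)"
        unfolding H dual_def by simp
      then have "H y * cnj (H y) = (H y * (\<Sum>u\<in>{a..<b}. cnj (F (y + u\<^sup>2)) * cnj (F' (y + (u + h)\<^sup>2)))) * (1 / of_nat N)"
        by (simp only: mult.assoc)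
      then show ?thesis unfolding complex_norm_square sum_distrib_left .
    qed
    then have "complex_of_real (average ?Y (\<lambda>y. (norm (H y))\<^sup>2))
        = average ?Y (\<lambda>y. (\<Sum>u\<in>{a..<b}. H y * (cnj (F (y + u\<^sup>2)) * cnj (F' (y + (u + h)\<^sup>2)))) * (1 / of_nat N))"
      by (simp only: average_of_real[symmetric])
    then show ?thesis unfolding average_mult_right average_sum \<phi>_def by simp
  qed
  then have "norm (complex_of_real (average ?Y (\<lambda>y. (norm (H y))\<^sup>2))) = norm (\<Sum>u\<in>{a..<b}. \<phi> u) / real N"
    by (simp only: norm_divide norm_of_nat)
  then have "1 / K \<le> norm (\<Sum>u\<in>{a..<b}. \<phi> u) / real N" using big unfolding norm_of_real by linarith
  then have S: "real N / K \<le> norm (\<Sum>u\<in>{a..<b}. \<phi> u)" using N0 K0 by (simp add: field_simps)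
  \<comment> \<open>Five shifts below \<open>P\<close> move the window by at most
    \<open>5 * P\<close>, which costs \<open>10 * P\<close>, at most half of the main term
    \<open>N / K\<close>.\<close>
  define P where "P = nat \<lfloor>real N / (20 * K)\<rfloor>"
  have c20: "20 * K ^ 1 \<le> K ^ 6" by (rule absorb_const[OF K, of _ 5]) auto
  have "K ^ 6 \<le> real N" by (rule NK) (simp add: dual_exponent_def)
  then have "1 \<le> real N / (20 * K)" using c20 K0 by (simp add: field_simps)
  then have P: "real P \<le> real N / (20 * K)" "real N / (20 * K) / 2 \<le> real P"
    using floor_half[of "real N / (20 * K)"] by (simp_all add: P_def)
  have P1: "P \<le> N"
  proof -
    have "real N / (20 * K) \<le> real N / 1" using K N0 by (intro divide_left_mono) auto
    then show ?thesis using P(1) by simp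
  qed
  have Px: "real N / K ^ 8 \<le> real P"
  proof -
    have "40 * K ^ 1 \<le> K ^ 8" by (rule absorb_const[OF K, of _ 6]) auto
    then have "real N / K ^ 8 \<le> real N / (40 * K)" using K0 N0 by (intro divide_left_mono) auto
    then show ?thesis using P(2) by simp
  qed
  define x where "x = K ^ 8"
  \<comment> \<open>This parameter and the next have one power more than the loss of the preceding
    step, which pays for the factor 2 in the following hypothesis.\<close>
  define z where "z = K ^ 58400001"
  define w where "w = z ^ 222701"
  have x: "x \<ge> 2" "K \<le> x" and z: "z \<ge> 2" "K \<le> z" and zx: "x \<le> z"
    unfolding x_def z_def using K power_increasing[of 1 8 K] power_increasing[of 1 58400001 K] power_increasing[of 8 58400001 K] by simp_all
  have w: "w \<ge> 2" unfolding w_def using z power_increasing[of 1 222701 z] by simp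
  have xN: "x ^ 8000000 \<le> real N" unfolding x_def power_mult[symmetric] by (rule NK) (simp add: dual_exponent_def)
  have zN: "z ^ 31440 \<le> real N" unfolding z_def power_mult[symmetric] by (rule NK) (simp add: dual_exponent_def)
  have wN: "w ^ 93 \<le> real N" unfolding w_def z_def power_mult[symmetric] by (rule NK) (simp add: dual_exponent_def)
  have P0: "P > 0"
  proof -
    have "0 < real N / x" using N0 x by simp
    then show ?thesis using Px unfolding x_def by (cases P) auto
  qed
  let ?B = "{0..<int P}"
  \<comment> \<open>Two of the five shift variables are consumed by \<open>linearize\<close>, three
    by \<open>three_shifts\<close>.\<close>
  let ?T = "?B \<times> ?B \<times> ?B \<times> ?B \<times> ?B"
  let ?\<sigma> = "\<lambda>\<tau>. case \<tau> of (t, s, t1, t2, t3) \<Rightarrow> (t :: int) + s + (t1 + t2 + t3)"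
  have T: "finite ?T" "?T \<noteq> {}" using P0 by auto
  have "norm (average ?T (\<lambda>\<tau>. (\<Sum>u\<in>{a..<b}. \<phi> (u + ?\<sigma> \<tau>)) - (\<Sum>u\<in>{a..<b}. \<phi> u))) \<le> 10 * real P"
  proof (rule norm_average_le_const)
    fix \<tau> assume "\<tau> \<in> ?T"
    then have s: "0 \<le> ?\<sigma> \<tau>" "?\<sigma> \<tau> \<le> 5 * int P" by auto
    have "norm ((\<Sum>u\<in>{a..<b}. \<phi> (u + int (nat (?\<sigma> \<tau>)))) - (\<Sum>u\<in>{a..<b}. \<phi> u)) \<le> 2 * real (nat (?\<sigma> \<tau>))"
      by (rule window_shift[OF \<phi>1])
    moreover have "real (nat (?\<sigma> \<tau>)) \<le> 5 * real P" using s by linarith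
    ultimately show "norm ((\<Sum>u\<in>{a..<b}. \<phi> (u + ?\<sigma> \<tau>)) - (\<Sum>u\<in>{a..<b}. \<phi> u)) \<le> 10 * real P" using s by simp
  qed simp
  then have "norm (average ?T (\<lambda>\<tau>. \<Sum>u\<in>{a..<b}. \<phi> (u + ?\<sigma> \<tau>)) - (\<Sum>u\<in>{a..<b}. \<phi> u)) \<le> 10 * real P"
    unfolding average_diff average_const[OF T] .
  then have "norm (\<Sum>u\<in>{a..<b}. \<phi> u) - 10 * real P \<le> norm (average ?T (\<lambda>\<tau>. \<Sum>u\<in>{a..<b}. \<phi> (u + ?\<sigma> \<tau>)))"
    using norm_triangle_ineq2[of "\<Sum>u\<in>{a..<b}. \<phi> u" "average ?T (\<lambda>\<tau>. \<Sum>u\<in>{a..<b}. \<phi> (u + ?\<sigma> \<tau>))"]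
    by (simp only: norm_minus_commute)
  moreover have "10 * real P \<le> real N / (2 * K)" using P(1) K0 by (simp add: field_simps)
  moreover have "real N / K - real N / (2 * K) = real N / (2 * K)" by simp
  ultimately have S2: "real N / (2 * K) \<le> norm (\<Sum>u\<in>{a..<b}. average ?T (\<lambda>\<tau>. \<phi> (u + ?\<sigma> \<tau>)))"
    using S unfolding average_sum by linarith
  have "\<exists>u\<in>{a..<b}. 1 / (2 * K) \<le> norm (average ?T (\<lambda>\<tau>. \<phi> (u + ?\<sigma> \<tau>)))"
  proof (rule ccontr)
    assume neg: "\<not> ?thesis"
    have ne: "{a..<b} \<noteq> {}" using S2 divide_pos_pos[OF N0(2), of "2 * K"] K0 by (intro notI) simp
    have "norm (\<Sum>u\<in>{a..<b}. average ?T (\<lambda>\<tau>. \<phi> (u + ?\<sigma> \<tau>))) \<le> (\<Sum>u\<in>{a..<b}. norm (average ?T (\<lambda>\<tau>. \<phi> (u + ?\<sigma> \<tau>))))"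
      by (rule norm_sum)
    also have "\<dots> < (\<Sum>u\<in>{a..<b}. 1 / (2 * K))" using neg ne by (intro sum_strict_mono) (auto simp: not_le)
    also have "\<dots> = real (nat (b - a)) * (1 / (2 * K))" by simp
    also have "\<dots> \<le> real N * (1 / (2 * K))" using J(1) K0 by (intro mult_right_mono) auto
    finally show False using S2 by simp
  qed
  then obtain u where u: "1 / (2 * K) \<le> norm (average ?T (\<lambda>\<tau>. \<phi> (u + ?\<sigma> \<tau>)))" by blast
  let ?q = "norm (average ?B (\<lambda>t. average ?B (\<lambda>s. average ?B (\<lambda>t1. average ?B (\<lambda>t2. average ?B (\<lambda>t3. average ?Y (\<lambda>y.
      H y * ((\<lambda>y. cnj (F y)) (y + (u + t + s + (t1 + t2 + t3))\<^sup>2) * (\<lambda>y. cnj (F' y)) (y + (u + h + t + s + (t1 + t2 + t3))\<^sup>2)))))))))"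
  have "average ?T (\<lambda>\<tau>. \<phi> (u + ?\<sigma> \<tau>)) = average ?B (\<lambda>t. average ?B (\<lambda>s. average ?B (\<lambda>t1. average ?B (\<lambda>t2. average ?B (\<lambda>t3.
      \<phi> (u + (t + s + (t1 + t2 + t3))))))))"
    by (simp add: average_Times)
  also have "\<dots> = average ?B (\<lambda>t. average ?B (\<lambda>s. average ?B (\<lambda>t1. average ?B (\<lambda>t2. average ?B (\<lambda>t3. average ?Y (\<lambda>y.
      H y * ((\<lambda>y. cnj (F y)) (y + (u + t + s + (t1 + t2 + t3))\<^sup>2) * (\<lambda>y. cnj (F' y)) (y + (u + h + t + s + (t1 + t2 + t3))\<^sup>2))))))))"
    unfolding \<phi>_def by (simp add: ac_simps)
  finally have "1 / (2 * K) \<le> ?q" using u by simp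
  have "2 * K ^ 1 \<le> K ^ 8" by (rule absorb_const[OF K, of _ 1]) auto
  then have "1 / x \<le> 1 / (2 * K)" unfolding x_def using K0 by (intro divide_left_mono) auto
  then have "(1 / x) ^ 32 \<le> ?q ^ 32" using \<open>1 / (2 * K) \<le> ?q\<close> x by (intro power_mono) auto
  also have "\<dots> \<le> 32 * average {- (2 * int P)..<2 * int P} (\<lambda>v. average {- int P..<int P} (\<lambda>e. average {- int P..<int P} (\<lambda>k. average {- int P..<int P} (\<lambda>r. spread M P H k v e r))))"
    by (rule quadratic_configuration_spread[OF M0 Hu ubp_cnj[OF F(1)] ubp_cnj[OF F(2)] refl refl refl])
  finally have "(1 / x) ^ 32 \<le> \<dots>" .
  from many_large_coefficients[OF x(1) xN Px[folded x_def] P1 M Hu refl refl this]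
  have st: "1 / x ^ 7300000 \<le> average {- (2 * int P)..<2 * int P} (\<lambda>v. average {- int P..<int P} (\<lambda>e. average ?Y (\<lambda>b. supft M (diff b (diff (2 * v * e) H)))))" .
  have zz: "2 / z \<le> 1 / x ^ 7300000"
  proof -
    have "x ^ 7300000 = K ^ 58400000" unfolding x_def by (simp flip: power_mult)
    moreover have "2 * K ^ 58400000 \<le> z" unfolding z_def by (rule absorb_const[OF K, of _ 1]) auto
    ultimately show ?thesis using K0 z by (simp add: field_simps)
  qed
  have Pz: "real N / z \<le> real P"
  proof -
    have "real N / z \<le> real N / x" using zx x N0 by (intro divide_left_mono) auto
    then show ?thesis using Px unfolding x_def by linarith
  qed
  have lo2: "1 / z ^ 222700 \<le> average ?Y (\<lambda>c. supft M (diff c H))"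
    by (rule dual_lowering_two_parameters[OF z(1) zN Pz P1 M F J refl refl H order_trans[OF zz st]])
  have ww: "2 / w \<le> 1 / z ^ 222700"
  proof -
    have "2 * z ^ 222700 \<le> w" unfolding w_def by (rule absorb_const[OF z(1), of _ 1]) auto
    then show ?thesis using z w by (simp add: field_simps)
  qed
  have "1 / w ^ 656 \<le> supft M H"
    by (rule dual_lowering_one_parameter[OF w wN M F J H order_trans[OF ww lo2]])
  then show ?thesis unfolding w_def z_def power_mult[symmetric] dual_exponent_def .
qed

section \<open>A common large Fourier coefficient\<close>

definition quad_sum :: "nat \<Rightarrow> int \<Rightarrow> int \<Rightarrow> int \<Rightarrow> int \<Rightarrow> int \<Rightarrow> real" where
  "quad_sum N M a b \<beta> g = norm (\<Sum>v\<in>{a..<b}. eM M (\<beta> * v\<^sup>2 + g * v)) / real N"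

lemma quad_sum_bounds:
  assumes "b - a \<le> int N"
  shows "0 \<le> quad_sum N M a b \<beta> g" "quad_sum N M a b \<beta> g \<le> 1"
proof -
  have "norm (\<Sum>v\<in>{a..<b}. eM M (\<beta> * v\<^sup>2 + g * v)) \<le> real (card {a..<b}) * 1"
    by (rule sum_norm_bound) simp
  also have "\<dots> \<le> real N" using assms by simp
  finally show "quad_sum N M a b \<beta> g \<le> 1" by (cases "N = 0") (simp_all add: quad_sum_def)
qed (simp add: quad_sum_def)

lemma ft_dual:
  assumes M: "M > 0" and F: "ubp M F" "ubp M F'"
  shows "ft M (dual N a b h F (\<lambda>y. cnj (F' y))) \<beta>
    = (\<Sum>j\<in>{0..<M}. ft M F (j + \<beta>) * (cnj (ft M F' j) * ((\<Sum>v\<in>{a..<b}. eM M ((j + \<beta>) * v\<^sup>2 - j * (v + h)\<^sup>2)) / of_nat N)))"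
proof -
  have "ft M (dual N a b h F (\<lambda>y. cnj (F' y))) \<beta>
      = average {0..<M} (\<lambda>y. (\<Sum>v\<in>{a..<b}. F (y + v\<^sup>2) * cnj (F' (y + (v + h)\<^sup>2)) * eM M (- (\<beta> * y))) * (1 / of_nat N))"
    unfolding ft_def dual_def by (simp add: sum_distrib_right sum_divide_distrib)
  also have "\<dots> = (\<Sum>v\<in>{a..<b}. average {0..<M} (\<lambda>y. F (y + v\<^sup>2) * cnj (F' (y + (v + h)\<^sup>2)) * eM M (- (\<beta> * y)))) * (1 / of_nat N)"
    unfolding average_mult_right average_sum ..
  also have "\<dots> = (\<Sum>v\<in>{a..<b}. \<Sum>j\<in>{0..<M}. ft M F (j + \<beta>) * cnj (ft M F' j) * eM M ((j + \<beta>) * v\<^sup>2 - j * (v + h)\<^sup>2)) * (1 / of_nat N)"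
    unfolding correlation_ft[OF M F(1) ubp_cnj[OF F(2)]] by simp
  also have "\<dots> = (\<Sum>j\<in>{0..<M}. \<Sum>v\<in>{a..<b}. ft M F (j + \<beta>) * cnj (ft M F' j) * eM M ((j + \<beta>) * v\<^sup>2 - j * (v + h)\<^sup>2)) * (1 / of_nat N)"
    by (subst sum.swap) (rule refl)
  finally show ?thesis by (simp only: sum_distrib_left sum_distrib_right sum_divide_distrib mult.assoc) simp
qed

text \<open>Cauchy--Schwarz separates the two functions: \<open>F\<close> disappears by Parseval,
  and since the quadratic sums are at most 1 their squares may be replaced by first powers. In the
  remaining sums \<open>h\<close> occurs only in the linear coefficient.\<close>

lemma ft_dual_square_le:
  assumes M: "M > 0" and F: "ubp M F" "ubp M F'" and J: "b - a \<le> int N"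
  shows "(norm (ft M (dual N a b h F (\<lambda>y. cnj (F' y))) \<beta>))\<^sup>2
    \<le> (\<Sum>j\<in>{0..<M}. (norm (ft M F' j))\<^sup>2 * quad_sum N M a b \<beta> (- (2 * j * h)))"
proof -
  let ?Y = "{0..<M}"
  let ?s = "\<lambda>j. quad_sum N M a b \<beta> (- (2 * j * h))"
  note s = quad_sum_bounds[OF J]
  have S: "norm ((\<Sum>v\<in>{a..<b}. eM M ((j + \<beta>) * v\<^sup>2 - j * (v + h)\<^sup>2)) / of_nat N) = ?s j" for j
  proof -
    have e: "(j + \<beta>) * v\<^sup>2 - j * (v + h)\<^sup>2 = (\<beta> * v\<^sup>2 + - (2 * j * h) * v) + - (j * h\<^sup>2)" for v
      by (simp add: algebra_simps power2_eq_square)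
    have "(\<Sum>v\<in>{a..<b}. eM M ((j + \<beta>) * v\<^sup>2 - j * (v + h)\<^sup>2))
        = (\<Sum>v\<in>{a..<b}. eM M (\<beta> * v\<^sup>2 + - (2 * j * h) * v)) * eM M (- (j * h\<^sup>2))"
      unfolding e eM_add[of M _ "- (j * h\<^sup>2)"] sum_distrib_right ..
    then show ?thesis by (simp add: quad_sum_def norm_divide norm_mult)
  qed
  have "norm (ft M (dual N a b h F (\<lambda>y. cnj (F' y))) \<beta>) \<le> (\<Sum>j\<in>?Y. norm (ft M F (j + \<beta>)) * (norm (ft M F' j) * ?s j))"
    unfolding ft_dual[OF M F] by (rule order_trans[OF norm_sum]) (simp only: norm_mult S complex_mod_cnj order_refl)
  then have "(norm (ft M (dual N a b h F (\<lambda>y. cnj (F' y))) \<beta>))\<^sup>2 \<le> (\<Sum>j\<in>?Y. norm (ft M F (j + \<beta>)) * (norm (ft M F' j) * ?s j))\<^sup>2"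
    by (rule power_mono) simp
  also have "\<dots> \<le> (\<Sum>j\<in>?Y. (norm (ft M F (j + \<beta>)))\<^sup>2) * (\<Sum>j\<in>?Y. (norm (ft M F' j) * ?s j)\<^sup>2)"
    by (rule Cauchy_Schwarz_ineq_sum)
  also have "\<dots> \<le> 1 * (\<Sum>j\<in>?Y. (norm (ft M F' j))\<^sup>2 * ?s j)"
  proof (rule mult_mono)
    show "(\<Sum>j\<in>?Y. (norm (ft M F (j + \<beta>)))\<^sup>2) \<le> 1" by (rule parseval_shift_le[OF M F(1)])
    have "(norm (ft M F' j) * ?s j)\<^sup>2 \<le> (norm (ft M F' j))\<^sup>2 * ?s j" for j
      unfolding power_mult_distrib using s by (intro mult_left_mono) (auto simp: power2_eq_square intro: mult_left_le)
    then show "(\<Sum>j\<in>?Y. (norm (ft M F' j) * ?s j)\<^sup>2) \<le> (\<Sum>j\<in>?Y. (norm (ft M F' j))\<^sup>2 * ?s j)" by (intro sum_mono)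
  qed (simp_all add: sum_nonneg)
  finally show ?thesis by simp
qed

text \<open>The leading coefficient may vary with \<open>x\<close> in any way, because only Weyl's
  conclusion on the linear coefficient is used: for many \<open>x\<close> a multiple of
  \<open>2 * j * (x - x') / M\<close> is near an integer. With a common multiple, Vinogradov's lemma
  in \<open>x\<close> gains the missing factor \<open>1 / N\<close>.\<close>

lemma quad_sum_average_major:
  fixes K :: real and N :: nat
  assumes K: "K \<ge> 2" and N: "K ^ 256 \<le> real N" and M: "M = 2 * (int N)\<^sup>2"
    and J: "\<And>x. b x - a x \<le> int N" "\<And>x v. v \<in> {a x..<b x} \<Longrightarrow> \<bar>v\<bar> \<le> 4 * int N"
    and big: "1 / K \<le> average {1..int N} (\<lambda>x. quad_sum N M (a x) (b x) (\<beta> x) (- (2 * j * (x - x'))))"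
  shows "j \<in> major N (K ^ 256)"
proof -
  \<comment> \<open>At least \<open>2 * K\<close>, which absorbs the halving in
    \<open>average_many\<close>.\<close>
  define z where "z = K ^ 2"
  have K0: "K > 0" "K \<ge> 1" using K by auto
  have zz: "2 * K ^ 1 \<le> K ^ 2" by (rule absorb_const[OF K, of _ 1]) auto
  have z: "z \<ge> 2" "2 * K \<le> z" "z \<ge> 1" "z > 0" using zz K unfolding z_def by auto
  have zN: "z ^ n \<le> real N" if "n \<le> 128" for n
  proof -
    have "z ^ n \<le> K ^ 256" unfolding z_def power_mult[symmetric] using that K by (intro power_increasing) auto
    then show ?thesis using N by linarith
  qed
  have "z ^ 0 \<le> real N" by (rule zN) simp
  then have N0: "N > 0" "real N > 0" by (cases N; simp)+
  let ?X = "{1..int N}"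
  let ?f = "\<lambda>x. quad_sum N M (a x) (b x) (\<beta> x) (- (2 * j * (x - x')))"
  define A where "A = {x \<in> ?X. 1 / K / 2 \<le> ?f x}"
  have "1 / K / 2 * real (card ?X) \<le> real (card A)"
    unfolding A_def by (rule average_many) (use big K0 quad_sum_bounds[OF J(1)] in auto)
  then have cA: "real N / (2 * K) \<le> real (card A)" by simp
  have "real N / z \<le> real N / (2 * K)" using z K0 by (intro divide_left_mono) auto
  then have cA: "real N / z \<le> real (card A)" using cA by linarith
  have "A \<subseteq> ?X" unfolding A_def by blast
  then have fA: "finite A" by (rule finite_subset) simp
  define \<gamma> where "\<gamma> = real_of_int (- (2 * j)) / real_of_int M"
  have W: "\<exists>q::nat. 0 < q \<and> real q \<le> z ^ 31 \<and> norm_circle (real q * (\<gamma> * of_int (x - x'))) \<le> z ^ 31 / real N"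
    if "x \<in> A" for x
  proof -
    have "1 / z \<le> ?f x"
    proof -
      have "1 / z \<le> 1 / (2 * K)" using z K0 by (intro divide_left_mono) auto
      then show ?thesis using that unfolding A_def by simp
    qed
    then have "real N / z \<le> norm (\<Sum>v\<in>{a x..<b x}. eM M (\<beta> x * v\<^sup>2 + - (2 * j * (x - x')) * v))"
      unfolding quad_sum_def using N0 z(4) by (simp add: field_simps)
    also have "(\<Sum>v\<in>{a x..<b x}. eM M (\<beta> x * v\<^sup>2 + - (2 * j * (x - x')) * v))
        = (\<Sum>v\<in>{a x..<b x}. echar (of_int (\<beta> x) / of_int M * of_int (v\<^sup>2) + \<gamma> * of_int (x - x') * of_int v))"
      unfolding eM_def \<gamma>_def by (intro sum.cong refl arg_cong[where f = echar]) (simp add: add_divide_distrib diff_divide_distrib)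
    finally have "real N / z \<le> norm (\<Sum>v\<in>{a x..<b x}. echar (of_int (\<beta> x) / of_int M * of_int (v\<^sup>2) + \<gamma> * of_int (x - x') * of_int v))" .
    from weyl[OF z(1) zN[of 31] J(1)[of x] J(2)[of _ x] this] show ?thesis by auto
  qed
  define g where "g x = (SOME q::nat. 0 < q \<and> real q \<le> z ^ 31 \<and> norm_circle (real q * (\<gamma> * of_int (x - x'))) \<le> z ^ 31 / real N)" for x
  have g: "0 < g x" "real (g x) \<le> z ^ 31" "norm_circle (real (g x) * (\<gamma> * of_int (x - x'))) \<le> z ^ 31 / real N" if "x \<in> A" for x
    using someI_ex[OF W[OF that], folded g_def] by auto
  define T where "T = {1..nat \<lfloor>z ^ 31\<rfloor>}"
  have gT: "g x \<in> T" if "x \<in> A" for x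
    unfolding T_def using g(1,2)[OF that] by (simp add: le_nat_floor)
  have cT: "real (card T) \<le> z ^ 31" unfolding T_def using z by simp
  \<comment> \<open>The denominators \<open>g x\<close> take at most \<open>z ^ 31\<close> values;
    if none were this popular, \<open>A\<close> would have at most \<open>N / z ^ 2\<close>
    elements.\<close>
  obtain q where q: "real N / z ^ 33 < real (card {x \<in> A. g x = q})"
  proof (rule ccontr)
    assume "\<not> thesis"
    then have "real (card {x \<in> A. g x = t}) \<le> real N / z ^ 33" for t using that by (meson not_less)
    from card_le_fibers[OF fA, of T g, OF _ gT this] have "real (card A) \<le> real (card T) * (real N / z ^ 33)"
      by (simp add: T_def)
    also have "\<dots> \<le> z ^ 31 * (real N / z ^ 33)" using cT z N0 by (intro mult_right_mono) auto
    also have "\<dots> = real N / z ^ 2" using z by (simp add: divide_simps flip: power_add)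
    also have "\<dots> < real N / z" using z N0 by (intro divide_strict_left_mono) (auto simp: power2_eq_square)
    finally show False using cA by simp
  qed
  let ?S = "(\<lambda>x. x - x') ` {x \<in> A. g x = q}"
  have "card {x \<in> A. g x = q} > 0" using q divide_pos_pos[OF N0(2), of "z ^ 33"] z(4) by (cases "card {x \<in> A. g x = q}") auto
  then have "{x \<in> A. g x = q} \<noteq> {}" by (metis card.empty less_irrefl)
  then have q0: "0 < q" "real q \<le> z ^ 31" using g by auto
  have "\<exists>q'::nat. 0 < q' \<and> real q' \<le> 4 * z ^ 33 \<and> norm_circle (real q' * (real q * \<gamma>)) \<le> 16 * (z ^ 33)\<^sup>2 * (z ^ 31 / real N) / of_int (int N)"
  proof (rule vinogradov)
    show "?S \<subseteq> {1 - x'..<1 - x' + int N}" unfolding A_def by auto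
    show "1 \<le> z ^ 33" using z by simp
    have "card ?S = card {x \<in> A. g x = q}" by (rule card_image) (simp add: inj_on_def)
    then show "real_of_int (int N) / z ^ 33 \<le> real (card ?S)" using q by simp
    show "norm_circle (real q * \<gamma> * real_of_int l) \<le> z ^ 31 / real N" if "l \<in> ?S" for l
      using that g(3) by (auto simp: mult.assoc)
    show "0 \<le> z ^ 31 / real N" using z by simp
    have "64 * z ^ 64 \<le> z ^ 70" by (rule absorb_const[OF z(1), of _ 6]) auto
    also have "\<dots> \<le> real N" by (rule zN) simp
    finally have "32 * z ^ 64 < real N" using N0 by linarith
    then show "32 * z ^ 33 * (z ^ 31 / real N) < 1" using N0 by (simp add: field_simps flip: power_add)
    have "8 * z ^ 66 \<le> z ^ 69" by (rule absorb_const[OF z(1), of _ 3]) auto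
    also have "\<dots> \<le> real N" by (rule zN) simp
    finally show "8 * (z ^ 33)\<^sup>2 \<le> real_of_int (int N)" by (simp flip: power_mult)
  qed
  then obtain q' :: nat where q': "0 < q'" "real q' \<le> 4 * z ^ 33"
    "norm_circle (real q' * (real q * \<gamma>)) \<le> 16 * (z ^ 33)\<^sup>2 * (z ^ 31 / real N) / of_int (int N)" by blast
  have "real (2 * q * q') \<le> K ^ 256"
  proof -
    have "real (2 * q * q') = 2 * (real q * real q')" by simp
    also have "\<dots> \<le> 2 * (z ^ 31 * (4 * z ^ 33))" using q0 q' z by (intro mult_left_mono mult_mono) auto
    also have "\<dots> = 8 * z ^ 64" by (simp flip: power_add)
    also have "\<dots> \<le> z ^ 128" by (rule absorb_const[OF z(1), of _ 3]) auto
    finally show ?thesis unfolding z_def power_mult[symmetric] by simp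
  qed
  moreover have "norm_circle (real (2 * q * q') * (of_int j / of_int (2 * (int N)\<^sup>2))) \<le> K ^ 256 / (real N)\<^sup>2"
  proof -
    have "real (2 * q * q') * (of_int j / of_int (2 * (int N)\<^sup>2)) = - (real q' * (real q * \<gamma>))"
      unfolding \<gamma>_def M by simp
    then have "norm_circle (real (2 * q * q') * (of_int j / of_int (2 * (int N)\<^sup>2))) = norm_circle (real q' * (real q * \<gamma>))" by (simp only: norm_circle_minus)
    also have "\<dots> \<le> 16 * z ^ 97 / (real N)\<^sup>2" using q'(3) by (simp add: power2_eq_square mult.assoc flip: power_add power_mult)
    also have "\<dots> \<le> z ^ 128 / (real N)\<^sup>2" by (intro divide_right_mono absorb_const[OF z(1), of _ 4]) auto
    finally show ?thesis unfolding z_def power_mult[symmetric] by simp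
  qed
  ultimately show ?thesis unfolding major_def using q0 q' by (intro CollectI exI[of _ "2 * q * q'"]) auto
qed

section \<open>The counting operator\<close>

text \<open>The triangular weight is the average of the uniform weights on the windows
  \<open>{n - N<..n}\<close>: exactly \<open>N - \<bar>d\<bar>\<close> of them contain
  \<open>d\<close>. This makes it possible to pass to a single interval of values of
  \<open>d\<close>.\<close>

lemma mu_infsum:
  fixes g :: "int \<Rightarrow> complex"
  assumes N: "N > 0"
  shows "(\<Sum>\<^sub>\<infinity>d\<in>UNIV. of_real (mu N d) * g d)
    = average {0..<int N} (\<lambda>n. (\<Sum>d\<in>{n - int N<..n}. g d) / of_nat N)"
proof -
  let ?D = "{- int N..int N}"
  have mu: "mu N d = real (card {n \<in> {0..<int N}. d \<in> {n - int N<..n}}) / (real N)\<^sup>2" for d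
  proof -
    have "{n \<in> {0..<int N}. d \<in> {n - int N<..n}} = {max 0 d..<min (int N) (d + int N)}" by auto
    moreover have "card \<dots> = nat (int N - \<bar>d\<bar>)" by (cases "d \<ge> 0") (simp_all add: max_def min_def abs_if)
    moreover have "pos_part (1 - of_int \<bar>d\<bar> / real N) = real (nat (int N - \<bar>d\<bar>)) / real N"
    proof (cases "\<bar>d\<bar> \<le> int N")
      case True
      then have "real_of_int \<bar>d\<bar> \<le> real N" by linarith
      then show ?thesis using True N by (simp add: pos_part_def max_def field_simps)
    next
      case False
      then have "real N \<le> real_of_int \<bar>d\<bar>" by linarith
      then show ?thesis using False N by (simp add: pos_part_def max_def field_simps)
    qed
    ultimately show ?thesis by (simp add: mu_def power2_eq_square)
  qed
  have "mu N d = 0" if "d \<notin> ?D" for d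
  proof -
    have "{n \<in> {0..<int N}. d \<in> {n - int N<..n}} = {}" using that by auto
    then show ?thesis unfolding mu by (simp only: card.empty of_nat_0 div_0)
  qed
  then have "(\<Sum>\<^sub>\<infinity>d\<in>UNIV. of_real (mu N d) * g d) = (\<Sum>\<^sub>\<infinity>d\<in>?D. of_real (mu N d) * g d)"
    by (intro infsum_cong_neutral) auto
  also have "\<dots> = (\<Sum>d\<in>?D. (\<Sum>n\<in>{0..<int N}. if d \<in> {n - int N<..n} then g d else 0)) / (of_nat N)\<^sup>2"
  proof -
    have "of_real (mu N d) * g d = (\<Sum>n\<in>{0..<int N}. if d \<in> {n - int N<..n} then g d else 0) / (of_nat N)\<^sup>2" for d
    proof -
      have "(\<Sum>n\<in>{0..<int N}. if d \<in> {n - int N<..n} then g d else 0) = of_nat (card {n \<in> {0..<int N}. d \<in> {n - int N<..n}}) * g d"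
        by (simp only: sum.inter_filter[symmetric] finite_atLeastLessThan_int sum_constant)
      then show ?thesis unfolding mu by simp
    qed
    then show ?thesis by (simp add: sum_divide_distrib)
  qed
  also have "(\<Sum>d\<in>?D. (\<Sum>n\<in>{0..<int N}. if d \<in> {n - int N<..n} then g d else 0))
      = (\<Sum>n\<in>{0..<int N}. \<Sum>d\<in>?D. if d \<in> {n - int N<..n} then g d else 0)" by (rule sum.swap)
  also have "\<dots> = (\<Sum>n\<in>{0..<int N}. sum g {n - int N<..n})"
  proof (rule sum.cong[OF refl])
    fix n assume "n \<in> {0..<int N}"
    then have "{d \<in> ?D. d \<in> {n - int N<..n}} = {n - int N<..n}" by auto
    then show "(\<Sum>d\<in>?D. if d \<in> {n - int N<..n} then g d else 0) = sum g {n - int N<..n}"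
      by (simp only: sum.inter_filter[symmetric] finite_atLeastAtMost_int)
  qed
  finally show ?thesis by (simp add: average_complex sum_divide_distrib power2_eq_square)
qed

lemma sum_translate:
  fixes g :: "int \<Rightarrow> 'a::comm_monoid_add"
  shows "(\<Sum>u\<in>{a..<b}. g (u + c)) = (\<Sum>u\<in>{a + c..<b + c}. g u)"
  by (rule sum.reindex_bij_witness[of _ "\<lambda>u. u - c" "\<lambda>u. u + c"]) auto

text \<open>In the variable \<open>u = x + d\<close> the factor \<open>f1\<close> is free of
  \<open>x\<close>, so it is bounded away and the square doubles \<open>x\<close>. The factors
  \<open>f0\<close> then stand outside the sum over \<open>d\<close> and are bounded as well; what
  is left inside is the dual function of the pair \<open>x, x'\<close>.\<close>

lemma cauchy_schwarz_twice:
  fixes \<phi> :: "int \<Rightarrow> int \<Rightarrow> complex" and f0 f1 :: "int \<Rightarrow> int \<Rightarrow> complex"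
  assumes N: "N > 0" and M: "M = 2 * (int N)\<^sup>2" and i: "- int N < i" "i \<le> 0"
    and f: "\<And>x y. norm (f0 x y) \<le> 1" "\<And>x y. norm (f1 x y) \<le> 1" and \<phi>: "\<And>x. ubp M (\<phi> x)"
    and \<delta>: "0 \<le> \<delta>"
      "\<delta> \<le> norm (average {1..int N} (\<lambda>x. average {1..(int N)\<^sup>2} (\<lambda>y.
        (\<Sum>d\<in>{i..<i + int N}. f0 x y * f1 (x + d) y * \<phi> x (y + d\<^sup>2)) / of_nat N)))"
  shows "\<delta> ^ 4 / 32 \<le> average {1..int N} (\<lambda>x. average {1..int N} (\<lambda>x'. average {0..<M} (\<lambda>y.
    (norm (dual N (max i (i + x' - x)) (min (i + int N) (i + int N + x' - x)) (x - x') (\<phi> x) (\<lambda>y. cnj (\<phi> x' y)) y))\<^sup>2)))"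
proof -
  let ?X = "{1..int N}" and ?Y = "{1..(int N)\<^sup>2}" and ?U = "{- int N..<3 * int N}" and ?I = "{i..<i + int N}"
  define G where "G x x' = dual N (max i (i + x' - x)) (min (i + int N) (i + int N + x' - x)) (x - x') (\<phi> x) (\<lambda>y. cnj (\<phi> x' y))" for x x'
  have uG: "ubp M (G x x')" for x x'
    unfolding G_def by (rule ubp_dual[OF _ \<phi> ubp_cnj[OF \<phi>]]) simp
  \<comment> \<open>Extension by zero makes the range of \<open>u\<close> independent of
    \<open>x\<close>. That range has \<open>4 * N\<close> elements while the sum is divided by
    \<open>N\<close>, which explains the factors 4.\<close>
  define w where "w x y u = (if u - x \<in> ?I then f0 x y * \<phi> x (y + (u - x)\<^sup>2) else 0)" for x y u
  define B where "B y u = average ?X (\<lambda>x. w x y u)" for y u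
  have avU: "average ?U h = sum h ?U / (4 * of_nat N)" for h :: "int \<Rightarrow> complex"
    by (simp add: average_complex)
  have inner: "(\<Sum>d\<in>?I. f0 x y * f1 (x + d) y * \<phi> x (y + d\<^sup>2)) / of_nat N = average ?U (\<lambda>u. 4 * f1 u y * w x y u)"
    if "x \<in> ?X" for x y
  proof -
    have "(\<Sum>d\<in>?I. f0 x y * f1 (x + d) y * \<phi> x (y + d\<^sup>2)) = (\<Sum>d\<in>?I. f1 (d + x) y * w x y (d + x))"
      by (rule sum.cong) (simp_all add: w_def add.commute)
    also have "\<dots> = (\<Sum>u\<in>{i + x..<i + int N + x}. f1 u y * w x y u)" by (rule sum_translate)
    also have "\<dots> = (\<Sum>u\<in>?U. f1 u y * w x y u)"
      using that i by (intro sum.mono_neutral_left) (auto simp: w_def)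
    finally show ?thesis using N unfolding avU by (simp add: sum_distrib_left mult.assoc flip: sum_distrib_left)
  qed
  have "average ?X (\<lambda>x. average ?Y (\<lambda>y. (\<Sum>d\<in>?I. f0 x y * f1 (x + d) y * \<phi> x (y + d\<^sup>2)) / of_nat N))
      = average ?X (\<lambda>x. average ?Y (\<lambda>y. average ?U (\<lambda>u. 4 * f1 u y * w x y u)))"
    by (intro average_cong inner)
  also have "\<dots> = average ?Y (\<lambda>y. average ?X (\<lambda>x. average ?U (\<lambda>u. 4 * f1 u y * w x y u)))" by (rule average_swap)
  also have "\<dots> = average ?Y (\<lambda>y. average ?U (\<lambda>u. average ?X (\<lambda>x. 4 * f1 u y * w x y u)))"
    by (intro average_cong average_swap)
  also have "\<dots> = average ?Y (\<lambda>y. average ?U (\<lambda>u. 4 * f1 u y * B y u))"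
    unfolding average_mult_left B_def ..
  finally have e: "average ?X (\<lambda>x. average ?Y (\<lambda>y. (\<Sum>d\<in>?I. f0 x y * f1 (x + d) y * \<phi> x (y + d\<^sup>2)) / of_nat N))
      = average ?Y (\<lambda>y. average ?U (\<lambda>u. 4 * f1 u y * B y u))" .
  have "\<delta> \<le> average ?Y (\<lambda>y. average ?U (\<lambda>u. 4 * norm (B y u)))"
  proof -
    have "norm (average ?Y (\<lambda>y. average ?U (\<lambda>u. 4 * f1 u y * B y u))) \<le> average ?Y (\<lambda>y. norm (average ?U (\<lambda>u. 4 * f1 u y * B y u)))"
      by (rule norm_average_le)
    also have "\<dots> \<le> average ?Y (\<lambda>y. average ?U (\<lambda>u. norm (4 * f1 u y * B y u)))"
      by (intro average_mono norm_average_le)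
    also have "\<dots> \<le> average ?Y (\<lambda>y. average ?U (\<lambda>u. 4 * norm (B y u)))"
      using f(2) by (intro average_mono) (simp add: norm_mult mult_left_le_one_le)
    finally show ?thesis using \<delta>(2) unfolding e by linarith
  qed
  then have b1: "\<delta> / 4 \<le> average ?Y (\<lambda>y. average ?U (\<lambda>u. norm (B y u)))" unfolding average_mult_left by simp
  have B2: "average ?U (\<lambda>u. (norm (B y u))\<^sup>2) \<le> average ?X (\<lambda>x. average ?X (\<lambda>x'. norm (G x x' y) / 4))" for y
  proof -
    have ww: "average ?U (\<lambda>u. w x y u * cnj (w x' y u)) = f0 x y * cnj (f0 x' y) * (G x x' y / 4)"
      if "x \<in> ?X" "x' \<in> ?X" for x x'
    proof -
      let ?a = "max i (i + x' - x)" and ?b = "min (i + int N) (i + int N + x' - x)"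
      have "(\<Sum>u\<in>{?a..<?b}. f0 x y * cnj (f0 x' y) * (\<phi> x (y + u\<^sup>2) * cnj (\<phi> x' (y + (u + (x - x'))\<^sup>2))))
          = (\<Sum>u\<in>{?a..<?b}. w x y (u + x) * cnj (w x' y (u + x)))"
        by (rule sum.cong) (auto simp: w_def algebra_simps)
      also have "\<dots> = (\<Sum>u\<in>{?a + x..<?b + x}. w x y u * cnj (w x' y u))" by (rule sum_translate)
      also have "\<dots> = (\<Sum>u\<in>?U. w x y u * cnj (w x' y u))"
        using that i by (intro sum.mono_neutral_left) (auto simp: w_def)
      finally show ?thesis using N unfolding avU G_def dual_def sum_distrib_left[symmetric] by (metis (no_types, lifting) divide_divide_eq_left' times_divide_eq_right)
    qed
    have "complex_of_real (average ?U (\<lambda>u. (norm (B y u))\<^sup>2)) = average ?U (\<lambda>u. average ?X (\<lambda>x. average ?X (\<lambda>x'. w x y u * cnj (w x' y u))))"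
      unfolding B_def average_norm_square[symmetric] average_of_real ..
    also have "\<dots> = average ?X (\<lambda>x. average ?U (\<lambda>u. average ?X (\<lambda>x'. w x y u * cnj (w x' y u))))" by (rule average_swap)
    also have "\<dots> = average ?X (\<lambda>x. average ?X (\<lambda>x'. average ?U (\<lambda>u. w x y u * cnj (w x' y u))))"
      by (intro average_cong average_swap)
    also have "\<dots> = average ?X (\<lambda>x. average ?X (\<lambda>x'. f0 x y * cnj (f0 x' y) * (G x x' y / 4)))"
      by (intro average_cong ww)
    finally have E: "complex_of_real (average ?U (\<lambda>u. (norm (B y u))\<^sup>2))
      = average ?X (\<lambda>x. average ?X (\<lambda>x'. f0 x y * cnj (f0 x' y) * (G x x' y / 4)))" .
    have "average ?U (\<lambda>u. (norm (B y u))\<^sup>2) \<le> norm (complex_of_real (average ?U (\<lambda>u. (norm (B y u))\<^sup>2)))"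
      by (simp only: norm_of_real abs_ge_self)
    also have "\<dots> \<le> average ?X (\<lambda>x. norm (average ?X (\<lambda>x'. f0 x y * cnj (f0 x' y) * (G x x' y / 4))))"
      unfolding E by (rule norm_average_le)
    also have "\<dots> \<le> average ?X (\<lambda>x. average ?X (\<lambda>x'. norm (f0 x y * cnj (f0 x' y) * (G x x' y / 4))))"
      by (intro average_mono norm_average_le)
    also have "\<dots> \<le> average ?X (\<lambda>x. average ?X (\<lambda>x'. norm (G x x' y) / 4))"
    proof (intro average_mono)
      fix x x'
      have "norm (f0 x y) * norm (f0 x' y) * norm (G x x' y / 4) \<le> 1 * norm (G x x' y / 4)"
        using mult_mono[OF f(1)[of x y] f(1)[of x' y]] by (intro mult_right_mono) auto
      then show "norm (f0 x y * cnj (f0 x' y) * (G x x' y / 4)) \<le> norm (G x x' y) / 4" by (simp add: norm_mult norm_divide)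
    qed
    finally show ?thesis .
  qed
  have "(\<delta> / 4)\<^sup>2 \<le> (average ?Y (\<lambda>y. average ?U (\<lambda>u. norm (B y u))))\<^sup>2" using b1 \<delta>(1) by (intro power_mono) auto
  also have "\<dots> \<le> average ?Y (\<lambda>y. (average ?U (\<lambda>u. norm (B y u)))\<^sup>2)" by (rule average_square_le)
  also have "\<dots> \<le> average ?Y (\<lambda>y. average ?U (\<lambda>u. (norm (B y u))\<^sup>2))" by (intro average_mono average_square_le)
  also have "\<dots> \<le> average ?Y (\<lambda>y. average ?X (\<lambda>x. average ?X (\<lambda>x'. norm (G x x' y) * (1 / 4))))"
    using B2 by (intro average_mono) simp
  finally have "\<delta>\<^sup>2 / 4 \<le> average ?Y (\<lambda>y. average ?X (\<lambda>x. average ?X (\<lambda>x'. norm (G x x' y))))"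
    unfolding average_mult_right by (simp add: power_divide)
  then have "(\<delta>\<^sup>2 / 4)\<^sup>2 \<le> (average ?Y (\<lambda>y. average ?X (\<lambda>x. average ?X (\<lambda>x'. norm (G x x' y)))))\<^sup>2" by (intro power_mono) auto
  also have "\<dots> \<le> average ?Y (\<lambda>y. (average ?X (\<lambda>x. average ?X (\<lambda>x'. norm (G x x' y))))\<^sup>2)" by (rule average_square_le)
  also have "\<dots> \<le> average ?Y (\<lambda>y. average ?X (\<lambda>x. (average ?X (\<lambda>x'. norm (G x x' y)))\<^sup>2))" by (intro average_mono average_square_le)
  also have "\<dots> \<le> average ?Y (\<lambda>y. average ?X (\<lambda>x. average ?X (\<lambda>x'. (norm (G x x' y))\<^sup>2)))" by (intro average_mono average_square_le)
  also have "\<dots> = average ?X (\<lambda>x. average ?Y (\<lambda>y. average ?X (\<lambda>x'. (norm (G x x' y))\<^sup>2)))" by (rule average_swap)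
  also have "\<dots> = average ?X (\<lambda>x. average ?X (\<lambda>x'. average ?Y (\<lambda>y. (norm (G x x' y))\<^sup>2)))" by (intro average_cong average_swap)
  \<comment> \<open>Completing the range of \<open>y\<close> to a full period doubles the number of
    points.\<close>
  also have "\<dots> \<le> average ?X (\<lambda>x. average ?X (\<lambda>x'. 2 * average {0..<M} (\<lambda>y. (norm (G x x' y))\<^sup>2)))"
  proof (intro average_mono)
    fix x x'
    have N1: "(int N)\<^sup>2 \<ge> 1" using N by simp
    have "(\<Sum>y\<in>?Y. (norm (G x x' y))\<^sup>2) \<le> (\<Sum>y\<in>{0..<M}. (norm (G x x' y))\<^sup>2)"
      using N1 by (intro sum_mono2) (auto simp: M)
    then show "average ?Y (\<lambda>y. (norm (G x x' y))\<^sup>2) \<le> 2 * average {0..<M} (\<lambda>y. (norm (G x x' y))\<^sup>2)"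
      using N by (simp add: average_real M field_simps nat_power_eq)
  qed
  finally show ?thesis unfolding average_mult_left G_def by (simp add: power_divide)
qed

text \<open>The first factor is the exponent of the auxiliary parameter \<open>L\<close> in the next
  lemma, the second the power of \<open>L\<close> lost there.\<close>

definition final_exponent :: nat where
  "final_exponent = (12 * dual_exponent + 7) * 1794"

text \<open>The large coefficient of each dual function is bounded by the coefficients of
  \<open>\<phi> x'\<close> weighted with quadratic sums. For fixed \<open>x'\<close> the average
  over \<open>x\<close> makes these weights small except at major frequencies, a set that does not
  depend on \<open>x'\<close>; pigeonhole over it therefore gives one \<open>j\<close> for all
  \<open>x'\<close>.\<close>

lemma common_large_coefficient:
  fixes K :: real and N :: nat and \<phi> :: "int \<Rightarrow> int \<Rightarrow> complex"
  assumes K: "K \<ge> 2" and N: "K ^ final_exponent \<le> real N" and M: "M = 2 * (int N)\<^sup>2"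
    and \<phi>: "\<And>x. ubp M (\<phi> x)" and J: "\<And>x x'. b x x' - a x x' \<le> int N" "\<And>x x' v. v \<in> {a x x'..<b x x'} \<Longrightarrow> \<bar>v\<bar> \<le> 4 * int N"
    and big: "1 / K ^ 5 \<le> average {1..int N} (\<lambda>x. average {1..int N} (\<lambda>x'. average {0..<M} (\<lambda>y.
      (norm (dual N (a x x') (b x x') (x - x') (\<phi> x) (\<lambda>y. cnj (\<phi> x' y)) y))\<^sup>2)))"
  shows "\<exists>j \<in> major N (K ^ final_exponent). 1 / K ^ final_exponent \<le> average {1..int N} (\<lambda>x. norm (ft M (\<phi> x) j))"
proof -
  let ?X = "{1..int N}" and ?Y = "{0..<M}" and ?e = dual_exponent
  define G where "G x x' = dual N (a x x') (b x x') (x - x') (\<phi> x) (\<lambda>y. cnj (\<phi> x' y))" for x x'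
  have uG: "ubp M (G x x')" for x x' unfolding G_def by (rule ubp_dual[OF J(1) \<phi> ubp_cnj[OF \<phi>]])
  have K0: "K > 0" "K \<ge> 1" using K by auto
  have NK: "K ^ n \<le> real N" if "n \<le> final_exponent" for n
    by (rule order_trans[OF power_increasing[OF that K0(2)] N])
  have "K ^ 0 \<le> real N" by (rule NK) simp
  then have N0: "N > 0" "real N > 0" by (cases N; simp)+
  then have M0: "M > 0" by (simp add: M)
  \<comment> \<open>The coefficients enter squared at level \<open>K ^ 6\<close>, hence
    \<open>12 * dual_exponent\<close>; the remaining 6 is the level itself.\<close>
  define m where "m = 12 * ?e + 6"
  define L where "L = K ^ Suc m"
  have KL: "K \<le> L" unfolding L_def using self_le_power[OF K0(2), of "Suc m"] by simp
  then have L: "L \<ge> 2" "L > 0" "L \<ge> 1" using K by auto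
  have L1794: "L ^ 1794 = K ^ final_exponent" unfolding L_def m_def final_exponent_def power_mult[symmetric] by (simp add: add.commute)
  have L256: "L ^ 256 \<le> real N" using order_trans[OF power_increasing[of 256 1794 L] N[folded L1794]] L by simp
  define D where "D x x' = average ?Y (\<lambda>y. (norm (G x x' y))\<^sup>2)" for x x'
  have D1: "D x x' \<le> 1" for x x'
    unfolding D_def by (rule average_le) (use ubp_norm[OF uG[of x x']] in \<open>auto simp: power_le_one\<close>)
  define \<beta> where "\<beta> x x' = (SOME j. supft M (G x x') = norm (ft M (G x x') j))" for x x'
  have \<beta>: "supft M (G x x') = norm (ft M (G x x') (\<beta> x x'))" for x x'
    unfolding \<beta>_def by (rule someI_ex) (use supft_attained[OF M0, of "G x x'"] in blast)
  define P where "P x x' = (norm (ft M (G x x') (\<beta> x x')))\<^sup>2" for x x'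
  \<comment> \<open>Pairs with a small mean square are covered by the first term, so no set of good
    pairs has to be carried along.\<close>
  have DP: "D x x' \<le> 1 / K ^ 6 + K ^ (12 * ?e) * P x x'" for x x'
  proof (cases "1 / K ^ 6 \<le> D x x'")
    case True
    have "1 / (K ^ 6) ^ ?e \<le> supft M (G x x')"
    proof (rule dual_large_coefficient[OF _ _ M \<phi> ubp_cnj[OF \<phi>] J(1) J(2) G_def])
      have "K ^ 1 \<le> K ^ 6" using K0 by (intro power_increasing) auto
      then show "2 \<le> K ^ 6" using K by simp
      show "(K ^ 6) ^ ?e \<le> real N" unfolding power_mult[symmetric] by (rule NK) (simp add: final_exponent_def)
      show "1 / K ^ 6 \<le> average ?Y (\<lambda>y. (norm (G x x' y))\<^sup>2)" using True unfolding D_def .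
    qed
    then have "(1 / (K ^ 6) ^ ?e)\<^sup>2 \<le> P x x'" unfolding \<beta> P_def using K0 by (intro power_mono) auto
    moreover have "(1 / (K ^ 6) ^ ?e)\<^sup>2 = 1 / K ^ (12 * ?e)" by (simp add: power_divide mult.commute flip: power_mult)
    ultimately have "1 \<le> K ^ (12 * ?e) * P x x'" using K0 by (simp add: field_simps)
    then show ?thesis using D1[of x x'] K0 by (simp add: add_increasing)
  next
    case False
    have "0 \<le> K ^ (12 * ?e) * P x x'" unfolding P_def using K0 by simp
    then show ?thesis using False by linarith
  qed
  have ne: "finite ?X" "?X \<noteq> {}" using N0 by auto
  let ?P = "average ?X (\<lambda>x. average ?X (\<lambda>x'. P x x'))"
  have "1 / K ^ 5 \<le> average ?X (\<lambda>x. average ?X (\<lambda>x'. D x x'))" using big unfolding D_def G_def .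
  also have "\<dots> \<le> average ?X (\<lambda>x. average ?X (\<lambda>x'. 1 / K ^ 6 + K ^ (12 * ?e) * P x x'))" by (intro average_mono DP)
  also have "\<dots> = 1 / K ^ 6 + K ^ (12 * ?e) * ?P" unfolding average_add average_mult_left average_const[OF ne] ..
  finally have "1 / K ^ 5 - 1 / K ^ 6 \<le> K ^ (12 * ?e) * ?P" by simp
  moreover have "1 / K ^ 6 \<le> 1 / K ^ 5 - 1 / K ^ 6"
  proof -
    have "2 * K ^ 5 \<le> K ^ 6" by (rule absorb_const[OF K, of _ 1]) auto
    then have "2 / K ^ 6 \<le> 1 / K ^ 5" using K0 by (simp only: divide_le_eq le_divide_eq times_divide_eq_left zero_less_power) simp
    then show ?thesis by simp
  qed
  ultimately have "1 / K ^ 6 \<le> K ^ (12 * ?e) * ?P" by linarith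
  then have Pm: "1 / K ^ m \<le> ?P" unfolding m_def power_add using K0 by (simp add: field_simps)
  define s where "s x x' j = quad_sum N M (a x x') (b x x') (\<beta> x x') (- (2 * j * (x - x')))" for x x' j
  let ?Q = "?Y \<inter> major N (L ^ 256)"
  have s_major: "average ?X (\<lambda>x. s x x' j) \<le> 1 / L + (if j \<in> major N (L ^ 256) then 1 else 0)" for x' j
  proof (cases "j \<in> major N (L ^ 256)")
    case True
    have "average ?X (\<lambda>x. s x x' j) \<le> 1" unfolding s_def by (rule average_le) (simp_all add: quad_sum_bounds[OF J(1)])
    then show ?thesis using True L by (simp add: add_increasing)
  next
    case False
    then have "\<not> 1 / L \<le> average ?X (\<lambda>x. s x x' j)"
      using quad_sum_average_major[OF L(1) L256 M, where a = "\<lambda>x. a x x'" and b = "\<lambda>x. b x x'" and \<beta> = "\<lambda>x. \<beta> x x'" and x' = x' and j = j, OF J(1)] J(2)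
      unfolding s_def by blast
    then show ?thesis using False by simp
  qed
  have "?P \<le> average ?X (\<lambda>x. average ?X (\<lambda>x'. \<Sum>j\<in>?Y. (norm (ft M (\<phi> x') j))\<^sup>2 * s x x' j))"
    unfolding P_def G_def s_def by (intro average_mono ft_dual_square_le[OF M0 \<phi> \<phi> J(1)])
  also have "\<dots> = average ?X (\<lambda>x'. average ?X (\<lambda>x. \<Sum>j\<in>?Y. (norm (ft M (\<phi> x') j))\<^sup>2 * s x x' j))" by (rule average_swap)
  also have "\<dots> = average ?X (\<lambda>x'. \<Sum>j\<in>?Y. (norm (ft M (\<phi> x') j))\<^sup>2 * average ?X (\<lambda>x. s x x' j))"
    unfolding average_sum average_mult_left ..
  also have "\<dots> \<le> average ?X (\<lambda>x'. 1 / L + (\<Sum>j\<in>?Q. (norm (ft M (\<phi> x') j))\<^sup>2))"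
  proof (rule average_mono)
    fix x'
    let ?n = "\<lambda>j. (norm (ft M (\<phi> x') j))\<^sup>2"
    have "(\<Sum>j\<in>?Y. ?n j * average ?X (\<lambda>x. s x x' j)) \<le> (\<Sum>j\<in>?Y. ?n j * (1 / L + (if j \<in> major N (L ^ 256) then 1 else 0)))"
      by (intro sum_mono mult_left_mono s_major) simp
    also have "\<dots> = (\<Sum>j\<in>?Y. ?n j) * (1 / L) + (\<Sum>j\<in>?Y. if j \<in> major N (L ^ 256) then ?n j else 0)"
      unfolding distrib_left sum.distrib sum_distrib_right by (intro arg_cong2[where f = "(+)"] sum.cong) auto
    also have "(\<Sum>j\<in>?Y. if j \<in> major N (L ^ 256) then ?n j else 0) = (\<Sum>j\<in>?Q. ?n j)"
      by (simp only: sum.inter_restrict[symmetric] finite_atLeastLessThan_int)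
    also have "(\<Sum>j\<in>?Y. ?n j) * (1 / L) + (\<Sum>j\<in>?Q. ?n j) \<le> 1 * (1 / L) + (\<Sum>j\<in>?Q. ?n j)"
      using parseval_le[OF M0 \<phi>[of x']] L by (intro add_right_mono mult_right_mono) auto
    finally show "(\<Sum>j\<in>?Y. ?n j * average ?X (\<lambda>x. s x x' j)) \<le> 1 / L + (\<Sum>j\<in>?Q. ?n j)" by simp
  qed
  also have "\<dots> = 1 / L + (\<Sum>j\<in>?Q. average ?X (\<lambda>x'. (norm (ft M (\<phi> x') j))\<^sup>2))"
    unfolding average_add average_const[OF ne] average_sum ..
  finally have Ps: "?P \<le> 1 / L + (\<Sum>j\<in>?Q. average ?X (\<lambda>x'. (norm (ft M (\<phi> x') j))\<^sup>2))" .
  have "2 / L \<le> 1 / K ^ m" unfolding L_def using K K0 by (simp add: field_simps)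
  then have "1 / L \<le> (\<Sum>j\<in>?Q. average ?X (\<lambda>x'. (norm (ft M (\<phi> x') j))\<^sup>2))" using Pm Ps by linarith
  also have "\<dots> \<le> (\<Sum>j\<in>?Q. average ?X (\<lambda>x'. norm (ft M (\<phi> x') j)))"
    using ft_norm_le[OF \<phi>] by (intro sum_mono average_mono) (simp add: power2_eq_square mult_left_le)
  finally have S: "1 / L \<le> (\<Sum>j\<in>?Q. average ?X (\<lambda>x'. norm (ft M (\<phi> x') j)))" .
  have cQ: "real (card ?Q) \<le> L ^ 1792"
  proof -
    have "L ^ 1 \<le> L ^ 256" using L by (intro power_increasing) auto
    then have "real (card (major N (L ^ 256) \<inter> {0..<2 * (int N)\<^sup>2})) \<le> (L ^ 256) ^ 7" using L N0 by (intro card_major) auto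
    then show ?thesis unfolding M Int_commute[of "{0..<2 * (int N)\<^sup>2}"] by (simp flip: power_mult)
  qed
  \<comment> \<open>There are at most \<open>L ^ 1792\<close> major frequencies; two further powers
    of \<open>L\<close> make the contradictory total smaller than \<open>1 / L\<close>.\<close>
  have "\<exists>j\<in>?Q. 1 / L ^ 1794 \<le> average ?X (\<lambda>x'. norm (ft M (\<phi> x') j))"
  proof (rule ccontr)
    assume "\<not> ?thesis"
    then have "(\<Sum>j\<in>?Q. average ?X (\<lambda>x'. norm (ft M (\<phi> x') j))) \<le> (\<Sum>j\<in>?Q. 1 / L ^ 1794)"
      by (intro sum_mono) (auto simp: not_le intro: less_imp_le)
    also have "\<dots> = real (card ?Q) * (1 / L ^ 1794)" by simp
    also have "\<dots> \<le> L ^ 1792 * (1 / L ^ 1794)" using cQ L by (intro mult_right_mono) auto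
    also have "\<dots> = 1 / L * (1 / L)" using L power_add[of L 1792 2] by (simp add: divide_simps power2_eq_square)
    also have "\<dots> < 1 / L * 1" using L by (intro mult_strict_left_mono) auto
    finally show False using S by simp
  qed
  then obtain j where j: "j \<in> major N (L ^ 256)" "1 / L ^ 1794 \<le> average ?X (\<lambda>x'. norm (ft M (\<phi> x') j))" by blast
  have "L ^ 256 \<le> L ^ 1794" using L by (intro power_increasing) auto
  then show ?thesis using j(2) major_mono[THEN subsetD, OF _ j(1)] unfolding L1794 by blast
qed

text \<open>By \<open>mu_infsum\<close> the operator is an average over window positions, and one of
  them is at least as large as the average.\<close>

lemma lambda_slice:
  assumes N: "N > 0" and \<delta>: "\<delta> \<le> norm (Lambda N f0 f1 f2)"
  shows "\<exists>i. - int N < i \<and> i \<le> 0 \<and> \<delta> \<le> norm (average {1..int N} (\<lambda>x. average {1..(int N)\<^sup>2} (\<lambda>y.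
        (\<Sum>d\<in>{i..<i + int N}. f0 (x, y) * f1 (x + d, y) * f2 (x, y + d\<^sup>2)) / of_nat N)))"
proof -
  let ?g = "\<lambda>n x y. (\<Sum>d\<in>{n - int N<..n}. f0 (x, y) * f1 (x + d, y) * f2 (x, y + d\<^sup>2)) / of_nat N"
  let ?X = "{1..int N}" and ?Y = "{1..(int N)\<^sup>2}" and ?n = "{0..<int N}"
  have "\<lfloor>(real N)\<^sup>2\<rfloor> = (int N)\<^sup>2" using floor_of_int[of "(int N)\<^sup>2"] by (simp del: floor_of_int)
  then have "Lambda N f0 f1 f2 = average ?X (\<lambda>x. average ?Y (\<lambda>y. average ?n (\<lambda>n. ?g n x y)))"
    unfolding Lambda_def interval_upto_def by (simp add: mu_infsum[OF N] mult.assoc)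
  also have "\<dots> = average ?X (\<lambda>x. average ?n (\<lambda>n. average ?Y (\<lambda>y. ?g n x y)))" by (intro average_cong average_swap)
  also have "\<dots> = average ?n (\<lambda>n. average ?X (\<lambda>x. average ?Y (\<lambda>y. ?g n x y)))" by (rule average_swap)
  finally have "\<delta> \<le> norm (average ?n (\<lambda>n. average ?X (\<lambda>x. average ?Y (\<lambda>y. ?g n x y))))" using \<delta> by simp
  then have "\<delta> \<le> average ?n (\<lambda>n. norm (average ?X (\<lambda>x. average ?Y (\<lambda>y. ?g n x y))))"
    by (rule order_trans[OF _ norm_average_le])
  moreover have "finite ?n" "?n \<noteq> {}" using N by auto
  ultimately obtain n where n: "n \<in> ?n" "\<delta> \<le> norm (average ?X (\<lambda>x. average ?Y (\<lambda>y. ?g n x y)))"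
    using average_exists_ge[of ?n \<delta>] by blast
  have "{n - int N<..n} = {n - int N + 1..<n - int N + 1 + int N}" by auto
  then show ?thesis using n by (intro exI[of _ "n - int N + 1"]) auto
qed

lemma lambda_large:
  fixes N :: nat and \<delta> :: real
  assumes N: "N > 0" "(2 / \<delta>) ^ final_exponent \<le> real N" and \<delta>: "0 < \<delta>" "\<delta> \<le> 1" "\<delta> \<le> norm (Lambda N f0 f1 f2)"
    and f: "\<And>p. norm (f0 p) \<le> 1" "\<And>p. norm (f1 p) \<le> 1" "\<And>p. norm (f2 p) \<le> 1"
  shows "\<exists>(\<alpha>::real) (q::nat). q > 0 \<and> real q \<le> (2 / \<delta>) ^ final_exponent \<and>
    norm_circle (real q * \<alpha>) \<le> (2 / \<delta>) ^ final_exponent / (real N)\<^sup>2 \<and>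
    1 / (2 / \<delta>) ^ final_exponent \<le> average (interval_upto (real N)) (\<lambda>x.
      norm (average (interval_upto (2 * (real N)\<^sup>2)) (\<lambda>y. f2 (x, y) * echar (\<alpha> * of_int y))))"
proof -
  define K where "K = 2 / \<delta>"
  have K: "K \<ge> 2" using \<delta> by (simp add: K_def field_simps)
  define M where "M = 2 * (int N)\<^sup>2"
  have M0: "M > 0" using N by (simp add: M_def)
  \<comment> \<open>Periodisation with the representatives \<open>1..M\<close>, the range of
    \<open>y\<close> in the conclusion; every point \<open>y + d\<^sup>2\<close> that occurs lies in
    this range.\<close>
  define \<phi> where "\<phi> x y = f2 (x, (y - 1) mod M + 1)" for x y
  have u\<phi>: "ubp M (\<phi> x)" for x unfolding ubp_def \<phi>_def using f(3) by (simp add: diff_add_eq[symmetric])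
  have \<phi>_eq: "\<phi> x y = f2 (x, y)" if "1 \<le> y" "y \<le> M" for x y
    using that unfolding \<phi>_def by simp
  from lambda_slice[OF N(1) \<delta>(3)] obtain i where i: "- int N < i" "i \<le> 0" and
    big: "\<delta> \<le> norm (average {1..int N} (\<lambda>x. average {1..(int N)\<^sup>2} (\<lambda>y.
        (\<Sum>d\<in>{i..<i + int N}. f0 (x, y) * f1 (x + d, y) * f2 (x, y + d\<^sup>2)) / of_nat N)))" by blast
  have "(\<Sum>d\<in>{i..<i + int N}. f0 (x, y) * f1 (x + d, y) * f2 (x, y + d\<^sup>2)) = (\<Sum>d\<in>{i..<i + int N}. f0 (x, y) * f1 (x + d, y) * \<phi> x (y + d\<^sup>2))"
    if "y \<in> {1..(int N)\<^sup>2}" for x y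
  proof (rule sum.cong[OF refl])
    fix d assume "d \<in> {i..<i + int N}"
    then have "\<bar>d\<bar> \<le> \<bar>int N\<bar>" using i by auto
    then have "d\<^sup>2 \<le> (int N)\<^sup>2" by (simp only: abs_le_square_iff)
    then have "\<phi> x (y + d\<^sup>2) = f2 (x, y + d\<^sup>2)" using that by (intro \<phi>_eq) (auto simp: M_def add_increasing2)
    then show "f0 (x, y) * f1 (x + d, y) * f2 (x, y + d\<^sup>2) = f0 (x, y) * f1 (x + d, y) * \<phi> x (y + d\<^sup>2)" by simp
  qed
  then have "average {1..int N} (\<lambda>x. average {1..(int N)\<^sup>2} (\<lambda>y.
        (\<Sum>d\<in>{i..<i + int N}. f0 (x, y) * f1 (x + d, y) * f2 (x, y + d\<^sup>2)) / of_nat N))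
    = average {1..int N} (\<lambda>x. average {1..(int N)\<^sup>2} (\<lambda>y.
        (\<Sum>d\<in>{i..<i + int N}. (\<lambda>x y. f0 (x, y)) x y * (\<lambda>x y. f1 (x, y)) (x + d) y * \<phi> x (y + d\<^sup>2)) / of_nat N))"
    by (intro average_cong arg_cong[where f = "\<lambda>z. z / of_nat N"]) simp
  then have "\<delta> \<le> norm (average {1..int N} (\<lambda>x. average {1..(int N)\<^sup>2} (\<lambda>y.
        (\<Sum>d\<in>{i..<i + int N}. (\<lambda>x y. f0 (x, y)) x y * (\<lambda>x y. f1 (x, y)) (x + d) y * \<phi> x (y + d\<^sup>2)) / of_nat N)))"
    using big by simp
  from cauchy_schwarz_twice[OF N(1) M_def i _ _ u\<phi> less_imp_le[OF \<delta>(1)] this] f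
  have "\<delta> ^ 4 / 32 \<le> average {1..int N} (\<lambda>x. average {1..int N} (\<lambda>x'. average {0..<M} (\<lambda>y.
    (norm (dual N (max i (i + x' - x)) (min (i + int N) (i + int N + x' - x)) (x - x') (\<phi> x) (\<lambda>y. cnj (\<phi> x' y)) y))\<^sup>2)))"
    by simp
  moreover have "1 / K ^ 5 \<le> \<delta> ^ 4 / 32"
  proof -
    have "2 * K ^ 4 \<le> K ^ 5" by (rule absorb_const[OF K, of _ 1]) auto
    then have "1 / K ^ 5 \<le> 1 / (2 * K ^ 4)" using K by (intro divide_left_mono) auto
    also have "\<dots> = \<delta> ^ 4 / 32" using \<delta> by (simp add: K_def power_divide)
    finally show ?thesis .
  qed
  ultimately have "1 / K ^ 5 \<le> average {1..int N} (\<lambda>x. average {1..int N} (\<lambda>x'. average {0..<M} (\<lambda>y.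
    (norm (dual N (max i (i + x' - x)) (min (i + int N) (i + int N + x' - x)) (x - x') (\<phi> x) (\<lambda>y. cnj (\<phi> x' y)) y))\<^sup>2)))"
    by linarith
  then have "\<exists>j \<in> major N (K ^ final_exponent). 1 / K ^ final_exponent \<le> average {1..int N} (\<lambda>x. norm (ft M (\<phi> x) j))"
    using i by (intro common_large_coefficient[OF K N(2)[folded K_def] M_def u\<phi>]) auto
  then obtain j where j: "j \<in> major N (K ^ final_exponent)"
    "1 / K ^ final_exponent \<le> average {1..int N} (\<lambda>x. norm (ft M (\<phi> x) j))" by blast
  \<comment> \<open>The sign is reversed because \<open>ft\<close> carries the conjugate
    character.\<close>
  define \<alpha> where "\<alpha> = - (of_int j / of_int M :: real)"
  have fl: "\<lfloor>2 * (real N)\<^sup>2\<rfloor> = M" using floor_of_int[of M] by (simp add: M_def del: floor_of_int)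
  have "ft M (\<phi> x) j = average {1..M} (\<lambda>y. f2 (x, y) * echar (\<alpha> * of_int y))" for x
  proof -
    \<comment> \<open>By periodicity the period \<open>{0..<M}\<close> may be moved by one to
      \<open>{1..M}\<close>, where \<open>\<phi>\<close> agrees with \<open>f2\<close>.\<close>
    have "(\<Sum>y\<in>{0..<M}. \<phi> x y * eM M (- (j * y))) = (\<Sum>y\<in>{0..<M}. (\<lambda>y. \<phi> x y * eM M (- (j * y))) (y + 1))"
    proof (rule sum_periodic_shift[OF M0, symmetric])
      fix y
      have "- (j * (y + M)) = - (j * y) + (- j) * M" by (simp add: algebra_simps)
      then have "eM M (- (j * (y + M))) = eM M (- (j * y))" using M0 by (simp only: eM_periodic)
      then show "\<phi> x (y + M) * eM M (- (j * (y + M))) = \<phi> x y * eM M (- (j * y))"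
        using u\<phi>[of x] by (simp only: ubp_def)
    qed
    also have "\<dots> = (\<Sum>y\<in>{0 + 1..<M + 1}. \<phi> x y * eM M (- (j * y)))" by (rule sum_translate)
    also have "{0 + 1..<M + 1} = {1..M}" by auto
    also have "(\<Sum>y\<in>{1..M}. \<phi> x y * eM M (- (j * y))) = (\<Sum>y\<in>{1..M}. f2 (x, y) * echar (\<alpha> * of_int y))"
      by (rule sum.cong) (simp_all add: \<phi>_eq eM_def \<alpha>_def)
    finally show ?thesis unfolding ft_def average_complex using M0 by simp
  qed
  then have "1 / K ^ final_exponent \<le> average (interval_upto (real N)) (\<lambda>x.
      norm (average (interval_upto (2 * (real N)\<^sup>2)) (\<lambda>y. f2 (x, y) * echar (\<alpha> * of_int y))))"
    using j(2) unfolding interval_upto_def fl by simp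
  moreover obtain q :: nat where q: "0 < q" "real q \<le> K ^ final_exponent" "norm_circle (real q * (of_int j / of_int M)) \<le> K ^ final_exponent / (real N)\<^sup>2"
    using j(1) unfolding major_def M_def by blast
  moreover have n: "norm_circle (real q * \<alpha>) = norm_circle (real q * (of_int j / of_int M))"
    unfolding \<alpha>_def mult_minus_right by (rule norm_circle_minus)
  ultimately show ?thesis unfolding K_def[symmetric] by (intro exI[of _ \<alpha>] exI[of _ q]) simp
qed

text \<open>Ensures \<open>\<delta> \<le> 1\<close>, so that raising the exponent only weakens the
  bounds.\<close>

lemma lambda_norm_le_1:
  assumes N: "N > 0" and f: "\<And>p. norm (f0 p) \<le> 1" "\<And>p. norm (f1 p) \<le> 1" "\<And>p. norm (f2 p) \<le> 1"
  shows "norm (Lambda N f0 f1 f2) \<le> 1"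
proof -
  obtain i where i: "norm (Lambda N f0 f1 f2) \<le> norm (average {1..int N} (\<lambda>x. average {1..(int N)\<^sup>2} (\<lambda>y.
        (\<Sum>d\<in>{i..<i + int N}. f0 (x, y) * f1 (x + d, y) * f2 (x, y + d\<^sup>2)) / of_nat N)))"
    using lambda_slice[OF N order_refl] by blast
  also have "\<dots> \<le> 1"
  proof (intro norm_average_le_const)
    fix x y
    have "norm (f0 (x, y)) * norm (f1 (x + d, y)) * norm (f2 (x, y + d\<^sup>2)) \<le> 1" for d
      using f by (intro mult_le_one) auto
    then have "norm (\<Sum>d\<in>{i..<i + int N}. f0 (x, y) * f1 (x + d, y) * f2 (x, y + d\<^sup>2)) \<le> real (card {i..<i + int N}) * 1"
      by (intro sum_norm_bound) (simp add: norm_mult)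
    then show "norm ((\<Sum>d\<in>{i..<i + int N}. f0 (x, y) * f1 (x + d, y) * f2 (x, y + d\<^sup>2)) / of_nat N) \<le> 1"
      using N by (simp add: norm_divide)
  qed simp_all
  finally show ?thesis .
qed

theorem theorem5p2:
  shows "\<exists>C::real. \<exists>c::real. C \<ge> 1 \<and> c > 0 \<and>
    (\<forall>(N::nat) (\<delta>::real) (f0::int \<times> int \<Rightarrow> complex) (f1::int \<times> int \<Rightarrow> complex) (f2::int \<times> int \<Rightarrow> complex).
       N > 0 \<longrightarrow> \<delta> > 0 \<longrightarrow>
       (\<forall>p. norm (f0 p) \<le> 1) \<longrightarrow> (\<forall>p. norm (f1 p) \<le> 1) \<longrightarrow> (\<forall>p. norm (f2 p) \<le> 1) \<longrightarrow>
       norm (Lambda N f0 f1 f2) \<ge> \<delta> \<longrightarrow>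
       real N \<le> C * \<delta> powr (- C) \<or>
       (\<exists>(\<alpha>::real) (q::nat).
          q > 0 \<and> real q \<le> C * \<delta> powr (- C) \<and>
          norm_circle (real q * \<alpha>) \<le> C * \<delta> powr (- C) / real N ^ 2 \<and>
          average (interval_upto (real N)) (\<lambda>x.
            norm (average (interval_upto (2 * real N ^ 2)) (\<lambda>y.
              f2 (x, y) * echar (\<alpha> * of_int y)))) \<ge> c * \<delta> powr C))"
proof -
  \<comment> \<open>The single \<open>C\<close> acts both as a factor, where
    \<open>(2 / \<delta>) ^ final_exponent\<close> requires \<open>2 ^ final_exponent\<close>, and
    as an exponent, where it must be at least \<open>final_exponent\<close>.\<close>
  define C :: real where "C = 2 ^ final_exponent"
  have C: "real final_exponent \<le> C" "C \<ge> 1" unfolding C_def using of_nat_less_two_power[of final_exponent, where ?'a = real] by auto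
  have "real N \<le> C * \<delta> powr (- C) \<or>
       (\<exists>(\<alpha>::real) (q::nat).
          q > 0 \<and> real q \<le> C * \<delta> powr (- C) \<and>
          norm_circle (real q * \<alpha>) \<le> C * \<delta> powr (- C) / real N ^ 2 \<and>
          average (interval_upto (real N)) (\<lambda>x.
            norm (average (interval_upto (2 * real N ^ 2)) (\<lambda>y.
              f2 (x, y) * echar (\<alpha> * of_int y)))) \<ge> 1 / C * \<delta> powr C)"
    if N: "N > 0" and \<delta>: "\<delta> > 0" and f: "\<forall>p. norm (f0 p) \<le> 1" "\<forall>p. norm (f1 p) \<le> 1" "\<forall>p. norm (f2 p) \<le> 1"
      and big: "norm (Lambda N f0 f1 f2) \<ge> \<delta>" for N \<delta> and f0 f1 f2 :: "int \<times> int \<Rightarrow> complex"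
  proof -
    have \<delta>1: "\<delta> \<le> 1" by (rule order_trans[OF big lambda_norm_le_1[OF N]]) (use f in auto)
    let ?K = "(2 / \<delta>) ^ final_exponent"
    have eq: "?K = C * \<delta> powr (- real final_exponent)"
      using \<delta> by (simp add: C_def power_divide powr_minus powr_realpow divide_inverse power_inverse)
    also have "\<dots> \<le> C * \<delta> powr (- C)" using C \<delta> \<delta>1 by (intro mult_left_mono powr_mono') auto
    finally have KC: "?K \<le> C * \<delta> powr (- C)" .
    have "1 / C * \<delta> powr C \<le> 1 / C * \<delta> powr (real final_exponent)"
      using C \<delta> \<delta>1 by (intro mult_left_mono powr_mono') auto
    also have "\<dots> = 1 / ?K" unfolding eq using \<delta> by (simp add: powr_minus field_simps)
    finally have cK: "1 / C * \<delta> powr C \<le> 1 / ?K" .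
    show ?thesis
    proof (cases "?K \<le> real N")
      case False
      then show ?thesis using KC by linarith
    next
      case True
      obtain \<alpha> :: real and q :: nat where q: "q > 0" "real q \<le> ?K"
        "norm_circle (real q * \<alpha>) \<le> ?K / (real N)\<^sup>2"
        "1 / ?K \<le> average (interval_upto (real N)) (\<lambda>x.
          norm (average (interval_upto (2 * (real N)\<^sup>2)) (\<lambda>y. f2 (x, y) * echar (\<alpha> * of_int y))))"
        using lambda_large[OF N True \<delta> \<delta>1 big] f by blast
      have "?K / (real N)\<^sup>2 \<le> C * \<delta> powr (- C) / (real N)\<^sup>2" using KC by (rule divide_right_mono) simp
      then show ?thesis using q KC cK by (intro disjI2 exI[of _ \<alpha>] exI[of _ q]) auto
    qed
  qed
  then show ?thesis using C by (intro exI[of _ C] exI[of _ "1 / C"]) auto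
qed

end
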